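(* The $\mathbb{Z}$-lattice $I_2\perp A_3\perp\langle 3\rangle$ of rank $6$ is an isolation of $I_3$, and no lattice of rank less than $6$ is an isolation of $I_3$. Hence $\mathrm{Iso}(I_3)=6$.
   Context: All $\mathbb{Z}$-lattices are positive definite with integral Gram matrix. $M$ is represented by $L$ if there is a linear map $\sigma:M\to L$ preserving the quadratic form. $\langle a_1,\dots,a_k\rangle$ denotes the diagonal lattice, $\perp$ the orthogonal sum, $I_n=\langle 1,\dots,1\rangle$ ($n$ ones). $A_3$ is the root lattice $\{(a_0,\dots,a_3)\in\mathbb{Z}^4: a_0+\dots+a_3=0\}$, with Gram matrix $\begin{pmatrix}2&-1&0\\-1&2&-1\\0&-1&2\end{pmatrix}$. A lattice $L$ is an isolation of $\ell$ if $L$ represents every sublattice of $\ell$ except $\ell$ itself, and does not represent $\ell$. $\mathrm{Iso}(\ell)$ is the minimum rank of an isolation of $\ell$. *)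

theory Defs
  imports "Jordan_Normal_Form.Matrix"
begin

text \<open>
  A \<open>\<int>\<close>-lattice of rank \<open>n\<close> is given by its Gram matrix \<open>G\<close> with respect to a basis, so the
  lattice itself is \<open>\<int>\<^sup>n\<close>, that is \<^term>\<open>carrier_vec n :: int vec set\<close>, equipped with the bilinear
  form \<open>B(x, y) = x\<^sup>T G y\<close>. Rank \<open>0\<close> is allowed.
\<close>

definition lat_rank :: "int mat \<Rightarrow> nat" where
  "lat_rank G = dim_row G"

definition lat_vecs :: "int mat \<Rightarrow> int vec set" where
  "lat_vecs G = carrier_vec (lat_rank G)"

definition lat_bform :: "int mat \<Rightarrow> int vec \<Rightarrow> int vec \<Rightarrow> int" where
  "lat_bform G x y = x \<bullet> (G *\<^sub>v y)"

definition lat_qform :: "int mat \<Rightarrow> int vec \<Rightarrow> int" where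
  "lat_qform G x = lat_bform G x x"

definition zlattice :: "int mat \<Rightarrow> bool" where
  "zlattice G \<longleftrightarrow> square_mat G \<and> transpose_mat G = G \<and>
     (\<forall>x\<in>lat_vecs G. x \<noteq> 0\<^sub>v (lat_rank G) \<longrightarrow> 0 < lat_qform G x)"

text \<open>
  Sublattices of \<open>G\<close> are the \<open>\<int>\<close>-submodules, i.e. the additive subgroups, of \<^term>\<open>lat_vecs G\<close>,
  of any rank, with the form inherited from \<open>G\<close>.
\<close>

definition sublattice :: "int vec set \<Rightarrow> int mat \<Rightarrow> bool" where
  "sublattice M G \<longleftrightarrow> subgroup M (monoid_vec TYPE(int) (lat_rank G))"

text \<open>\<open>represents L M G\<close>: the lattice \<open>L\<close> represents the sublattice \<open>M\<close> of \<open>G\<close>.\<close>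

definition represents :: "int mat \<Rightarrow> int vec set \<Rightarrow> int mat \<Rightarrow> bool" where
  "represents L M G \<longleftrightarrow> (\<exists>\<sigma>. \<sigma> \<in> M \<rightarrow> lat_vecs L \<and>
     (\<forall>x\<in>M. \<forall>y\<in>M. \<sigma> (x + y) = \<sigma> x + \<sigma> y) \<and>
     (\<forall>c. \<forall>x\<in>M. \<sigma> (c \<cdot>\<^sub>v x) = c \<cdot>\<^sub>v \<sigma> x) \<and>
     (\<forall>x\<in>M. lat_qform L (\<sigma> x) = lat_qform G x))"

definition isolation :: "int mat \<Rightarrow> int mat \<Rightarrow> bool" where
  "isolation L G \<longleftrightarrow> zlattice L \<and> zlattice G \<and>
     (\<forall>M. sublattice M G \<and> M \<noteq> lat_vecs G \<longrightarrow> represents L M G) \<and>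
     \<not> represents L (lat_vecs G) G"

text \<open>This is only meaningful for \<open>G\<close> that have an isolation, since \<open>LEAST\<close> is unspecified otherwise.\<close>

definition Iso :: "int mat \<Rightarrow> nat" where
  "Iso G = (LEAST r. \<exists>L. isolation L G \<and> lat_rank L = r)"

definition diag_lat :: "int list \<Rightarrow> int mat" where
  "diag_lat as = mat_diag (length as) (\<lambda>i. as ! i)"

definition I_lat :: "nat \<Rightarrow> int mat" where
  "I_lat n = diag_lat (replicate n 1)"

definition orth_sum :: "int mat \<Rightarrow> int mat \<Rightarrow> int mat" (infixr "\<bottom>\<^sub>L" 65) where
  "G \<bottom>\<^sub>L H = four_block_mat G (0\<^sub>m (dim_row G) (dim_col H)) (0\<^sub>m (dim_row H) (dim_col G)) H"

definition A3_lat :: "int mat" where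
  "A3_lat = mat_of_rows_list 3 [[2, -1, 0], [-1, 2, -1], [0, -1, 2]]"

text \<open>
  \<^const>\<open>A3_lat\<close> is the Gram matrix of the root lattice of vectors in \<open>\<int>\<^sup>4\<close> with coordinate sum \<open>0\<close>,
  for the basis \<open>e\<^sub>0 - e\<^sub>1\<close>, \<open>e\<^sub>1 - e\<^sub>2\<close>, \<open>e\<^sub>2 - e\<^sub>3\<close>.
\<close>

definition A3_root_lattice :: "int vec set" where
  "A3_root_lattice = {a \<in> carrier_vec 4. (\<Sum>i<4. a $ i) = 0}"

definition A3_embed :: "int vec \<Rightarrow> int vec" where
  "A3_embed x = vec_of_list [x $ 0, x $ 1 - x $ 0, x $ 2 - x $ 1, - x $ 2]"

lemma A3_embed_index:
  "dim_vec (A3_embed x) = 4" "A3_embed x $ 0 = x $ 0" "A3_embed x $ Suc 0 = x $ 1 - x $ 0"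
  "A3_embed x $ 2 = x $ 2 - x $ 1" "A3_embed x $ 3 = - x $ 2"
  by (simp_all add: A3_embed_def numeral_2_eq_2 numeral_3_eq_3)

lemma lat_vecs_A3: "lat_vecs A3_lat = carrier_vec 3"
  by (simp add: lat_vecs_def lat_rank_def A3_lat_def mat_of_rows_list_def numeral_3_eq_3)

lemma A3_embed_bij: "bij_betw A3_embed (lat_vecs A3_lat) A3_root_lattice"
proof -
  define g :: "int vec \<Rightarrow> int vec" where "g a = vec_of_list [a $ 0, a $ 0 + a $ 1, - a $ 3]" for a
  have g: "dim_vec (g a) = 3" "g a $ 0 = a $ 0" "g a $ Suc 0 = a $ 0 + a $ 1" "g a $ 2 = - a $ 3" for a
    by (simp_all add: g_def numeral_2_eq_2 numeral_3_eq_3)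
  have lt3: "i = 0 \<or> i = 1 \<or> i = 2" if "i < 3" for i :: nat using that by linarith
  have lt4: "i = 0 \<or> i = 1 \<or> i = 2 \<or> i = 3" if "i < 4" for i :: nat using that by linarith
  have sum4: "(\<Sum>i<4. f i) = f 0 + f 1 + f 2 + f 3" for f :: "nat \<Rightarrow> int"
    by (simp add: eval_nat_numeral)
  have 1: "g (A3_embed x) = x" if "x \<in> carrier_vec 3" for x
    by (rule eq_vecI) (use that in \<open>auto simp: g A3_embed_index dest!: lt3\<close>)
  have 2: "A3_embed (g a) = a" if "a \<in> A3_root_lattice" for a
    by (rule eq_vecI)
      (use that in \<open>auto simp: g A3_embed_index A3_root_lattice_def sum4 dest!: lt4\<close>)
  show ?thesis
    unfolding lat_vecs_A3
  proof (rule bij_betw_byWitness[where f' = g])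
    show "A3_embed ` carrier_vec 3 \<subseteq> A3_root_lattice"
      by (auto simp: A3_root_lattice_def sum4 A3_embed_index intro!: carrier_vecI)
    show "g ` A3_root_lattice \<subseteq> carrier_vec 3"
      by (auto simp: g intro!: carrier_vecI)
  qed (simp_all add: 1 2)
qed

lemma A3_embed_add:
  assumes "x \<in> lat_vecs A3_lat" "y \<in> lat_vecs A3_lat"
  shows "A3_embed (x + y) = A3_embed x + A3_embed y"
proof (rule eq_vecI)
  fix i assume "i < dim_vec (A3_embed x + A3_embed y)"
  then have "i = 0 \<or> i = 1 \<or> i = 2 \<or> i = 3" by (simp add: A3_embed_index) linarith
  then show "A3_embed (x + y) $ i = (A3_embed x + A3_embed y) $ i"
    using assms by (auto simp: A3_embed_index lat_vecs_A3)
qed (simp add: A3_embed_index)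

lemma A3_embed_form:
  assumes "x \<in> lat_vecs A3_lat" "y \<in> lat_vecs A3_lat"
  shows "A3_embed x \<bullet> A3_embed y = lat_bform A3_lat x y"
proof -
  have "{0..<4} = {0, 1, 2, 3 :: nat}" "{0..<3} = {0, 1, 2 :: nat}" by auto
  moreover have "dim_vec x = 3" "dim_vec y = 3" using assms by (auto simp: lat_vecs_A3)
  ultimately show ?thesis
    by (simp add: lat_bform_def A3_lat_def mat_of_rows_list_def scalar_prod_def A3_embed_index
        algebra_simps flip: numeral_2_eq_2)
qed

end

theory Submission
  imports Defs "Jordan_Normal_Form.Determinant"
begin

text \<open>
  A proper sublattice of \<open>I\<^sub>3\<close> lies in some \<open>M = {x. p dvd x\<^sub>i + b x\<^sub>j + c x\<^sub>k}\<close> with \<open>p\<close> prime. The root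
  lattice \<open>A\<^sub>3\<close> is \<open>D\<^sub>3\<close>, the triples of even sum, so \<open>M\<close> is represented as soon as
  \<open>x \<bullet> x = l\<^sub>0\<^sup>2 + \<dots> + l\<^sub>4\<^sup>2 + 3 w\<^sup>2\<close> on \<open>M\<close> for additive \<open>l\<^sub>r\<close>, \<open>w\<close> with \<open>l\<^sub>0 + l\<^sub>1 + l\<^sub>2\<close> even. For \<open>p \<ge> 5\<close>
  the lattice \<open>M\<close> embeds into a \<open>p\<close>-neighbour of \<open>I\<^sub>5 \<bottom> \<langle>3\<rangle>\<close>, and by Hermite reduction this neighbour is
  again isometric to \<open>I\<^sub>5 \<bottom> \<langle>3\<rangle>\<close>, which gives \<open>l\<^sub>r\<close> and \<open>w\<close>. Their parities are determined by the values
  at three orthogonal vectors of norm \<open>p\<^sup>2\<close>. If \<open>w\<close> is not even, then among these parities there always is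
  a triple \<open>l\<^sub>i, l\<^sub>j, l\<^sub>k\<close> with even sum, perhaps after replacing four of the \<open>l\<^sub>r\<close> by \<open>s - l\<^sub>r\<close>, with
  \<open>2 s\<close> their sum. If \<open>w\<close> is even, then so are two of the \<open>l\<^sub>r\<close>, and a \<open>2\<close>-adic descent on these two
  and \<open>w\<close> makes \<open>w\<close> odd somewhere.

  Conversely, let a lattice of rank at most \<open>5\<close> represent \<open>\<langle>1, 1, 9\<rangle>\<close> by \<open>f\<^sub>1, f\<^sub>2, g\<close> and also \<open>D\<^sub>3\<close>, but not
  \<open>I\<^sub>3\<close>. Since no further unit vector is orthogonal to \<open>f\<^sub>1, f\<^sub>2\<close>, the roots of \<open>D\<^sub>3\<close> are orthogonal to both, so
  \<open>g\<close> lies in the rational span of \<open>D\<^sub>3\<close> for reasons of rank. Then some \<open>g - v\<close> with \<open>v\<close> in \<open>D\<^sub>3\<close> is such a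
  unit vector.
\<close>

subsection \<open>Hermite reduction\<close>

text \<open>For odd \<open>p\<close> the lattice \<open>M\<close> already sits in I_5 + <3> through
  x |-> (x, 0, 0, 0), but there the first three coordinates take all parities on \<open>M\<close>,
  and no triple of the five unit coordinates has even sum throughout. The neighbour serves to
  replace this embedding. Let h = (1, b, c, k1, k2, 1), with k1 and k2 chosen so that its norm in
  I_5 + <3> vanishes modulo \<open>p\<close>. Every (x, 0, 0, 0) with x in \<open>M\<close> has
  product divisible by \<open>p\<close> with h, so it survives in the neighbour at h. The gain is
  that the image of \<open>M\<close> in the neighbour is primitive. Once the neighbour is identified
  with I_5 + <3>, this image cannot lie in three of the unit coordinates, because \<open>M\<close>
  would then contain an orthonormal basis and be all of I_3. That is exactly the non-degeneracy
  which starts the descent. The primes 2 and 3 get explicit formulas instead: lifting h to a vector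
  of norm divisible by p^2 uses that \<open>p\<close> is odd, and keeping the invariant at 3 uses
  that 3 does not divide \<open>p\<close>.\<close>

abbreviation rmat :: "int mat \<Rightarrow> rat mat" where
  "rmat \<equiv> map_mat rat_of_int"

definition unimodular :: "nat \<Rightarrow> int mat \<Rightarrow> bool" where
  "unimodular n T \<longleftrightarrow> T \<in> carrier_mat n n \<and> (\<exists>T' \<in> carrier_mat n n. T * T' = 1\<^sub>m n \<and> T' * T = 1\<^sub>m n)"

definition congr :: "'a :: comm_ring_1 mat \<Rightarrow> 'a mat \<Rightarrow> 'a mat" where
  "congr P G = P\<^sup>T * G * P"

definition posdef :: "nat \<Rightarrow> 'a :: {comm_ring_1, linorder} mat \<Rightarrow> bool" where
  "posdef n G \<longleftrightarrow> G \<in> carrier_mat n n \<and> G\<^sup>T = G \<and>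
    (\<forall>x \<in> carrier_vec n. x \<noteq> 0\<^sub>v n \<longrightarrow> 0 < x \<bullet> (G *\<^sub>v x))"

definition lead_minor :: "'a :: comm_ring_1 mat \<Rightarrow> nat \<Rightarrow> 'a" where
  "lead_minor G i = det (mat i i (\<lambda>(r, c). G $$ (r, c)))"

lemma unimodularI:
  "T \<in> carrier_mat n n \<Longrightarrow> T' \<in> carrier_mat n n \<Longrightarrow> T * T' = 1\<^sub>m n \<Longrightarrow> T' * T = 1\<^sub>m n \<Longrightarrow> unimodular n T"
  unfolding unimodular_def by blast

lemma unimodular_one: "unimodular n (1\<^sub>m n)"
  by (rule unimodularI[of _ _ "1\<^sub>m n"]) auto

lemma unimodular_mult:
  assumes "unimodular n S" "unimodular n T" shows "unimodular n (S * T)"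
proof -
  obtain S' T' where *: "S \<in> carrier_mat n n" "T \<in> carrier_mat n n"
    "S' \<in> carrier_mat n n" "S * S' = 1\<^sub>m n" "S' * S = 1\<^sub>m n"
    "T' \<in> carrier_mat n n" "T * T' = 1\<^sub>m n" "T' * T = 1\<^sub>m n"
    using assms unfolding unimodular_def by auto
  have "S * T * (T' * S') = S * (T * T') * S'"
    using * by (smt (verit) assoc_mult_mat mult_carrier_mat)
  moreover have "T' * S' * (S * T) = T' * (S' * S) * T"
    using * by (smt (verit) assoc_mult_mat mult_carrier_mat)
  ultimately show ?thesis
    using * by (intro unimodularI[of _ _ "T' * S'"]) auto
qed

lemma unimodular_det:
  assumes "unimodular n T" shows "det T * det T = 1"
proof -
  obtain T' where "T \<in> carrier_mat n n" "T' \<in> carrier_mat n n" "T * T' = 1\<^sub>m n"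
    using assms unfolding unimodular_def by auto
  then have "det T * det T' = 1" by (metis det_mult det_one)
  then have "det T = 1 \<or> det T = -1" by (auto simp: zmult_eq_1_iff)
  then show ?thesis by auto
qed

lemma congr_carrier: "P \<in> carrier_mat n n \<Longrightarrow> G \<in> carrier_mat n n \<Longrightarrow> congr P G \<in> carrier_mat n n"
  unfolding congr_def by auto

lemma congr_mult:
  fixes G :: "'a :: comm_ring_1 mat"
  assumes "P \<in> carrier_mat n n" "Q \<in> carrier_mat n n" "G \<in> carrier_mat n n"
  shows "congr (P * Q) G = congr Q (congr P G)"
proof -
  have t: "P\<^sup>T \<in> carrier_mat n n" "Q\<^sup>T \<in> carrier_mat n n" using assms by auto
  have "congr (P * Q) G = (Q\<^sup>T * P\<^sup>T) * G * (P * Q)"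
    unfolding congr_def using transpose_mult assms by metis
  also have "\<dots> = Q\<^sup>T * (P\<^sup>T * G * P) * Q"
    using assms t by (smt (verit) assoc_mult_mat mult_carrier_mat)
  finally show ?thesis unfolding congr_def .
qed

lemma congr_form:
  fixes G :: "'a :: comm_ring_1 mat"
  assumes "P \<in> carrier_mat n n" "G \<in> carrier_mat n n" "x \<in> carrier_vec n" "y \<in> carrier_vec n"
  shows "x \<bullet> (congr P G *\<^sub>v y) = (P *\<^sub>v x) \<bullet> (G *\<^sub>v (P *\<^sub>v y))"
proof -
  have "congr P G *\<^sub>v y = P\<^sup>T *\<^sub>v (G *\<^sub>v (P *\<^sub>v y))"
    unfolding congr_def using assms by (smt (verit) assoc_mult_mat_vec mult_carrier_mat mult_mat_vec_carrier transpose_carrier_mat)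
  moreover have "x \<bullet> (P\<^sup>T *\<^sub>v v) = (P *\<^sub>v x) \<bullet> v" if "v \<in> carrier_vec n" for v
    by (metis assms(1,3) that comm_scalar_prod mult_mat_vec_carrier transpose_carrier_mat transpose_vec_mult_scalar)
  ultimately show ?thesis using assms by simp
qed

lemma congr_symmetric:
  fixes G :: "'a :: comm_ring_1 mat"
  assumes "P \<in> carrier_mat n n" "G \<in> carrier_mat n n" "G\<^sup>T = G"
  shows "(congr P G)\<^sup>T = congr P G"
  unfolding congr_def using assms
  by (smt (verit) assoc_mult_mat mult_carrier_mat transpose_carrier_mat transpose_mult transpose_transpose)

lemma nonzero_vec_index:
  fixes x :: "'a :: zero vec"
  assumes "x \<in> carrier_vec n" "x \<noteq> 0\<^sub>v n"
  obtains i where "i < n" "x $ i \<noteq> 0"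
proof -
  have "x = 0\<^sub>v n" if "\<And>i. i < n \<Longrightarrow> x $ i = 0" using assms(1) that by (intro eq_vecI) auto
  then show ?thesis using assms(2) that by blast
qed

lemma mult_mat_zero_vec: "A \<in> carrier_mat m n \<Longrightarrow> A *\<^sub>v 0\<^sub>v n = (0\<^sub>v m :: 'a :: comm_ring_1 vec)"
  by (rule eq_vecI) auto

lemma posdef_congr:
  fixes G :: "'a :: {comm_ring_1, linorder} mat"
  assumes "posdef n G" "P \<in> carrier_mat n n" "P' \<in> carrier_mat n n" "P' * P = 1\<^sub>m n"
  shows "posdef n (congr P G)"
proof -
  have G: "G \<in> carrier_mat n n" using assms unfolding posdef_def by auto
  have "0 < x \<bullet> (congr P G *\<^sub>v x)" if x: "x \<in> carrier_vec n" "x \<noteq> 0\<^sub>v n" for x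
  proof -
    have "P' *\<^sub>v (P *\<^sub>v x) = x" using assms x
      by (metis assoc_mult_mat_vec one_mult_mat_vec)
    then have "P *\<^sub>v x \<noteq> 0\<^sub>v n" using x mult_mat_zero_vec[OF assms(3)] by metis
    then show ?thesis using assms G x by (simp add: congr_form posdef_def)
  qed
  then show ?thesis using assms G by (auto simp: posdef_def congr_carrier congr_symmetric)
qed

lemma det_congr:
  fixes G :: "'a :: comm_ring_1 mat"
  assumes "P \<in> carrier_mat n n" "G \<in> carrier_mat n n"
  shows "det (congr P G) = det P * det P * det G"
  unfolding congr_def using assms by (simp add: det_mult[of _ n] det_transpose[of _ n])

lemma rmat_one: "rmat (1\<^sub>m n) = 1\<^sub>m n"
  by (rule eq_matI) auto

lemma rmat_mult: "A \<in> carrier_mat n m \<Longrightarrow> B \<in> carrier_mat m k \<Longrightarrow> rmat (A * B) = rmat A * rmat B"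
  by (rule of_int_hom.mat_hom_mult)

lemma rmat_transpose: "rmat (A\<^sup>T) = (rmat A)\<^sup>T"
  by (rule eq_matI) auto

lemma rmat_congr:
  assumes "P \<in> carrier_mat n n" "G \<in> carrier_mat n n"
  shows "rmat (congr P G) = congr (rmat P) (rmat G)"
  unfolding congr_def using assms
  by (simp add: rmat_mult[of _ n n _ n] rmat_transpose)

lemma posdef_congr_unimodular:
  assumes "posdef n G" "unimodular n T" shows "posdef n (congr (rmat T) G)"
proof -
  obtain T' where "T \<in> carrier_mat n n" "T' \<in> carrier_mat n n" "T' * T = 1\<^sub>m n"
    using assms unfolding unimodular_def by auto
  then show ?thesis using assms(1)
    by (intro posdef_congr[of _ _ _ "rmat T'"]) (auto simp flip: rmat_mult simp: rmat_one)
qed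

section \<open>Splitting a Gram matrix along its first basis vector\<close>

definition unip :: "nat \<Rightarrow> 'a :: comm_ring_1 mat \<Rightarrow> 'a mat" where
  "unip n q = four_block_mat (1\<^sub>m 1) q (0\<^sub>m n 1) (1\<^sub>m n)"

definition dsum :: "nat \<Rightarrow> 'a :: comm_ring_1 \<Rightarrow> 'a mat \<Rightarrow> 'a mat" where
  "dsum n a X = four_block_mat (mat 1 1 (\<lambda>_. a)) (0\<^sub>m 1 n) (0\<^sub>m n 1) X"

lemma unip_carrier [simp]: "q \<in> carrier_mat 1 n \<Longrightarrow> unip n q \<in> carrier_mat (Suc n) (Suc n)"
  unfolding unip_def using four_block_carrier_mat[of "1\<^sub>m 1" 1 1 "1\<^sub>m n" n n] by simp

lemma dsum_carrier [simp]: "X \<in> carrier_mat n n \<Longrightarrow> dsum n a X \<in> carrier_mat (Suc n) (Suc n)"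
  unfolding dsum_def using four_block_carrier_mat[of "mat 1 1 (\<lambda>_. a)" 1 1 X n n] by simp

lemma unip_mult:
  assumes "q \<in> carrier_mat 1 n" "r \<in> carrier_mat 1 n"
  shows "unip n q * unip n r = unip n (r + q)"
  unfolding unip_def using assms
  by (subst mult_four_block_mat[of _ 1 1 _ n _ n _ _ 1 _ n]) auto

lemma unip_zero: "unip n (0\<^sub>m 1 n) = 1\<^sub>m (Suc n)"
  unfolding unip_def using four_block_one_mat[of 1 n] by simp

lemma dsum_mult:
  assumes "X \<in> carrier_mat n n" "Y \<in> carrier_mat n n"
  shows "dsum n a X * dsum n b Y = dsum n (a * b) (X * Y)"
  unfolding dsum_def using assms
  by (subst mult_four_block_mat[of _ 1 1 _ n _ n _ _ 1 _ n]) (auto simp: scalar_prod_def)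

lemma dsum_one: "dsum n 1 (1\<^sub>m n) = 1\<^sub>m (Suc n)"
  by (rule eq_matI) (auto simp: dsum_def)

lemma dsum_transpose:
  assumes "X \<in> carrier_mat n n"
  shows "(dsum n a X)\<^sup>T = dsum n a (X\<^sup>T)"
  using assms by (intro eq_matI) (auto simp: dsum_def)

lemma dsum_unip:
  assumes "X \<in> carrier_mat n n" "q \<in> carrier_mat 1 n"
  shows "dsum n 1 X * unip n q = four_block_mat (1\<^sub>m 1) q (0\<^sub>m n 1) X"
proof -
  have "mat 1 1 (\<lambda>_. 1) = (1\<^sub>m 1 :: 'a mat)" by (rule eq_matI) auto
  then show ?thesis
  unfolding unip_def dsum_def using assms
  by (subst mult_four_block_mat[of _ 1 1 _ n _ n _ _ 1 _ n]) auto
qed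

lemma unip_dsum:
  assumes "X \<in> carrier_mat n n" "q \<in> carrier_mat 1 n"
  shows "unip n q * dsum n 1 X = dsum n 1 X * unip n (q * X)"
proof -
  have "mat 1 1 (\<lambda>_. 1) = (1\<^sub>m 1 :: 'a mat)" by (rule eq_matI) auto
  then show ?thesis
  unfolding dsum_unip[OF assms(1) mult_carrier_mat[OF assms(2,1)]]
  unfolding unip_def dsum_def using assms
  by (subst mult_four_block_mat[of _ 1 1 _ n _ n _ _ 1 _ n]) auto
qed

lemma det_unip: "q \<in> carrier_mat 1 n \<Longrightarrow> det (unip n (q :: 'a :: idom mat)) = 1"
  unfolding unip_def by (subst det_four_block_mat_lower_left_zero[of _ 1 _ n]) auto

lemma det_dsum: "X \<in> carrier_mat n n \<Longrightarrow> det (dsum n a (X :: 'a :: idom mat)) = a * det X"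
  unfolding dsum_def by (subst det_four_block_mat_lower_left_zero[of _ 1 _ n]) (auto simp: det_single)

lemma congr_dsum:
  assumes "X \<in> carrier_mat n n" "Y \<in> carrier_mat n n"
  shows "congr (dsum n 1 Y) (dsum n a X) = dsum n a (congr Y X)"
  unfolding congr_def using assms by (simp add: dsum_transpose dsum_mult)

lemma dsum_mult_vec:
  assumes "X \<in> carrier_mat n n" "x \<in> carrier_vec n"
  shows "dsum n a X *\<^sub>v (vec 1 (\<lambda>_. c) @\<^sub>v x) = vec 1 (\<lambda>_. a * c) @\<^sub>v (X *\<^sub>v x)"
  unfolding dsum_def using assms
  by (subst four_block_mat_mult_vec[of _ 1 1 _ n _ n]) (auto intro!: arg_cong2[where f = append_vec] eq_vecI simp: scalar_prod_def)

lemma dsum_form: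
  assumes "X \<in> carrier_mat n n" "x \<in> carrier_vec n" "y \<in> carrier_vec n"
  shows "(vec 1 (\<lambda>_. c) @\<^sub>v x) \<bullet> (dsum n a X *\<^sub>v (vec 1 (\<lambda>_. d) @\<^sub>v y)) = a * c * d + x \<bullet> (X *\<^sub>v y)"
  unfolding dsum_mult_vec[OF assms(1,3)] using assms
  by (subst scalar_prod_append[of _ 1 _ n]) (auto simp: scalar_prod_def)

text \<open>This is the first Gram-Schmidt step: \<open>a\<close> is the norm of the first basis
  vector, \<open>q\<close> the row of projection coefficients of the other vectors onto it, and
  \<open>X\<close> the Gram matrix of their projections to its orthogonal complement.\<close>

definition bordered :: "nat \<Rightarrow> 'a :: comm_ring_1 \<Rightarrow> 'a mat \<Rightarrow> 'a mat \<Rightarrow> 'a mat" where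
  "bordered n a q X = congr (unip n q) (dsum n a X)"

lemma bordered_index:
  assumes "q \<in> carrier_mat 1 n" "X \<in> carrier_mat n n" "i < Suc n" "j < Suc n"
  shows "bordered n a q X $$ (i, j) =
    (if i = 0 then (if j = 0 then a else a * q $$ (0, j - 1))
     else if j = 0 then a * q $$ (0, i - 1) else a * q $$ (0, i - 1) * q $$ (0, j - 1) + X $$ (i - 1, j - 1))"
proof -
  have t: "(unip n q)\<^sup>T = four_block_mat (1\<^sub>m 1) (0\<^sub>m 1 n) (q\<^sup>T) (1\<^sub>m n)"
    unfolding unip_def using assms by (subst transpose_four_block_mat[of _ 1 1 _ n _ n]) auto
  have "bordered n a q X = four_block_mat (mat 1 1 (\<lambda>_. a)) (mat 1 1 (\<lambda>_. a) * q)
      (q\<^sup>T * mat 1 1 (\<lambda>_. a)) (q\<^sup>T * mat 1 1 (\<lambda>_. a) * q + X)"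
    unfolding bordered_def congr_def t unfolding unip_def dsum_def using assms
    by (subst mult_four_block_mat[of _ 1 1 _ n _ n _ _ 1 _ n]; (simp; fail)?)+ auto
  then show ?thesis using assms
    by (auto simp: scalar_prod_def)
qed

lemma bordered_carrier [simp]:
  "q \<in> carrier_mat 1 n \<Longrightarrow> X \<in> carrier_mat n n \<Longrightarrow> bordered n a q X \<in> carrier_mat (Suc n) (Suc n)"
  unfolding bordered_def by (simp add: congr_carrier)

lemma dim_bordered [simp]:
  assumes "q \<in> carrier_mat 1 n" "X \<in> carrier_mat n n"
  shows "dim_row (bordered n a q X) = Suc n" "dim_col (bordered n a q X) = Suc n"
  using bordered_carrier[OF assms] by auto

text \<open>Truncation commutes with bordering, and the unipotent factor has determinant 1, so only
  \<open>a\<close> and the minor of \<open>X\<close> remain.\<close>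

lemma lead_minor_bordered:
  fixes q :: "'a :: idom mat"
  assumes "q \<in> carrier_mat 1 n" "X \<in> carrier_mat n n" "i \<le> n"
  shows "lead_minor (bordered n a q X) (Suc i) = a * lead_minor X i"
proof -
  define q' where "q' = mat 1 i (\<lambda>(r, c). q $$ (r, c))"
  define X' where "X' = mat i i (\<lambda>(r, c). X $$ (r, c))"
  have c: "q' \<in> carrier_mat 1 i" "X' \<in> carrier_mat i i" by (auto simp: q'_def X'_def)
  have "mat (Suc i) (Suc i) (\<lambda>(r, c). bordered n a q X $$ (r, c)) = bordered i a q' X'"
  proof (rule eq_matI)
    fix r s assume "r < dim_row (bordered i a q' X')" "s < dim_col (bordered i a q' X')"
    then have "r < Suc i" "s < Suc i" using c by auto
    then show "mat (Suc i) (Suc i) (\<lambda>(r, c). bordered n a q X $$ (r, c)) $$ (r, s) = bordered i a q' X' $$ (r, s)"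
      using assms unfolding bordered_index[OF c \<open>r < Suc i\<close> \<open>s < Suc i\<close>]
      by (auto simp: bordered_index[OF assms(1,2)]) (auto simp: q'_def X'_def)
  qed (use c in auto)
  then have "lead_minor (bordered n a q X) (Suc i) = det (bordered i a q' X')"
    by (simp add: lead_minor_def)
  also have "\<dots> = a * det X'"
    unfolding bordered_def using c by (simp add: det_congr[of _ "Suc i"] det_unip det_dsum)
  finally show ?thesis by (simp add: lead_minor_def X'_def)
qed

text \<open>A basis change \<open>T\<close> of the projected lattice is lifted, and multiples
  \<open>k\<close> of the first vector are then added to the others. The corner \<open>a\<close>
  survives, and \<open>k\<close> merely shifts the projection coefficients, which is what makes
  rounding them possible.\<close>

lemma congr_bordered:
  assumes "r \<in> carrier_mat 1 n" "X \<in> carrier_mat n n" "T \<in> carrier_mat n n" "k \<in> carrier_mat 1 n"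
  shows "congr (dsum n 1 T * unip n k) (bordered n a r X) = bordered n a (k + r * T) (congr T X)"
proof -
  have "unip n r * (dsum n 1 T * unip n k) = unip n r * dsum n 1 T * unip n k"
    using assms by (simp add: assoc_mult_mat[of _ "Suc n" "Suc n" _ "Suc n" _ "Suc n"])
  also have "\<dots> = dsum n 1 T * (unip n (r * T) * unip n k)"
    using assms unip_carrier[of "r * T" n] by (simp add: unip_dsum assoc_mult_mat[of _ "Suc n" "Suc n" _ "Suc n" _ "Suc n"])
  also have "\<dots> = dsum n 1 T * unip n (k + r * T)"
    using assms by (simp add: unip_mult)
  finally have e: "unip n r * (dsum n 1 T * unip n k) = dsum n 1 T * unip n (k + r * T)" .
  have c: "k + r * T \<in> carrier_mat 1 n" using assms by auto
  have "congr (dsum n 1 T * unip n k) (congr (unip n r) (dsum n a X))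
      = congr (unip n r * (dsum n 1 T * unip n k)) (dsum n a X)"
    using assms by (intro congr_mult[of _ "Suc n", symmetric] mult_carrier_mat[of _ _ "Suc n"]) auto
  also have "\<dots> = congr (unip n (k + r * T)) (congr (dsum n 1 T) (dsum n a X))"
    unfolding e using assms c by (intro congr_mult[of _ "Suc n"]) auto
  finally show ?thesis
    unfolding bordered_def using assms by (simp add: congr_dsum)
qed

lemma bordered_of_mat:
  fixes R :: "'a :: field mat"
  assumes R: "R \<in> carrier_mat (Suc n) (Suc n)" "R\<^sup>T = R" "R $$ (0,0) \<noteq> 0"
  obtains r X where "r \<in> carrier_mat 1 n" "X \<in> carrier_mat n n" "R = bordered n (R $$ (0,0)) r X"
proof -
  define a where "a = R $$ (0,0)"
  define r where "r = mat 1 n (\<lambda>(_, j). R $$ (0, Suc j) / a)"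
  define X where "X = mat n n (\<lambda>(i, j). R $$ (Suc i, Suc j) - R $$ (0, Suc i) * R $$ (0, Suc j) / a)"
  have s: "R $$ (i, j) = R $$ (j, i)" if "i < Suc n" "j < Suc n" for i j
    using R that by (metis carrier_matD index_transpose_mat(1))
  have c: "r \<in> carrier_mat 1 n" "X \<in> carrier_mat n n" by (auto simp: r_def X_def)
  have "R = bordered n a r X"
  proof (rule eq_matI)
    fix i j assume "i < dim_row (bordered n a r X)" "j < dim_col (bordered n a r X)"
    then have "i < Suc n" "j < Suc n" using c by auto
    then show "R $$ (i, j) = bordered n a r X $$ (i, j)"
      using assms s[of i 0] by (cases i; cases j) (auto simp: bordered_index[OF c], auto simp: a_def r_def X_def)
  qed (use R c in auto)
  with that c show ?thesis unfolding a_def by blast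
qed

lemma posdef_dsum:
  fixes X :: "'a :: {comm_ring_1, linorder} mat"
  assumes pd: "posdef (Suc n) (dsum n a X)" and X: "X \<in> carrier_mat n n"
  shows "posdef n X"
proof -
  have sym: "X\<^sup>T = X"
  proof (rule eq_matI)
    fix i j assume ij: "i < dim_row X" "j < dim_col X"
    have "(dsum n a X)\<^sup>T $$ (Suc i, Suc j) = dsum n a X $$ (Suc i, Suc j)"
      using pd by (simp add: posdef_def)
    then show "X\<^sup>T $$ (i, j) = X $$ (i, j)" using ij X by (simp add: dsum_def)
  qed (use X in auto)
  have "0 < x \<bullet> (X *\<^sub>v x)" if x: "x \<in> carrier_vec n" "x \<noteq> 0\<^sub>v n" for x
  proof -
    obtain i where i: "i < n" "x $ i \<noteq> 0" using nonzero_vec_index[OF x] .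
    then have "(vec 1 (\<lambda>_. 0) @\<^sub>v x) $ Suc i \<noteq> 0\<^sub>v (Suc n) $ Suc i" using x by simp
    then have "vec 1 (\<lambda>_. 0) @\<^sub>v x \<noteq> 0\<^sub>v (Suc n)" by metis
    moreover have "vec 1 (\<lambda>_. 0) @\<^sub>v x \<in> carrier_vec (Suc n)" using x append_carrier_vec[of "vec 1 (\<lambda>_. 0)" 1 x n] by simp
    ultimately have "0 < (vec 1 (\<lambda>_. 0) @\<^sub>v x) \<bullet> (dsum n a X *\<^sub>v (vec 1 (\<lambda>_. 0) @\<^sub>v x))"
      using pd unfolding posdef_def by blast
    also have "\<dots> = x \<bullet> (X *\<^sub>v x)"
      using dsum_form[OF X x(1) x(1), where a = a and c = 0 and d = 0] by simp
    finally show ?thesis .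
  qed
  with sym X show ?thesis by (simp add: posdef_def)
qed

lemma posdef_bordered:
  fixes q :: "'a :: {comm_ring_1, linorder} mat"
  assumes "posdef (Suc n) (bordered n a q X)" "q \<in> carrier_mat 1 n" "X \<in> carrier_mat n n"
  shows "posdef n X"
proof -
  have m: "- q \<in> carrier_mat 1 n" using assms by auto
  have "unip n q * unip n (-q) = 1\<^sub>m (Suc n)" "unip n (-q) * unip n q = 1\<^sub>m (Suc n)"
    using assms m by (simp_all add: unip_mult flip: unip_zero) (auto intro!: arg_cong[where f = "unip n"])
  note u = this
  then have pd: "posdef (Suc n) (congr (unip n (-q)) (bordered n a q X))"
    using assms m by (intro posdef_congr[of _ _ _ "unip n q"]) auto
  have one: "congr (1\<^sub>m (Suc n)) D = D" if "D \<in> carrier_mat (Suc n) (Suc n)" for D :: "'a mat"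
    using that by (simp add: congr_def transpose_one)
  have "congr (unip n (-q)) (bordered n a q X) = dsum n a X"
    unfolding bordered_def using assms m u by (simp add: congr_mult[of _ "Suc n", symmetric] one)
  with pd show ?thesis using posdef_dsum assms(3) by simp
qed

lemma mat_unit_vec_col:
  fixes A :: "'a :: comm_ring_1 mat"
  assumes "A \<in> carrier_mat n m" "j < m" shows "A *\<^sub>v unit_vec m j = col A j"
  using assms by (intro eq_vecI) (auto simp: scalar_prod_right_unit)

lemma posdef_diag_pos:
  fixes R :: "'a :: {comm_ring_1, linorder} mat"
  assumes "posdef n R" "i < n" shows "0 < R $$ (i, i)"
proof -
  have R: "R \<in> carrier_mat n n" using assms unfolding posdef_def by auto
  have "unit_vec n i \<bullet> (R *\<^sub>v unit_vec n i) = R $$ (i, i)"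
    using assms R by (simp add: mat_unit_vec_col scalar_prod_left_unit)
  moreover have "unit_vec n i \<noteq> (0\<^sub>v n :: 'a vec)" using assms(2)
    by (metis index_unit_vec(1) index_zero_vec(1) zero_neq_one)
  ultimately show ?thesis using assms unfolding posdef_def by (metis unit_vec_carrier)
qed

lemma congr_index:
  fixes G :: "'a :: comm_ring_1 mat"
  assumes P: "P \<in> carrier_mat n n" "G \<in> carrier_mat n n" and r: "r < n" "s < n"
  shows "congr P G $$ (r, s) = col P r \<bullet> (G *\<^sub>v col P s)"
proof -
  have C: "congr P G \<in> carrier_mat n n" using P by (rule congr_carrier)
  have "congr P G $$ (r, s) = unit_vec n r \<bullet> (congr P G *\<^sub>v unit_vec n s)"
    unfolding mat_unit_vec_col[OF C r(2)] using r carrier_matD[OF C]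
    by (subst scalar_prod_left_unit[of _ n]) (auto intro!: carrier_vecI)
  then show ?thesis
    unfolding congr_form[OF P unit_vec_carrier unit_vec_carrier] mat_unit_vec_col[OF P(1) r(1)] mat_unit_vec_col[OF P(1) r(2)] .
qed

lemma congr_swap_index:
  fixes R :: "'a :: comm_ring_1 mat"
  assumes "R \<in> carrier_mat n n" "k < n"
  shows "congr (swaprows_mat n 0 k) R $$ (0, 0) = R $$ (k, k)"
proof -
  have n: "0 < n" using assms by auto
  have c: "col (swaprows_mat n 0 k) 0 = (unit_vec n k :: 'a vec)"
    using assms n by (intro eq_vecI) (auto simp: swaprows_mat_def)
  have "congr (swaprows_mat n 0 k) R $$ (0, 0) = unit_vec n k \<bullet> (R *\<^sub>v unit_vec n k)"
    using congr_index[of "swaprows_mat n 0 k" n R 0 0] assms n by (simp add: c)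
  then show ?thesis using assms by (simp add: mat_unit_vec_col scalar_prod_left_unit)
qed

lemma unimodular_swap: "k < n \<Longrightarrow> unimodular n (swaprows_mat n 0 k)"
  by (rule unimodularI[of _ _ "swaprows_mat n 0 k"]) (auto intro!: swaprows_mat_inv)

section \<open>Minimal vectors and the reduction theorem\<close>

lemma common_denominator:
  "finite A \<Longrightarrow> \<exists>D > 0. \<forall>x \<in> A. \<exists>z. rat_of_int D * x = of_int z"
proof (induction rule: finite_induct)
  case (insert x A)
  then obtain D where D: "D > 0" "\<And>x. x \<in> A \<Longrightarrow> \<exists>z. rat_of_int D * x = of_int z" by auto
  obtain a b where x: "x = of_int a / of_int b" "b > 0" by (metis quotient_of_denom_pos quotient_of_div surj_pair)
  have "rat_of_int (D * b) * x = of_int (D * a)" using x by simp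
  moreover have "\<exists>z. rat_of_int (D * b) * y = of_int z" if y: "y \<in> A" for y
  proof -
    obtain z where "rat_of_int D * y = of_int z" using D(2) y by blast
    then have "rat_of_int (D * b) * y = of_int (z * b)" by (simp add: mult.commute mult.left_commute)
    then show ?thesis by blast
  qed
  ultimately have "\<forall>y \<in> insert x A. \<exists>z. rat_of_int (D * b) * y = of_int z" by blast
  then show ?case using D x(2) by (intro exI[of _ "D * b"]) simp
qed (auto intro: exI[of _ 1])

text \<open>After multiplication by a common denominator \<open>D\<close> the corners over all bases
  are positive integers, so a least one exists.\<close>

lemma minimal_corner:
  assumes "posdef n G" "0 < n"
  obtains T where "unimodular n T"
    "\<And>T'. unimodular n T' \<Longrightarrow> congr (rmat T) G $$ (0, 0) \<le> congr (rmat T') G $$ (0, 0)"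
proof -
  have G: "G \<in> carrier_mat n n" using assms unfolding posdef_def by auto
  have "finite ((\<lambda>(i, j). G $$ (i, j)) ` ({..<n} \<times> {..<n}))" by auto
  from common_denominator[OF this] obtain D
    where D: "D > 0" "\<And>i j. i < n \<Longrightarrow> j < n \<Longrightarrow> \<exists>z. rat_of_int D * G $$ (i, j) = of_int z" by auto
  define H where "H = mat n n (\<lambda>(i, j). \<lfloor>rat_of_int D * G $$ (i, j)\<rfloor>)"
  have H: "H \<in> carrier_mat n n" "rmat H = rat_of_int D \<cdot>\<^sub>m G"
  proof -
    show "rmat H = rat_of_int D \<cdot>\<^sub>m G"
    proof (rule eq_matI)
      fix i j assume "i < dim_row (rat_of_int D \<cdot>\<^sub>m G)" "j < dim_col (rat_of_int D \<cdot>\<^sub>m G)"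
      then have ij: "i < n" "j < n" using G by auto
      then obtain z where "rat_of_int D * G $$ (i, j) = of_int z" using D(2) by blast
      then show "rmat H $$ (i, j) = (rat_of_int D \<cdot>\<^sub>m G) $$ (i, j)" using ij G by (simp add: H_def)
    qed (use G in \<open>auto simp: H_def\<close>)
  qed (simp add: H_def)
  have val: "rat_of_int D * congr (rmat T) G $$ (0, 0) = of_int (congr T H $$ (0, 0))" if "unimodular n T" for T
  proof -
    have T: "T \<in> carrier_mat n n" using that by (auto simp: unimodular_def)
    then have rT: "rmat T \<in> carrier_mat n n" by simp
    have "rmat (congr T H) = congr (rmat T) (rat_of_int D \<cdot>\<^sub>m G)"
      unfolding rmat_congr[OF T H(1)] H(2) ..
    also have "\<dots> = rat_of_int D \<cdot>\<^sub>m congr (rmat T) G"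
      unfolding congr_def using rT G
      by (simp add: mult_smult_distrib[of _ n n _ n] mult_smult_assoc_mat[of _ n n _ n])
    finally have "rmat (congr T H) $$ (0, 0) = (rat_of_int D \<cdot>\<^sub>m congr (rmat T) G) $$ (0, 0)" by simp
    then show ?thesis
      using carrier_matD[OF congr_carrier[OF T H(1)]] carrier_matD[OF congr_carrier[OF rT G]] assms(2) by simp
  qed
  define m where "m T = nat (congr T H $$ (0, 0))" for T
  obtain T where T: "unimodular n T" "\<And>T'. unimodular n T' \<Longrightarrow> m T \<le> m T'"
    using ex_has_least_nat[of "unimodular n" "1\<^sub>m n" m] unimodular_one by blast
  have pos: "0 < congr S H $$ (0, 0)" if "unimodular n S" for S
  proof -
    have "0 < congr (rmat S) G $$ (0, 0)"
      using posdef_diag_pos posdef_congr_unimodular assms that by blast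
    then have "0 < rat_of_int D * congr (rmat S) G $$ (0, 0)" using D by simp
    then show ?thesis unfolding val[OF that] by simp
  qed
  have "congr (rmat T) G $$ (0, 0) \<le> congr (rmat T') G $$ (0, 0)" if T': "unimodular n T'" for T'
  proof -
    have "congr T H $$ (0, 0) \<le> congr T' H $$ (0, 0)"
      using T(2)[OF T'] pos[OF T'] pos[OF T(1)] by (simp add: m_def)
    then have "rat_of_int D * congr (rmat T) G $$ (0, 0) \<le> rat_of_int D * congr (rmat T') G $$ (0, 0)"
      using T T' by (simp add: val)
    then show ?thesis using D by simp
  qed
  with T(1) that show ?thesis by blast
qed

text \<open>The quotients of successive leading minors are the squared lengths of the Gram-Schmidt vectors.\<close>

definition reduced :: "nat \<Rightarrow> rat mat \<Rightarrow> bool" where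
  "reduced n R \<longleftrightarrow>
    (\<forall>i \<le> n. 0 < lead_minor R i) \<and>
    (\<forall>i < n. R $$ (0, 0) \<le> R $$ (i, i)) \<and>
    (\<forall>i < n. 0 < i \<longrightarrow> 2 * \<bar>R $$ (0, i)\<bar> \<le> R $$ (0, 0)) \<and>
    (\<forall>i. Suc i < n \<longrightarrow> 3 * (lead_minor R (Suc i))\<^sup>2 \<le> 4 * lead_minor R i * lead_minor R (Suc (Suc i))) \<and>
    (\<forall>i < n. R $$ (i, i) \<le> lead_minor R (Suc i) / lead_minor R i
        + (\<Sum>j<i. lead_minor R (Suc j) / lead_minor R j) / 4)"

lemma lead_minor_0 [simp]: "lead_minor R 0 = 1"
  by (simp add: lead_minor_def)

text \<open>The first basis vector is taken with least corner, the projected lattice is reduced by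
  induction, and its basis is lifted with projection coefficients of absolute value at most 1/2.
  Minimality then gives a <= Y(0,0) + a/4, the first inequality between minors. The others come from
  the projected lattice, multiplied by a^2.\<close>

theorem hermite_reduction:
  assumes "posdef n G"
  shows "\<exists>T. unimodular n T \<and> reduced n (congr (rmat T) G)"
  using assms
proof (induction n arbitrary: G)
  case 0
  then show ?case using unimodular_one[of 0] by (intro exI[of _ "1\<^sub>m 0"]) (auto simp: reduced_def)
next
  case (Suc n)
  obtain T1 where T1: "unimodular (Suc n) T1"
    "\<And>T'. unimodular (Suc n) T' \<Longrightarrow> congr (rmat T1) G $$ (0, 0) \<le> congr (rmat T') G $$ (0, 0)"
    using minimal_corner[OF Suc.prems] by blast
  define R1 where "R1 = congr (rmat T1) G"
  define a where "a = R1 $$ (0, 0)"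
  have R1: "posdef (Suc n) R1" unfolding R1_def using posdef_congr_unimodular Suc.prems T1(1) by blast
  have a: "a > 0" unfolding a_def using posdef_diag_pos[OF R1] by simp
  obtain r X where rX: "r \<in> carrier_mat 1 n" "X \<in> carrier_mat n n" "R1 = bordered n a r X"
    using bordered_of_mat[of R1 n thesis] R1 a unfolding a_def posdef_def by simp
  have "posdef n X" using R1 rX posdef_bordered by blast
  from Suc.IH[OF this] obtain T' where T': "unimodular n T'" "reduced n (congr (rmat T') X)" by blast
  have T'c: "T' \<in> carrier_mat n n" using T' by (auto simp: unimodular_def)
  define k where "k = mat 1 n (\<lambda>(_, j). - round ((r * rmat T') $$ (0, j)))"
  define q where "q = rmat k + r * rmat T'"
  define Y where "Y = congr (rmat T') X"
  have c: "k \<in> carrier_mat 1 n" "q \<in> carrier_mat 1 n" "Y \<in> carrier_mat n n"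
    using rX T'c by (auto simp: k_def q_def Y_def congr_carrier)
  have q: "\<bar>q $$ (0, j)\<bar> \<le> 1 / 2" if "j < n" for j
    using of_int_round_abs_le[of "(r * rmat T') $$ (0, j)"] that rX T'c
    unfolding q_def k_def by (simp add: abs_minus_commute)
  define F where "F = dsum n 1 T' * unip n k"
  obtain T'' where T'': "T'' \<in> carrier_mat n n" "T' * T'' = 1\<^sub>m n" "T'' * T' = 1\<^sub>m n"
    using T' by (auto simp: unimodular_def)
  have "unimodular (Suc n) (dsum n 1 T')"
    using T'' T'c by (intro unimodularI[of _ _ "dsum n 1 T''"]) (simp_all add: dsum_mult dsum_one)
  moreover have "unimodular (Suc n) (unip n k)"
  proof (rule unimodularI[of _ _ "unip n (-k)"])
    have m: "-k \<in> carrier_mat 1 n" using c by auto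
    have z: "k + - k = 0\<^sub>m 1 n" "- k + k = 0\<^sub>m 1 n" using c by (auto intro!: eq_matI)
    show "unip n k * unip n (-k) = 1\<^sub>m (Suc n)" "unip n (-k) * unip n k = 1\<^sub>m (Suc n)"
      unfolding unip_mult[OF c(1) m] unip_mult[OF m c(1)] z unip_zero by auto
  qed (use c in auto)
  ultimately have F: "unimodular (Suc n) F" unfolding F_def by (rule unimodular_mult)
  have rF: "rmat F = dsum n 1 (rmat T') * unip n (rmat k)"
  proof -
    have "rmat F = rmat (dsum n 1 T') * rmat (unip n k)" unfolding F_def
      using T'c c by (intro rmat_mult[of _ "Suc n" "Suc n" _ "Suc n"]) auto
    moreover have "rmat (dsum n 1 T') = dsum n 1 (rmat T')" "rmat (unip n k) = unip n (rmat k)"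
      using T'c c unfolding dsum_def unip_def by (auto intro!: eq_matI)
    ultimately show ?thesis by simp
  qed
  define T where "T = T1 * F"
  have T: "unimodular (Suc n) T" unfolding T_def using T1(1) F by (rule unimodular_mult)
  have cT: "T1 \<in> carrier_mat (Suc n) (Suc n)" "F \<in> carrier_mat (Suc n) (Suc n)" "T \<in> carrier_mat (Suc n) (Suc n)"
    "G \<in> carrier_mat (Suc n) (Suc n)"
    using T1(1) F T Suc.prems by (auto simp: unimodular_def posdef_def)
  define R where "R = congr (rmat T) G"
  have "R = congr (rmat F) R1"
    unfolding R_def R1_def T_def rmat_mult[OF cT(1,2)]
    using cT by (intro congr_mult[of _ "Suc n"]) auto
  also have "\<dots> = bordered n a q Y"
    unfolding rF rX(3) q_def Y_def using rX T'c c by (intro congr_bordered) auto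
  finally have R: "R = bordered n a q Y" .
  have R00: "R $$ (0, 0) = a" unfolding R by (simp add: bordered_index[OF c(2,3)])
  \<comment> \<open>Exchanging the first and the \<open>i\<close>-th basis vector gives another
    basis, whose corner is \<open>R $$ (i, i)\<close>.\<close>
  have min: "a \<le> R $$ (i, i)" if i: "i < Suc n" for i
  proof -
    have S: "swaprows_mat (Suc n) 0 i \<in> carrier_mat (Suc n) (Suc n)" for i by simp
    have "rmat (T * swaprows_mat (Suc n) 0 i) = rmat T * swaprows_mat (Suc n) 0 i"
      unfolding rmat_mult[OF cT(3) S] by (rule arg_cong[where f = "\<lambda>x. rmat T * x"]) (auto intro!: eq_matI simp: swaprows_mat_def)
    then have "congr (rmat (T * swaprows_mat (Suc n) 0 i)) G = congr (swaprows_mat (Suc n) 0 i) R"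
      unfolding R_def using cT by (simp add: congr_mult[of _ "Suc n"])
    then show ?thesis
      using T1(2)[OF unimodular_mult[OF T unimodular_swap[OF i]]] congr_swap_index[of R "Suc n" i] i bordered_carrier[OF c(2,3)]
      unfolding R a_def R1_def by simp
  qed
  have lm: "lead_minor R (Suc i) = a * lead_minor Y i" if "i \<le> n" for i
    unfolding R using lead_minor_bordered[OF c(2,3) that] .
  have red: "reduced n Y" using T' unfolding Y_def by simp
  have dia: "R $$ (Suc i, Suc i) \<le> Y $$ (i, i) + a / 4" if "i < n" for i
  proof -
    have "q $$ (0, i) * q $$ (0, i) \<le> 1 / 2 * (1 / 2)"
      using q[OF that] by (metis abs_ge_zero abs_mult_self_eq mult_mono' )
    then have "a * (q $$ (0, i) * q $$ (0, i)) \<le> a * (1 / 4)" using a by (intro mult_left_mono) auto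
    then show ?thesis unfolding R using that by (simp add: bordered_index[OF c(2,3)] mult.assoc)
  qed
  have "reduced (Suc n) R"
    unfolding reduced_def
  proof (intro conjI allI impI)
    fix i assume "i \<le> Suc n" then show "0 < lead_minor R i"
      using red a by (cases i) (auto simp: lm reduced_def)
  next
    fix i assume "i < Suc n" then show "R $$ (0, 0) \<le> R $$ (i, i)" using min R00 by simp
  next
    fix i assume i: "i < Suc n" "0 < i"
    then have "R $$ (0, i) = a * q $$ (0, i - 1)" unfolding R by (simp add: bordered_index[OF c(2,3)])
    moreover have "a * \<bar>q $$ (0, i - 1)\<bar> \<le> a * (1 / 2)" using q[of "i - 1"] i a by (intro mult_left_mono) auto
    ultimately show "2 * \<bar>R $$ (0, i)\<bar> \<le> R $$ (0, 0)" using a R00 by (simp add: abs_mult)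
  next
    fix i assume i: "Suc i < Suc n"
    show "3 * (lead_minor R (Suc i))\<^sup>2 \<le> 4 * lead_minor R i * lead_minor R (Suc (Suc i))"
    proof (cases i)
      case 0
      have y: "Y $$ (0, 0) = lead_minor Y 1" by (simp add: lead_minor_def det_single)
      have "a \<le> Y $$ (0, 0) + a / 4" using min[of 1] dia[of 0] i 0 by simp
      then have "a * (3 * a) \<le> a * (4 * lead_minor Y 1)" using a y by (intro mult_left_mono) auto
      then show ?thesis using 0 i lm[of 0] lm[of 1] by (simp add: power2_eq_square)
    next
      case (Suc j)
      have "3 * (lead_minor Y (Suc j))\<^sup>2 \<le> 4 * lead_minor Y j * lead_minor Y (Suc (Suc j))"
        using red i Suc by (auto simp: reduced_def)
      then have "a\<^sup>2 * (3 * (lead_minor Y (Suc j))\<^sup>2) \<le> a\<^sup>2 * (4 * lead_minor Y j * lead_minor Y (Suc (Suc j)))"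
        by (intro mult_left_mono) auto
      then show ?thesis using Suc i by (simp add: lm power_mult_distrib power2_eq_square mult_ac)
    qed
  next
    fix i assume i: "i < Suc n"
    have B: "lead_minor R (Suc (Suc j)) / lead_minor R (Suc j) = lead_minor Y (Suc j) / lead_minor Y j" if "j < n" for j
      using that a by (simp add: lm)
    have l1: "lead_minor R (Suc 0) = a" using lm[of 0] by simp
    show "R $$ (i, i) \<le> lead_minor R (Suc i) / lead_minor R i + (\<Sum>j<i. lead_minor R (Suc j) / lead_minor R j) / 4"
    proof (cases i)
      case 0 then show ?thesis using R00 l1 by simp
    next
      case (Suc j)
      have "(\<Sum>l<Suc j. lead_minor R (Suc l) / lead_minor R l)
          = a + (\<Sum>l<j. lead_minor R (Suc (Suc l)) / lead_minor R (Suc l))"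
        by (subst sum.lessThan_Suc_shift) (simp add: l1)
      also have "(\<Sum>l<j. lead_minor R (Suc (Suc l)) / lead_minor R (Suc l)) = (\<Sum>l<j. lead_minor Y (Suc l) / lead_minor Y l)"
        using i Suc by (intro sum.cong) (auto simp: B)
      finally have s: "(\<Sum>l<Suc j. lead_minor R (Suc l) / lead_minor R l) = a + (\<Sum>l<j. lead_minor Y (Suc l) / lead_minor Y l)" .
      have "Y $$ (j, j) \<le> lead_minor Y (Suc j) / lead_minor Y j + (\<Sum>l<j. lead_minor Y (Suc l) / lead_minor Y l) / 4"
        using red i Suc by (auto simp: reduced_def)
      then show ?thesis using dia[of j] i B[of j] unfolding Suc s by (simp add: add_divide_distrib)
    qed
  qed
  with T show ?case unfolding R_def by blast
qed

subsection \<open>Lattices of determinant 3\<close>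

text \<open>Orbits of length two contribute twice the same value, so modulo 2 only the fixed points
  count.\<close>

lemma even_sum_involution:
  fixes f :: "'a \<Rightarrow> int"
  assumes "finite S" "\<And>x. x \<in> S \<Longrightarrow> g x \<in> S" "\<And>x. x \<in> S \<Longrightarrow> g (g x) = x"
    "\<And>x. x \<in> S \<Longrightarrow> f (g x) = f x" "\<And>x. x \<in> S \<Longrightarrow> g x = x \<Longrightarrow> even (f x)"
  shows "even (sum f S)"
  using assms
proof (induction S rule: finite_psubset_induct)
  case (psubset S)
  show ?case
  proof (cases "S = {}")
    case False
    then obtain x where x: "x \<in> S" by auto
    let ?S = "S - {x, g x}"
    have "even (sum f ?S)"
      by (rule psubset.IH; use x psubset.prems in \<open>auto; metis\<close>)
    moreover have "sum f S = sum f ?S + sum f {x, g x}"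
      using x psubset by (intro sum.subset_diff) auto
    moreover have "even (sum f {x, g x})"
      using x psubset.prems by (cases "g x = x") auto
    ultimately show ?thesis by simp
  qed simp
qed

text \<open>By symmetry the terms at (i, j) and (j, i) agree, so modulo 2 only the diagonal terms
  count.\<close>

lemma even_form:
  fixes R :: "int mat"
  assumes R: "R \<in> carrier_mat n n" "R\<^sup>T = R" "\<And>i. i < n \<Longrightarrow> even (R $$ (i, i))"
    and x: "x \<in> carrier_vec n"
  shows "even (x \<bullet> (R *\<^sub>v x))"
proof -
  have s: "R $$ (i, j) = R $$ (j, i)" if "i < n" "j < n" for i j
    using R that by (metis carrier_matD index_transpose_mat(1))
  define f where "f p = x $ fst p * (R $$ p * x $ snd p)" for p
  have "x \<bullet> (R *\<^sub>v x) = (\<Sum>i=0..<n. \<Sum>j=0..<n. x $ i * (R $$ (i, j) * x $ j))"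
    using R x by (simp add: scalar_prod_def sum_distrib_left)
  also have "\<dots> = sum f ({0..<n} \<times> {0..<n})"
    unfolding f_def by (simp add: sum.cartesian_product case_prod_unfold)
  also have "even \<dots>"
  proof (rule even_sum_involution[where g = prod.swap])
    fix p assume "p \<in> {0..<n} \<times> {0..<n}"
    then obtain i j where p: "p = (i, j)" "i < n" "j < n" by auto
    have sw: "R $$ (j, i) = R $$ (i, j)" using s p by blast
    show "f (prod.swap p) = f p"
      unfolding f_def p(1) swap_simp fst_conv snd_conv sw by (simp only: mult_ac)
    assume "prod.swap p = p"
    then have "j = i" unfolding p(1) swap_simp prod.inject by (rule conjunct1)
    then show "even (f p)" unfolding f_def using R(3)[OF p(2)] p(1) by simp
  qed auto
  finally show ?thesis .
qed

text \<open>By symmetry a permutation and its inverse have the same Leibniz term. A permutation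
  equal to its inverse has a fixed point because \<open>n\<close> is odd, and the diagonal factor
  there is even.\<close>

lemma even_det:
  fixes A :: "int mat"
  assumes A: "A \<in> carrier_mat n n" "A\<^sup>T = A" "\<And>i. i < n \<Longrightarrow> even (A $$ (i, i))" and n: "odd n"
  shows "even (det A)"
  unfolding det_def'[OF A(1)]
proof (rule even_sum_involution[where g = Hilbert_Choice.inv])
  have s: "A $$ (i, j) = A $$ (j, i)" if "i < n" "j < n" for i j
    using A that by (metis carrier_matD index_transpose_mat(1))
  show "finite {p. p permutes {0..<n}}" by (simp add: finite_permutations)
  fix p assume "p \<in> {p. p permutes {0..<n}}"
  then have p: "p permutes {0..<n}" by simp
  show "Hilbert_Choice.inv p \<in> {p. p permutes {0..<n}}" using p by (simp add: permutes_inv)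
  show "Hilbert_Choice.inv (Hilbert_Choice.inv p) = p" using p by (simp add: permutes_inv_inv)
  have "(\<Prod>i=0..<n. A $$ (i, Hilbert_Choice.inv p i)) = (\<Prod>i=0..<n. A $$ (p i, Hilbert_Choice.inv p (p i)))"
    using prod.permute[OF p, of "\<lambda>i. A $$ (i, Hilbert_Choice.inv p i)"] by (simp add: o_def)
  also have "\<dots> = (\<Prod>i=0..<n. A $$ (i, p i))"
    using p s by (intro prod.cong) (auto simp: permutes_inverses permutes_in_image)
  finally show "signof (Hilbert_Choice.inv p) * (\<Prod>i=0..<n. A $$ (i, Hilbert_Choice.inv p i)) = signof p * (\<Prod>i=0..<n. A $$ (i, p i))"
    using p by (simp add: sign_inverse permutation_permutes[of p] exI[of _ "{0..<n}"])
  assume ip: "Hilbert_Choice.inv p = p"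
  have "\<exists>i<n. p i = i"
  proof (rule ccontr)
    assume "\<not> (\<exists>i<n. p i = i)"
    then have "even (\<Sum>i\<in>{0..<n}. 1::int)"
      using p ip by (intro even_sum_involution[where g = p]) (auto simp: permutes_in_image, metis permutes_inverses(1))
    then show False using n by simp
  qed
  then obtain i where i: "i < n" "p i = i" by auto
  then have "2 dvd (\<Prod>i=0..<n. A $$ (i, p i))"
    using A(3)[of i] dvd_prodI[of "{0..<n}" i "\<lambda>i. A $$ (i, p i)"] by (auto intro: dvd_trans)
  then show "even (signof p * (\<Prod>i=0..<n. A $$ (i, p i)))" by simp
qed

section \<open>Integral forms, their rational extension and chains of minors\<close>

lemma of_int_form:
  fixes G :: "int mat"
  assumes "G \<in> carrier_mat n n" "y \<in> carrier_vec n"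
  shows "rat_of_int (y \<bullet> (G *\<^sub>v y)) = map_vec rat_of_int y \<bullet> (rmat G *\<^sub>v map_vec rat_of_int y)"
  using assms by (simp add: scalar_prod_def sum_distrib_left)

lemma smult_form:
  fixes G :: "'a :: comm_ring_1 mat"
  assumes "G \<in> carrier_mat n n" "x \<in> carrier_vec n"
  shows "(k \<cdot>\<^sub>v x) \<bullet> (G *\<^sub>v (k \<cdot>\<^sub>v x)) = k * (k * (x \<bullet> (G *\<^sub>v x)))"
  using assms by (simp add: scalar_prod_def sum_distrib_left mult_ac)

lemma posdef_rmat:
  assumes G: "posdef n G" shows "posdef n (rmat G)"
proof -
  have c: "G \<in> carrier_mat n n" "G\<^sup>T = G" using G by (auto simp: posdef_def)
  have "0 < x \<bullet> (rmat G *\<^sub>v x)" if x: "x \<in> carrier_vec n" "x \<noteq> 0\<^sub>v n" for x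
  proof -
    obtain D where D: "D > 0" "\<forall>y \<in> (\<lambda>i. x $ i) ` {..<n}. \<exists>z. rat_of_int D * y = of_int z"
      using common_denominator[of "(\<lambda>i. x $ i) ` {..<n}"] by auto
    then have "\<forall>i<n. \<exists>z. rat_of_int D * x $ i = of_int z" by auto
    then obtain z where z: "\<And>i. i < n \<Longrightarrow> rat_of_int D * x $ i = of_int (z i)" by metis
    define y where "y = vec n z"
    have y: "y \<in> carrier_vec n" "map_vec rat_of_int y = rat_of_int D \<cdot>\<^sub>v x"
      using x z by (auto simp: y_def)
    obtain i where i: "i < n" "x $ i \<noteq> 0" using nonzero_vec_index[OF x] .
    then have "y $ i \<noteq> 0" using z[OF i(1)] D by (auto simp: y_def)
    then have "y \<noteq> 0\<^sub>v n" using i by auto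
    then have "0 < rat_of_int (y \<bullet> (G *\<^sub>v y))" using G y unfolding posdef_def by simp
    also have "\<dots> = rat_of_int D * (rat_of_int D * (x \<bullet> (rmat G *\<^sub>v x)))"
      unfolding of_int_form[OF c(1) y(1)] y(2) using x c by (intro smult_form) auto
    finally show ?thesis using D by (simp add: zero_less_mult_iff)
  qed
  moreover have "(rmat G)\<^sup>T = rmat G" using rmat_transpose[of G] c by simp
  ultimately show ?thesis using c by (simp add: posdef_def)
qed

lemma lead_minor_rmat:
  assumes "R \<in> carrier_mat n n" "i \<le> n"
  shows "lead_minor (rmat R) i = of_int (lead_minor R i)"
proof -
  have "mat i i (\<lambda>(r, c). rmat R $$ (r, c)) = rmat (mat i i (\<lambda>(r, c). R $$ (r, c)))"
    using assms by (intro eq_matI) auto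
  then show ?thesis unfolding lead_minor_def by simp
qed

lemma lead_minor_full: "R \<in> carrier_mat n n \<Longrightarrow> lead_minor R n = det R"
  unfolding lead_minor_def by (rule arg_cong[where f = det]) (auto intro!: eq_matI)

lemma hermite_reduction_int:
  assumes G: "posdef n G"
  obtains T where "unimodular n T" "reduced n (rmat (congr T G))"
proof -
  obtain T where T: "unimodular n T" "reduced n (congr (rmat T) (rmat G))"
    using hermite_reduction[OF posdef_rmat[OF G]] by blast
  moreover have "congr (rmat T) (rmat G) = rmat (congr T G)"
    using T(1) G by (subst rmat_congr[of _ n]) (auto simp: unimodular_def posdef_def)
  ultimately show ?thesis using that by simp
qed

text \<open>In terms of quotients: if y/x >= p/q, then z/y >= (3/4)(p/q). So a lower bound for one
  quotient of successive minors passes to the next at the cost of the factor 3/4.\<close>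

lemma chain_step:
  fixes x y z p q :: int
  assumes "0 < x" "0 < y" "3 * y\<^sup>2 \<le> 4 * x * z" "p * x \<le> q * y" "0 \<le> q"
  shows "3 * p * y \<le> 4 * q * z"
proof -
  have "x * (3 * p * y) \<le> 3 * y * (q * y)"
    using mult_right_mono[OF assms(4), of "3 * y"] assms(2) by (simp add: algebra_simps)
  also have "\<dots> = q * (3 * y\<^sup>2)" by (simp add: power2_eq_square)
  also have "\<dots> \<le> q * (4 * x * z)" using assms by (intro mult_left_mono) auto
  also have "\<dots> = x * (4 * q * z)" by simp
  finally show ?thesis using assms(1) by (simp add: mult_le_cancel_left_pos)
qed

text \<open>The extremal values \<open>2, 3, 4, 4, 4, 3\<close> are the determinants of \<open>A\<^sub>1, A\<^sub>2, A\<^sub>3, D\<^sub>4, D\<^sub>5, E\<^sub>6\<close>.\<close>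

lemma minor_chain:
  fixes a b c d e :: int
  assumes a: "2 \<le> a" and b: "0 < b" "3 * a\<^sup>2 \<le> 4 * b"
  shows "3 \<le> b \<and> (b = 3 \<longrightarrow> a = 2)"
    "0 < c \<Longrightarrow> 3 * b\<^sup>2 \<le> 4 * a * c \<Longrightarrow> 4 \<le> c \<and> (c = 4 \<longrightarrow> a = 2 \<and> b = 3)"
    "0 < c \<Longrightarrow> 3 * b\<^sup>2 \<le> 4 * a * c \<Longrightarrow> 0 < d \<Longrightarrow> 3 * c\<^sup>2 \<le> 4 * b * d \<Longrightarrow>
      4 \<le> d \<and> (d = 4 \<longrightarrow> a = 2 \<and> b = 3 \<and> c = 4)"
    "0 < c \<Longrightarrow> 3 * b\<^sup>2 \<le> 4 * a * c \<Longrightarrow> 0 < d \<Longrightarrow> 3 * c\<^sup>2 \<le> 4 * b * d \<Longrightarrow> 0 < e \<Longrightarrow> 3 * d\<^sup>2 \<le> 4 * c * e \<Longrightarrow>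
      3 \<le> e \<and> (e \<le> 4 \<longrightarrow> a = 2 \<and> b = 3 \<and> c = 4 \<and> d = 4)"
    "0 < c \<Longrightarrow> 3 * b\<^sup>2 \<le> 4 * a * c \<Longrightarrow> 0 < d \<Longrightarrow> 3 * c\<^sup>2 \<le> 4 * b * d \<Longrightarrow> 0 < e \<Longrightarrow> 3 * d\<^sup>2 \<le> 4 * c * e \<Longrightarrow>
      3 * e\<^sup>2 \<le> 4 * d * 3 \<Longrightarrow> a = 2 \<and> b = 3 \<and> c = 4 \<and> d = 4 \<and> (e = 3 \<or> e = 4)"
proof -
  have a0: "0 < a" using a by simp
  have b1: "3 * a \<le> 2 * b" using chain_step[of 1 a b 2 1] a b by simp
  have b2: "9 * a \<le> 4 * b" if "3 \<le> a" using chain_step[of 1 a b 3 1] a b that by simp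
  have b3: "3 \<le> b" using b1 a by linarith
  have ba: "a = 2" if "b = 3" using b1 a that by linarith
  show "3 \<le> b \<and> (b = 3 \<longrightarrow> a = 2)" using b3 ba by simp
  have cases: "3 \<le> a \<or> a = 2 \<and> 4 \<le> b \<or> a = 2 \<and> b = 3" using a b3 by linarith
  {
    assume c: "0 < c" "3 * b\<^sup>2 \<le> 4 * a * c"
    note s = chain_step[OF a0 b(1) c(2)]
    have c1: "9 * b \<le> 8 * c" using s[of 3 2] b1 by simp
    have c2: "27 * b \<le> 16 * c" "11 \<le> c" if "3 \<le> a"
      using s[of 9 4] b2[OF that] that by simp_all
    have c3: "3 * b \<le> 2 * c" "6 \<le> c" if "a = 2" "4 \<le> b"
      using s[of 2 1] that by simp_all
    have c4: "4 \<le> c" using c1 b3 by simp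
    have cases: "3 \<le> a \<or> a = 2 \<and> 4 \<le> b \<or> a = 2 \<and> b = 3 \<and> 5 \<le> c \<or> a = 2 \<and> b = 3 \<and> c = 4"
      using cases c4 by auto
    show "4 \<le> c \<and> (c = 4 \<longrightarrow> a = 2 \<and> b = 3)" using c4 c2(2) c3(2) cases by auto
    {
      assume d: "0 < d" "3 * c\<^sup>2 \<le> 4 * b * d"
      note s = chain_step[OF b(1) c(1) d(2)]
      have d1: "81 * c \<le> 64 * d" "13 \<le> d" if "3 \<le> a"
        using s[of 27 16] c2[OF that] by simp_all
      have d2: "9 * c \<le> 8 * d" "6 \<le> d" if "a = 2" "4 \<le> b"
        using s[of 3 2] c3[OF that] by simp_all
      have d3: "5 * c \<le> 4 * d" "6 \<le> d" if "b = 3" "5 \<le> c"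
        using s[of 5 3] that by simp_all
      have d4: "4 \<le> d" if "b = 3" "c = 4" using d(2) that by simp
      have cases: "3 \<le> a \<or> a = 2 \<and> 4 \<le> b \<or> a = 2 \<and> b = 3 \<and> 5 \<le> c
          \<or> a = 2 \<and> b = 3 \<and> c = 4 \<and> 5 \<le> d \<or> a = 2 \<and> b = 3 \<and> c = 4 \<and> d = 4"
        using cases d4 by force
      show "4 \<le> d \<and> (d = 4 \<longrightarrow> a = 2 \<and> b = 3 \<and> c = 4)"
        using cases d1(2) d2(2) d3(2) by force
      {
        assume e: "0 < e" "3 * d\<^sup>2 \<le> 4 * c * e"
        note s = chain_step[OF c(1) d(1) e(2)]
        have e1: "243 * d \<le> 256 * e" "13 \<le> e" if "3 \<le> a"
          using s[of 81 64] d1[OF that] by simp_all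
        have e2: "27 * d \<le> 32 * e" "6 \<le> e" if "a = 2" "4 \<le> b"
          using s[of 9 8] d2[OF that] by simp_all
        have e3: "15 * d \<le> 16 * e" "6 \<le> e" if "b = 3" "5 \<le> c"
          using s[of 5 4] d3[OF that] by simp_all
        have e4: "15 * d \<le> 16 * e" "5 \<le> e" if "c = 4" "5 \<le> d"
          using s[of 5 4] that by simp_all
        have e5: "3 \<le> e" if "c = 4" "d = 4" using e(2) that by simp
        show "3 \<le> e \<and> (e \<le> 4 \<longrightarrow> a = 2 \<and> b = 3 \<and> c = 4 \<and> d = 4)"
          using cases by (elim disjE) (use e1(2) e2(2) e3(2) e4(2) e5 in auto)
        assume f: "3 * e\<^sup>2 \<le> 4 * d * 3"
        note s = chain_step[OF d(1) e(1) f]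
        have "\<not> 3 \<le> a" using e1 s[of 243 256] by auto
        moreover have "\<not> (a = 2 \<and> 4 \<le> b)" using e2 s[of 27 32] by auto
        moreover have "\<not> (b = 3 \<and> 5 \<le> c)" using e3 s[of 15 16] by auto
        moreover have "\<not> (c = 4 \<and> 5 \<le> d)" using e4 s[of 15 16] by auto
        ultimately have *: "a = 2" "b = 3" "c = 4" "d = 4" using cases by blast+
        then have "e \<le> 4" using s[of 5 4] by (cases "5 \<le> e") simp_all
        then show "a = 2 \<and> b = 3 \<and> c = 4 \<and> d = 4 \<and> (e = 3 \<or> e = 4)" using e5[OF *(3,4)] * by auto
      }
    }
  }
qed

section \<open>Uniqueness of I_{n-1} + <3> for n at most 6\<close>

definition std_gram :: "nat \<Rightarrow> int mat" where
  "std_gram n = mat n n (\<lambda>(i, j). if i = j then if Suc i = n then 3 else 1 else 0)"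

text \<open>This property tells \<open>I\<^sub>n\<^sub>-\<^sub>1 \<bottom> \<langle>3\<rangle>\<close> from \<open>I\<^sub>n\<^sub>-\<^sub>2 \<bottom> A\<^sub>2\<close>: the dual of \<open>A\<^sub>2\<close> has norms \<open>2/3\<close> rather
  than \<open>1/3\<close> modulo \<open>1\<close>.\<close>

definition glue :: "nat \<Rightarrow> int mat \<Rightarrow> bool" where
  "glue n G \<longleftrightarrow> (\<exists>x \<in> carrier_vec n. (\<forall>i<n. 3 dvd (G *\<^sub>v x) $ i) \<and> (x \<bullet> (G *\<^sub>v x)) mod 9 = 3)"

lemma std_gram_Suc: "0 < n \<Longrightarrow> std_gram (Suc n) = dsum n 1 (std_gram n)"
  by (rule eq_matI) (auto simp: std_gram_def dsum_def)

lemma congr_unimodular_inverse: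
  assumes "unimodular n T" "G \<in> carrier_mat n n"
  obtains T' where "unimodular n T'" "congr T' (congr T G) = G" "T' \<in> carrier_mat n n" "T * T' = 1\<^sub>m n"
proof -
  obtain T' where T': "T' \<in> carrier_mat n n" "T * T' = 1\<^sub>m n" "T' * T = 1\<^sub>m n" and T: "T \<in> carrier_mat n n"
    using assms by (auto simp: unimodular_def)
  have "congr T' (congr T G) = congr (1\<^sub>m n) G"
    using congr_mult[OF T T'(1) assms(2)] T' by simp
  also have "\<dots> = G" using assms(2) by (simp add: congr_def transpose_one)
  finally show ?thesis using that T' T unimodularI by blast
qed

lemma glue_congr:
  assumes "glue n G" "unimodular n T" "G \<in> carrier_mat n n"
  shows "glue n (congr T G)"
proof -
  obtain T' where T': "T' \<in> carrier_mat n n" "T * T' = 1\<^sub>m n" and T: "T \<in> carrier_mat n n"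
    using assms by (auto simp: unimodular_def)
  obtain x where x: "x \<in> carrier_vec n" "\<And>i. i < n \<Longrightarrow> 3 dvd (G *\<^sub>v x) $ i" "(x \<bullet> (G *\<^sub>v x)) mod 9 = 3"
    using assms(1) by (auto simp: glue_def)
  have Tx: "T *\<^sub>v (T' *\<^sub>v x) = x" using T T' x by (metis assoc_mult_mat_vec one_mult_mat_vec)
  have y: "T' *\<^sub>v x \<in> carrier_vec n" using T' x by simp
  have "congr T G *\<^sub>v (T' *\<^sub>v x) = T\<^sup>T *\<^sub>v (G *\<^sub>v (T *\<^sub>v (T' *\<^sub>v x)))"
    unfolding congr_def using T y assms(3)
    by (smt (verit) assoc_mult_mat_vec mult_carrier_mat mult_mat_vec_carrier transpose_carrier_mat)
  then have e: "congr T G *\<^sub>v (T' *\<^sub>v x) = T\<^sup>T *\<^sub>v (G *\<^sub>v x)" unfolding Tx .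
  have "3 dvd (congr T G *\<^sub>v (T' *\<^sub>v x)) $ i" if "i < n" for i
    unfolding e using that x assms(3) T by (auto simp: scalar_prod_def[of _ "G *\<^sub>v x"] intro!: dvd_sum)
  moreover have "((T' *\<^sub>v x) \<bullet> (congr T G *\<^sub>v (T' *\<^sub>v x))) mod 9 = 3"
    using x(3) by (simp add: congr_form[OF T assms(3) y y] Tx)
  ultimately show ?thesis using y unfolding glue_def by blast
qed

lemma carrier_vec_Suc_split:
  fixes x :: "'a :: zero vec"
  assumes "x \<in> carrier_vec (Suc n)"
  obtains c y where "y \<in> carrier_vec n" "x = vec 1 (\<lambda>_. c) @\<^sub>v y"
proof (rule that)
  show "vec n (\<lambda>i. x $ Suc i) \<in> carrier_vec n" by simp
  show "x = vec 1 (\<lambda>_. x $ 0) @\<^sub>v vec n (\<lambda>i. x $ Suc i)"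
    using assms by (intro eq_vecI) auto
qed

text \<open>The unit coordinate of a glue vector is its product with the first basis vector. It is
  therefore divisible by 3 and contributes a multiple of 9 to the norm.\<close>

lemma glue_dsum:
  assumes "glue (Suc n) (dsum n 1 X)" "X \<in> carrier_mat n n"
  shows "glue n X"
proof -
  obtain x where x: "x \<in> carrier_vec (Suc n)" "\<And>i. i < Suc n \<Longrightarrow> 3 dvd (dsum n 1 X *\<^sub>v x) $ i" "(x \<bullet> (dsum n 1 X *\<^sub>v x)) mod 9 = 3"
    using assms(1) unfolding glue_def by blast
  obtain c y where y: "y \<in> carrier_vec n" "x = vec 1 (\<lambda>_. c) @\<^sub>v y" using carrier_vec_Suc_split[OF x(1)] by blast
  have e: "dsum n 1 X *\<^sub>v x = vec 1 (\<lambda>_. c) @\<^sub>v (X *\<^sub>v y)"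
    unfolding y(2) using dsum_mult_vec[OF assms(2) y(1), of 1 c] by simp
  have "3 dvd c" using x(2)[of 0] unfolding e using assms(2) by simp
  then obtain k where k: "c = 3 * k" by blast
  have "3 dvd (X *\<^sub>v y) $ i" if "i < n" for i
    using x(2)[of "Suc i"] that assms(2) unfolding e by simp
  moreover have "(y \<bullet> (X *\<^sub>v y)) mod 9 = 3"
  proof -
    have "x \<bullet> (dsum n 1 X *\<^sub>v x) = 9 * (k * k) + y \<bullet> (X *\<^sub>v y)"
      unfolding y(2) dsum_form[OF assms(2) y(1,1)] k by simp
    then show ?thesis using x(3) by simp
  qed
  ultimately show ?thesis using y(1) unfolding glue_def by blast
qed

text \<open>With corner 1 the other entries of the first row are integers of absolute value at most
  1/2, hence 0.\<close>

lemma reduced_split: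
  assumes R: "R \<in> carrier_mat (Suc n) (Suc n)" "R\<^sup>T = R" "reduced (Suc n) (rmat R)" "R $$ (0, 0) = 1"
  obtains X where "X \<in> carrier_mat n n" "R = dsum n 1 X"
proof -
  have z: "R $$ (0, j) = 0" "R $$ (j, 0) = 0" if "0 < j" "j < Suc n" for j
  proof -
    have "2 * \<bar>rat_of_int (R $$ (0, j))\<bar> \<le> 1" using R that by (auto simp: reduced_def)
    then have "rat_of_int (2 * \<bar>R $$ (0, j)\<bar>) \<le> of_int 1" by simp
    then have "2 * \<bar>R $$ (0, j)\<bar> \<le> 1" unfolding of_int_le_iff .
    then show "R $$ (0, j) = 0" by linarith
    then show "R $$ (j, 0) = 0" using R(1,2) that by (metis carrier_matD index_transpose_mat(1) zero_less_Suc)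
  qed
  have "R = dsum n 1 (mat n n (\<lambda>(i, j). R $$ (Suc i, Suc j)))"
    using R z by (intro eq_matI) (auto simp: dsum_def)
  then show ?thesis using that by (metis mat_carrier)
qed

lemma reduced_int:
  assumes R: "R \<in> carrier_mat n n" "reduced n (rmat R)"
  shows "\<And>i. i \<le> n \<Longrightarrow> 0 < lead_minor R i"
    "\<And>i. i < n \<Longrightarrow> R $$ (0, 0) \<le> R $$ (i, i)"
    "\<And>i. Suc i < n \<Longrightarrow> 3 * (lead_minor R (Suc i))\<^sup>2 \<le> 4 * lead_minor R i * lead_minor R (Suc (Suc i))"
proof -
  note l = lead_minor_rmat[OF R(1)]
  show "0 < lead_minor R i" if "i \<le> n" for i
    using R that l[OF that] unfolding reduced_def by (metis of_int_0_less_iff)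
  show "R $$ (0, 0) \<le> R $$ (i, i)" if "i < n" for i
    using R that by (auto simp: reduced_def)
  show "3 * (lead_minor R (Suc i))\<^sup>2 \<le> 4 * lead_minor R i * lead_minor R (Suc (Suc i))" if "Suc i < n" for i
  proof -
    have "3 * (lead_minor (rmat R) (Suc i))\<^sup>2 \<le> 4 * lead_minor (rmat R) i * lead_minor (rmat R) (Suc (Suc i))"
      using R(2) that unfolding reduced_def by blast
    then have "rat_of_int (3 * (lead_minor R (Suc i))\<^sup>2) \<le> of_int (4 * lead_minor R i * lead_minor R (Suc (Suc i)))"
      using that by (simp add: l)
    then show ?thesis unfolding of_int_le_iff .
  qed
qed

lemma lead_minor_one: "lead_minor R 1 = R $$ (0, 0)"
  by (simp add: lead_minor_def det_single)

text \<open>In a reduced form the integer \<open>R $$ (i, i)\<close> is at least the corner 2, and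
  the Gram-Schmidt bound keeps it below 3.\<close>

lemma reduced_diag_even:
  assumes R: "R \<in> carrier_mat n n" "reduced n (rmat R)" "R $$ (0, 0) = 2" "i < n"
    and "rat_of_int (lead_minor R (Suc i)) / of_int (lead_minor R i)
        + (\<Sum>j<i. rat_of_int (lead_minor R (Suc j)) / of_int (lead_minor R j)) / 4 < 3"
  shows "R $$ (i, i) = 2"
proof -
  note l = lead_minor_rmat[OF R(1)]
  have "rmat R $$ (i, i) \<le> lead_minor (rmat R) (Suc i) / lead_minor (rmat R) i
      + (\<Sum>j<i. lead_minor (rmat R) (Suc j) / lead_minor (rmat R) j) / 4"
    using R(2,4) unfolding reduced_def by blast
  also have "(\<Sum>j<i. lead_minor (rmat R) (Suc j) / lead_minor (rmat R) j) = (\<Sum>j<i. rat_of_int (lead_minor R (Suc j)) / of_int (lead_minor R j))"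
    using R(4) by (intro sum.cong) (auto simp: l)
  finally have "rat_of_int (R $$ (i, i)) < 3" using R(1,4) assms(5) by (simp add: l)
  then have "R $$ (i, i) < 3" by simp
  then show ?thesis using reduced_int(2)[OF R(1,2,4)] R(3) by simp
qed

lemma det_2:
  fixes A :: "'a :: comm_ring_1 mat"
  assumes A: "A \<in> carrier_mat 2 2"
  shows "det A = A $$ (0, 0) * A $$ (1, 1) - A $$ (0, 1) * A $$ (1, 0)"
proof -
  have c: "mat_delete A i j \<in> carrier_mat 1 1" for i j using mat_delete_carrier[OF A, of i j] by simp
  show ?thesis
    using A by (simp add: laplace_expansion_row[OF A, of 0] cofactor_def det_single[OF c])
      (simp add: numeral_2_eq_2 mat_delete_def)
qed

text \<open>Completing the square, twice the norm is (2 s + b t)^2 + 3 t^2. On a glue vector the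
  first square is divisible by 9, so norm 3 modulo 9 would make t^2 congruent to 2 modulo 3.\<close>

lemma glue_not_A2:
  assumes R: "R \<in> carrier_mat 2 2" "R\<^sup>T = R" "R $$ (0, 0) = 2" "det R = 3"
  shows "\<not> glue 2 R"
proof
  assume "glue 2 R"
  then obtain x where x: "x \<in> carrier_vec 2" "3 dvd (R *\<^sub>v x) $ 0" "(x \<bullet> (R *\<^sub>v x)) mod 9 = 3"
    by (auto simp: glue_def)
  define b c s t where d: "b = R $$ (0, 1)" "c = R $$ (1, 1)" "s = x $ 0" "t = x $ 1"
  have b': "R $$ (1, 0) = b" using R(1,2) unfolding d by (metis carrier_matD index_transpose_mat(1) one_less_numeral_iff pos2 semiring_norm(76))
  have "2 * c - b * b = 3" using R b' by (simp add: det_2[OF R(1)] d)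
  then have c: "2 * c = b * b + 3" by simp
  have row0: "(R *\<^sub>v x) $ 0 = 2 * s + b * t" and row1: "(R *\<^sub>v x) $ 1 = b * s + c * t"
    using R x b' by (simp_all add: scalar_prod_def d numeral_2_eq_2)
  have form: "x \<bullet> (R *\<^sub>v x) = s * (2 * s + b * t) + t * (b * s + c * t)"
    using x R row0 row1 by (simp add: scalar_prod_def[of _ "R *\<^sub>v x"] numeral_2_eq_2) (simp add: d)
  obtain k where k: "2 * s + b * t = 3 * k" using x(2) row0 by auto
  have "2 * (x \<bullet> (R *\<^sub>v x)) = (2 * s + b * t) * (2 * s + b * t) + (2 * c - b * b) * (t * t)"
    unfolding form by (simp add: algebra_simps)
  then have "2 * (x \<bullet> (R *\<^sub>v x)) = 9 * (k * k) + 3 * (t * t)" unfolding k c by simp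
  moreover have "t mod 3 = 0 \<or> t mod 3 = 1 \<or> t mod 3 = 2" by auto
  then have "(t * t) mod 3 = 0 \<or> (t * t) mod 3 = 1" by (auto simp: mod_mult_eq[of t 3 t, symmetric])
  ultimately show False using x(3) by presburger
qed

text \<open>If the corner is 1, a unit vector splits off and the rank drops. Otherwise the corner is
  at least 2, and determinant 3 is then too small in ranks 3 and 4. Rank 2 leaves A_2, which
  \<open>glue\<close> excludes. In ranks 5 and 6 the minors are so tight that all diagonal entries
  are 2: in rank 5 the determinant would then be even, and in rank 6 the form would be even (E_6),
  against the given vector of odd norm.\<close>

theorem classification:
  assumes "posdef n G" "det G = 3" "glue n G" "0 < n" "n \<le> 6"
    and "n = 6 \<Longrightarrow> \<exists>x \<in> carrier_vec n. odd (x \<bullet> (G *\<^sub>v x))"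
  shows "\<exists>T. unimodular n T \<and> congr T G = std_gram n"
  using assms
proof (induction n arbitrary: G)
  case (Suc m)
  let ?n = "Suc m"
  have G: "G \<in> carrier_mat ?n ?n" using Suc.prems by (simp add: posdef_def)
  obtain T where T: "unimodular ?n T" "reduced ?n (rmat (congr T G))"
    using hermite_reduction_int Suc.prems(1) by blast
  have Tc: "T \<in> carrier_mat ?n ?n" using T by (simp add: unimodular_def)
  define R where "R = congr T G"
  have R: "R \<in> carrier_mat ?n ?n" "R\<^sup>T = R" "reduced ?n (rmat R)"
    unfolding R_def using T Tc G Suc.prems(1) by (auto simp: congr_carrier congr_symmetric posdef_def)
  have det: "det R = 3" unfolding R_def det_congr[OF Tc G] using unimodular_det[OF T(1)] Suc.prems by simp
  have glue: "glue ?n R" unfolding R_def using glue_congr Suc.prems T G by blast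
  obtain T' where T': "unimodular ?n T'" "congr T' R = G" "T' \<in> carrier_mat ?n ?n"
    using congr_unimodular_inverse[OF T(1) G] unfolding R_def by metis
  have pdR: "posdef ?n R"
    unfolding R_def using T(1) Suc.prems(1) posdef_congr by (auto simp: unimodular_def)
  note ri = reduced_int[OF R(1,3)]
  define l where "l = lead_minor R"
  have l: "l 0 = 1" "l 1 = R $$ (0, 0)" "l ?n = 3"
    unfolding l_def using lead_minor_full[OF R(1)] det lead_minor_one by auto
  have l0: "0 < l i" if "i \<le> ?n" for i using ri that by (simp add: l_def)
  have lc: "3 * (l (Suc i))\<^sup>2 \<le> 4 * l i * l (Suc (Suc i))" if "Suc i < ?n" for i using ri that by (simp add: l_def)
  consider "m = 0" | "0 < m" "R $$ (0, 0) = 1" | "0 < m" "2 \<le> R $$ (0, 0)"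
    using l0[of 1] l by force
  then show ?case
  proof cases
    case 1
    then have "R = std_gram ?n" using l R(1) by (intro eq_matI) (auto simp: std_gram_def)
    then show ?thesis using T unfolding R_def by auto
  next
    case 2
    obtain X where X: "X \<in> carrier_mat m m" "R = dsum m 1 X"
      using reduced_split[OF R 2(2)] by blast
    have "posdef m X" using posdef_dsum pdR X by blast
    moreover have "det X = 3" using det X by (simp add: det_dsum)
    moreover have "glue m X" using glue_dsum glue X by blast
    ultimately obtain S where S: "unimodular m S" "congr S X = std_gram m"
      using Suc.IH[of X] 2 Suc.prems(5) by auto
    then obtain S' where S': "S \<in> carrier_mat m m" "S' \<in> carrier_mat m m" "S * S' = 1\<^sub>m m" "S' * S = 1\<^sub>m m"
      by (auto simp: unimodular_def)
    have "unimodular ?n (dsum m 1 S)"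
      using S' by (intro unimodularI[of _ _ "dsum m 1 S'"]) (auto simp: dsum_mult dsum_one)
    moreover have "congr (dsum m 1 S) R = std_gram ?n"
      unfolding X(2) congr_dsum[OF X(1) S'(1)] S(2) using 2 by (simp add: std_gram_Suc)
    moreover have "congr (T * dsum m 1 S) G = congr (dsum m 1 S) R"
      unfolding R_def using Tc G S' by (intro congr_mult[of _ ?n]) auto
    ultimately show ?thesis using unimodular_mult[OF T(1)] by metis
  next
    case 3
    have a: "2 \<le> l 1" using 3 l by simp
    have b: "0 < l 2" "3 * (l 1)\<^sup>2 \<le> 4 * l 2" if "1 \<le> m"
      using lc[of 0] l0[of 2] that l by (simp_all add: eval_nat_numeral)
    have c: "0 < l 3" "3 * (l 2)\<^sup>2 \<le> 4 * l 1 * l 3" if "2 \<le> m"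
      using lc[of 1] l0[of 3] that by (simp_all add: eval_nat_numeral)
    have d: "0 < l 4" "3 * (l 3)\<^sup>2 \<le> 4 * l 2 * l 4" if "3 \<le> m"
      using lc[of 2] l0[of 4] that by (simp_all add: eval_nat_numeral)
    have e: "0 < l 5" "3 * (l 4)\<^sup>2 \<le> 4 * l 3 * l 5" if "4 \<le> m"
      using lc[of 3] l0[of 5] that by (simp_all add: eval_nat_numeral)
    \<comment> \<open>The successive quotients are 2, 3/2, 4/3, 1, followed by 3/4 and 1 or by 1 and
      3/4. The largest bound that occurs is 1 + (2 + 3/2 + 4/3 + 1 + 3/4)/4, which is less than
      3.\<close>
    have dia: "R $$ (i, i) = 2"
      if i: "i < ?n" and v: "l 1 = 2" "l 2 = 3" "l 3 = 4" "l 4 = 4" "4 < i \<Longrightarrow> l 6 = 3" "l 5 = 3 \<or> l 5 = 4" for i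
    proof (rule reduced_diag_even[OF R(1,3) _ i])
      show "R $$ (0, 0) = 2" using l v by simp
      have "i = 0 \<or> i = 1 \<or> i = 2 \<or> i = 3 \<or> i = 4 \<or> i = 5" using i Suc.prems(5) by linarith
      then show "rat_of_int (lead_minor R (Suc i)) / of_int (lead_minor R i)
        + (\<Sum>j<i. rat_of_int (lead_minor R (Suc j)) / of_int (lead_minor R j)) / 4 < 3"
        using v l(1) unfolding l_def by (elim disjE) (simp_all add: eval_nat_numeral)
    qed
    consider "m = 1" | "m = 2" | "m = 3" | "m = 4" | "m = 5" using 3 Suc.prems(5) by linarith
    then show ?thesis
    proof cases
      case m: 1
      have n: "?n = 2" using m by simp
      have l2: "l 2 = 3" using l n by simp
      have b: "3 * (l 1)\<^sup>2 \<le> 4 * l 2" using lc[of 0] m l by (simp add: numeral_2_eq_2)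
      have "l 1 = 2" using minor_chain(1)[OF a _ b] l2 by simp
      then have "R $$ (0, 0) = 2" using l by simp
      then have "\<not> glue 2 R" using glue_not_A2 R(1,2) det unfolding n by blast
      then show ?thesis using glue unfolding n by simp
    next
      case m: 2
      have m': "1 \<le> m" "2 \<le> m" using m by simp_all
      note b = b[OF m'(1)] and c = c[OF m'(2)]
      show ?thesis using minor_chain(2)[OF a b c] l m by (simp add: eval_nat_numeral)
    next
      case m: 3
      have m': "1 \<le> m" "2 \<le> m" "3 \<le> m" using m by simp_all
      note b = b[OF m'(1)] and c = c[OF m'(2)] and d = d[OF m'(3)]
      show ?thesis using minor_chain(3)[OF a b c d] l m by (simp add: eval_nat_numeral)
    next
      case m: 4
      have m': "1 \<le> m" "2 \<le> m" "3 \<le> m" "4 \<le> m" using m by simp_all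
      note b = b[OF m'(1)] and c = c[OF m'(2)] and d = d[OF m'(3)] and e = e[OF m'(4)]
      have l5: "l 5 = 3" using l m by (simp add: eval_nat_numeral)
      have v: "l 0 = 1" "l 1 = 2" "l 2 = 3" "l 3 = 4" "l 4 = 4" "l 5 = 3"
        using minor_chain(4)[OF a b c d e] l5 l by simp_all
      have "R $$ (i, i) = 2" if "i < ?n" for i using dia[OF that v(2-5)] v(6) m that by force
      then have "even (det R)" using m by (intro even_det[OF R(1,2)]) auto
      then show ?thesis using det by simp
    next
      case m: 5
      have m': "1 \<le> m" "2 \<le> m" "3 \<le> m" "4 \<le> m" using m by simp_all
      note b = b[OF m'(1)] and c = c[OF m'(2)] and d = d[OF m'(3)] and e = e[OF m'(4)]
      have f: "3 * (l 5)\<^sup>2 \<le> 4 * l 4 * l 6" using lc[of 4] m l by (simp_all add: eval_nat_numeral)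
      have l6: "l 6 = 3" using l m by (simp add: eval_nat_numeral)
      have v: "l 0 = 1" "l 1 = 2" "l 2 = 3" "l 3 = 4" "l 4 = 4" "l 5 = 3 \<or> l 5 = 4"
        using minor_chain(5)[OF a b c d e] f l6 l by simp_all
      have dia: "R $$ (i, i) = 2" if "i < ?n" for i using dia[OF that v(2-5)] v(6) l6 m by auto
      obtain x where x: "x \<in> carrier_vec ?n" "odd (x \<bullet> (G *\<^sub>v x))" using Suc.prems(6) m by auto
      have "x \<bullet> (G *\<^sub>v x) = (T' *\<^sub>v x) \<bullet> (R *\<^sub>v (T' *\<^sub>v x))"
        using congr_form[OF T'(3) R(1) x(1) x(1)] T'(2) by simp
      moreover have "even ((T' *\<^sub>v x) \<bullet> (R *\<^sub>v (T' *\<^sub>v x)))"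
        using T'(3) x(1) dia by (intro even_form[OF R(1,2)]) auto
      ultimately show ?thesis using x by simp
    qed
  qed
qed simp

subsection \<open>Parity patterns and descent\<close>

text \<open>The values modulo \<open>2\<close> of \<open>(l\<^sub>0, \<dots>, l\<^sub>4, w)\<close> that are possible when \<open>l\<^sub>0\<^sup>2 + \<dots> + l\<^sub>4\<^sup>2 + 3 w\<^sup>2\<close> is \<open>1\<close>
  modulo \<open>4\<close>.\<close>

definition parity_rows :: "bool list list" where
  "parity_rows = [[True, False, False, False, False, False], [False, True, False, False, False, False],
    [False, False, True, False, False, False], [False, False, False, True, False, False],
    [False, False, False, False, True, False], [True, True, True, True, True, False],
    [True, True, False, False, False, True], [True, False, True, False, False, True],
    [True, False, False, True, False, True], [True, False, False, False, True, True],
    [False, True, True, False, False, True], [False, True, False, True, False, True],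
    [False, True, False, False, True, True], [False, False, True, True, False, True],
    [False, False, True, False, True, True], [False, False, False, True, True, True]]"

primrec odd_many :: "bool list \<Rightarrow> bool" where
  "odd_many [] = False" | "odd_many (b # bs) = (if b then \<not> odd_many bs else odd_many bs)"

text \<open>The coefficient 3 of \<open>w\<close> is odd, so modulo 2 the last entry enters the
  inner product like the other five.\<close>

definition parity_orth :: "bool list \<Rightarrow> bool list \<Rightarrow> bool" where
  "parity_orth u v \<longleftrightarrow> \<not> odd_many (map2 (\<and>) u v)"

definition index_sets :: "nat \<Rightarrow> nat list list" where
  "index_sets k = filter (\<lambda>q. length q = k) (subseqs [0, 1, 2, 3, 4])"

definition kills :: "bool list \<Rightarrow> nat list \<Rightarrow> bool" where
  "kills u q \<longleftrightarrow> \<not> odd_many (map ((!) u) q)"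

definition kills_three :: "bool list \<Rightarrow> bool list \<Rightarrow> bool list \<Rightarrow> bool" where
  "kills_three u v z \<longleftrightarrow> list_ex (\<lambda>q. if kills u q then if kills v q then kills z q else False else False) (index_sets 3)"

text \<open>The parities after replacing \<open>l\<^sub>i\<close> by \<open>h - l\<^sub>i\<close> for \<open>i\<close> in \<open>q\<close>, where \<open>2 h\<close> is the sum of these \<open>l\<^sub>i\<close> and
  \<open>h\<close> is odd iff \<open>s\<close>. Changing the sign of the last \<open>l\<^sub>i\<close> beforehand changes \<open>h\<close> by that \<open>l\<^sub>i\<close>, whence the
  two alternatives in \<open>hadamard_kills\<close>.\<close>

definition hadamard_row :: "nat list \<Rightarrow> bool \<Rightarrow> bool list \<Rightarrow> bool list" where
  "hadamard_row q s u = map (\<lambda>i. if i \<in> set q then (if s then \<not> u ! i else u ! i) else u ! i) [0, 1, 2, 3, 4, 5]"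

definition hadamard_kills :: "bool list \<Rightarrow> bool list \<Rightarrow> bool list \<Rightarrow> bool" where
  "hadamard_kills u v z \<longleftrightarrow> list_ex (\<lambda>q. if kills u q then if kills v q then if kills z q then
     list_all (\<lambda>r. list_all (\<lambda>s. list_all (\<lambda>t.
       if kills_three (hadamard_row q r u) (hadamard_row q s v) (hadamard_row q t z) then True
       else kills_three (hadamard_row q (r \<noteq> u ! (last q)) u) (hadamard_row q (s \<noteq> v ! (last q)) v) (hadamard_row q (t \<noteq> z ! (last q)) z))
       [False, True]) [False, True]) [False, True] else False else False else False) (index_sets 4)"

text \<open>This is the outcome when \<open>w\<close> is even at all three vectors. The row with
  five odd entries then has odd product with every possible row, itself included, so three pairwise
  orthogonal rows are distinct unit rows and two of the first five columns stay empty.\<close>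

definition two_zeros :: "bool list \<Rightarrow> bool list \<Rightarrow> bool list \<Rightarrow> bool" where
  "two_zeros u v z \<longleftrightarrow> list_ex (\<lambda>q. list_all (\<lambda>i. \<not> u ! i \<and> \<not> v ! i \<and> \<not> z ! i) q) (index_sets 2)"

definition parity_check :: "bool list \<Rightarrow> bool list \<Rightarrow> bool list \<Rightarrow> bool" where
  "parity_check u v z \<longleftrightarrow> (if u ! 5 \<or> v ! 5 \<or> z ! 5 then if kills_three u v z then True else hadamard_kills u v z else two_zeros u v z)"

lemma parity_check_rows:
  "list_all (\<lambda>u. list_all (\<lambda>v. if parity_orth u v then
     list_all (\<lambda>z. if parity_orth u z then if parity_orth v z then parity_check u v z else True else True) parity_rows else True) parity_rows) parity_rows"
  by code_simp

section \<open>Additive functions and the 2-adic descent for X^2 + Y^2 + 3 W^2\<close>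

definition additive_on :: "int vec set \<Rightarrow> (int vec \<Rightarrow> int) \<Rightarrow> bool" where
  "additive_on M f \<longleftrightarrow> (\<forall>x \<in> M. \<forall>y \<in> M. f (x + y) = f x + f y)"

lemma additive_on_add: "additive_on M f \<Longrightarrow> additive_on M g \<Longrightarrow> additive_on M (\<lambda>x. f x + g x)"
  and additive_on_diff: "additive_on M f \<Longrightarrow> additive_on M g \<Longrightarrow> additive_on M (\<lambda>x. f x - g x)"
  and additive_on_mult: "additive_on M f \<Longrightarrow> additive_on M (\<lambda>x. k * f x)"
  and additive_on_uminus: "additive_on M f \<Longrightarrow> additive_on M (\<lambda>x. - f x)"
  and additive_on_zero: "additive_on M (\<lambda>x. 0)"
  by (auto simp: additive_on_def algebra_simps)

lemma additive_on_div:
  "additive_on M f \<Longrightarrow> (\<And>x. x \<in> M \<Longrightarrow> k dvd f x) \<Longrightarrow> additive_on M (\<lambda>x. f x div k)"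
  by (auto simp: additive_on_def div_plus_div_distrib_dvd_left)

lemmas additive_on_intros = additive_on_add additive_on_diff additive_on_mult additive_on_uminus additive_on_zero

text \<open>If \<open>F\<close> is the part of the norm carried by two of the squares and by
  \<open>w\<close>, such \<open>X\<close>, \<open>Y\<close>, \<open>W\<close> can take their place,
  and the new \<open>w\<close> has an odd value.\<close>

definition odd_rep :: "int vec set \<Rightarrow> (int vec \<Rightarrow> int) \<Rightarrow> bool" where
  "odd_rep M F \<longleftrightarrow> (\<exists>X Y W. additive_on M X \<and> additive_on M Y \<and> additive_on M W \<and>
      (\<forall>x\<in>M. (X x)\<^sup>2 + (Y x)\<^sup>2 + 3 * (W x)\<^sup>2 = F x) \<and> (\<exists>x\<in>M. odd (W x)))"

lemma odd_repI:
  assumes "additive_on M X" "additive_on M Y" "additive_on M W"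
    "\<And>x. x \<in> M \<Longrightarrow> (X x)\<^sup>2 + (Y x)\<^sup>2 + 3 * (W x)\<^sup>2 = F x" "\<exists>x\<in>M. odd (W x)"
  shows "odd_rep M F"
  using assms unfolding odd_rep_def by blast

lemma odd_rep_cong: "odd_rep M F \<Longrightarrow> (\<And>x. x \<in> M \<Longrightarrow> F x = F' x) \<Longrightarrow> odd_rep M F'"
  unfolding odd_rep_def by auto

text \<open>If \<open>X - W\<close> takes an odd value, pass to \<open>(X + 3 W, X - W)\<close>. Otherwise first rotate \<open>(X, W)\<close> to
  \<open>((X + 3 W) / 2, (X - W) / 2)\<close> or \<open>((X - 3 W) / 2, (X + W) / 2)\<close>: the two new values of \<open>W\<close>
  differ by an odd number somewhere, so one of them differs in parity from \<open>Y\<close>, and the first case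
  applies with \<open>Y\<close> in place of \<open>X\<close>.\<close>

lemma descent_step:
  assumes ad: "additive_on M X" "additive_on M Y" "additive_on M W" and odd: "\<exists>x\<in>M. odd (X x) \<or> odd (Y x) \<or> odd (W x)"
  shows "odd_rep M (\<lambda>x. 4 * ((X x)\<^sup>2 + (Y x)\<^sup>2 + 3 * (W x)\<^sup>2))" (is "?P X Y W")
proof -
  have step: "?P X Y W" if "additive_on M X" "additive_on M Y" "additive_on M W" "\<exists>x\<in>M. odd (W x - X x)" for X Y W
  proof (rule odd_repI[of M "\<lambda>x. X x + 3 * W x" "\<lambda>x. 2 * Y x" "\<lambda>x. X x - W x"])
    show "(X x + 3 * W x)\<^sup>2 + (2 * Y x)\<^sup>2 + 3 * (X x - W x)\<^sup>2 = 4 * ((X x)\<^sup>2 + (Y x)\<^sup>2 + 3 * (W x)\<^sup>2)" for x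
      by (simp add: power2_eq_square algebra_simps)
  qed (use that in \<open>auto intro!: additive_on_intros\<close>)
  have swap: "?P X Y W" if "?P Y X W" for X Y W
    using that by (rule odd_rep_cong) simp
  consider "\<exists>x\<in>M. odd (W x - X x)" | "\<exists>x\<in>M. odd (W x - Y x)"
    | "\<forall>x\<in>M. even (W x - X x)" "\<forall>x\<in>M. even (W x - Y x)" by blast
  then show ?thesis
  proof cases
    case 1 then show ?thesis using step[OF ad] by blast
  next
    case 2 then show ?thesis using swap step[OF ad(2,1,3)] by blast
  next
    case 3
    define d where "d x = (X x - W x) div 2" for x
    have d: "X x = 2 * d x + W x" if "x \<in> M" for x using 3(1) that by (auto simp: d_def)
    have da: "additive_on M d" unfolding d_def using ad 3 by (intro additive_on_div additive_on_intros) auto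
    obtain m where m: "m \<in> M" "odd (W m)" "odd (Y m)" using odd 3 by force
    obtain e where e: "\<exists>x\<in>M. odd ((if e then d x else d x + W x) - Y x)"
    proof (cases "\<exists>x\<in>M. odd (d x - Y x)")
      case True
      then show ?thesis using that[of True] by simp
    next
      case False
      then have "odd (d m + W m - Y m)" using m by auto
      then show ?thesis using that[of False] m(1) by auto
    qed
    let ?X = "\<lambda>x. if e then d x + 2 * W x else d x - W x" and ?W = "\<lambda>x. if e then d x else d x + W x"
    have a: "additive_on M ?X" "additive_on M ?W"
      using ad da by (cases e; auto intro!: additive_on_intros)+
    show ?thesis
      by (rule odd_rep_cong[OF swap[OF step[OF ad(2) a e]]]) (simp add: d power2_eq_square algebra_simps)
  qed
qed

text \<open>All functions are halved until one of them takes an odd value. On the way back each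
  halving is undone by one use of \<open>descent_step\<close>, which restores the factor 4 and makes
  \<open>W\<close> odd somewhere. The nonzero value at \<open>x0\<close> makes the halving
  stop.\<close>

lemma descent:
  assumes "additive_on M X" "additive_on M Y" "additive_on M W"
    and "\<And>x. x \<in> M \<Longrightarrow> even (X x) \<and> even (Y x) \<and> even (W x)"
    and x0: "x0 \<in> M" and "X x0 \<noteq> 0 \<or> Y x0 \<noteq> 0 \<or> W x0 \<noteq> 0"
  shows "odd_rep M (\<lambda>x. (X x)\<^sup>2 + (Y x)\<^sup>2 + 3 * (W x)\<^sup>2)"
  using assms(1-4,6)
proof (induction "nat (\<bar>X x0\<bar> + \<bar>Y x0\<bar> + \<bar>W x0\<bar>)" arbitrary: X Y W rule: less_induct)
  case less
  let ?h = "\<lambda>f x. f x div (2::int)"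
  have h: "X x = 2 * ?h X x" "Y x = 2 * ?h Y x" "W x = 2 * ?h W x" if "x \<in> M" for x
    using less.prems(4)[OF that] by auto
  have a: "additive_on M (?h X)" "additive_on M (?h Y)" "additive_on M (?h W)"
    using less.prems by (auto intro!: additive_on_div)
  obtain A B C where ABC: "additive_on M A" "additive_on M B" "additive_on M C" "\<exists>x\<in>M. odd (A x) \<or> odd (B x) \<or> odd (C x)"
    "\<And>x. x \<in> M \<Longrightarrow> (A x)\<^sup>2 + (B x)\<^sup>2 + 3 * (C x)\<^sup>2 = (?h X x)\<^sup>2 + (?h Y x)\<^sup>2 + 3 * (?h W x)\<^sup>2"
  proof (cases "\<exists>x\<in>M. odd (?h X x) \<or> odd (?h Y x) \<or> odd (?h W x)")
    case True
    then show ?thesis using that[OF a] by simp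
  next
    case False
    obtain p q s where e: "X x0 = 2 * p" "Y x0 = 2 * q" "W x0 = 2 * s" using less.prems(4)[OF x0] by (meson evenE)
    have pqs: "p \<noteq> 0 \<or> q \<noteq> 0 \<or> s \<noteq> 0" using less.prems(5) unfolding e by auto
    then have nz: "?h X x0 \<noteq> 0 \<or> ?h Y x0 \<noteq> 0 \<or> ?h W x0 \<noteq> 0" unfolding e by simp
    have "0 < \<bar>p\<bar> + \<bar>q\<bar> + \<bar>s\<bar>" using pqs by linarith
    then have "nat (\<bar>?h X x0\<bar> + \<bar>?h Y x0\<bar> + \<bar>?h W x0\<bar>) < nat (\<bar>X x0\<bar> + \<bar>Y x0\<bar> + \<bar>W x0\<bar>)"
      unfolding e by (simp add: abs_mult)
    from less.hyps[OF this a _ nz] False show ?thesis using that unfolding odd_rep_def by blast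
  qed
  show ?case
  proof (rule odd_rep_cong[OF descent_step[OF ABC(1-4)]])
    fix x assume x: "x \<in> M"
    have "(X x)\<^sup>2 + (Y x)\<^sup>2 + 3 * (W x)\<^sup>2 = (2 * ?h X x)\<^sup>2 + (2 * ?h Y x)\<^sup>2 + 3 * (2 * ?h W x)\<^sup>2"
      using h[OF x] by simp
    then show "4 * ((A x)\<^sup>2 + (B x)\<^sup>2 + 3 * (C x)\<^sup>2) = (X x)\<^sup>2 + (Y x)\<^sup>2 + 3 * (W x)\<^sup>2"
      unfolding ABC(5)[OF x] power_mult_distrib by simp
  qed
qed

section \<open>From five squares and 3 w^2 to a triple with even sum\<close>

definition square_rep :: "int vec set \<Rightarrow> (nat \<Rightarrow> int vec \<Rightarrow> int) \<Rightarrow> (int vec \<Rightarrow> int) \<Rightarrow> bool" where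
  "square_rep M g w \<longleftrightarrow> (\<forall>i<5. additive_on M (g i)) \<and> additive_on M w \<and>
    (\<forall>x\<in>M. (\<Sum>i<5. (g i x)\<^sup>2) + 3 * (w x)\<^sup>2 = x \<bullet> x)"

definition even_rep :: "int vec set \<Rightarrow> bool" where
  "even_rep M \<longleftrightarrow> (\<exists>g w. square_rep M g w \<and> (\<forall>x\<in>M. even (g 0 x + g 1 x + g 2 x)))"

definition parity_row :: "(nat \<Rightarrow> int vec \<Rightarrow> int) \<Rightarrow> (int vec \<Rightarrow> int) \<Rightarrow> int vec \<Rightarrow> bool list" where
  "parity_row g w v = map (\<lambda>i. odd (g i v)) [0..<5] @ [odd (w v)]"

lemma square_mod_4: "\<exists>q. a\<^sup>2 = 4 * q + of_bool (odd a)" for a :: int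
proof (cases "even a")
  case True then show ?thesis by (auto elim!: evenE simp: power2_eq_square)
next
  case False
  then obtain b where "a = 2 * b + 1" by (rule oddE)
  then show ?thesis by (intro exI[of _ "b * b + b"]) (simp add: power2_eq_square algebra_simps)
qed

lemma sum_lessThan_5: fixes f :: "nat \<Rightarrow> int" shows "(\<Sum>i<5. f i) = f 0 + f 1 + f 2 + f 3 + (f 4 :: int)"
  by (simp add: eval_nat_numeral)

lemma parity_row_eq: "parity_row g w v = [odd (g 0 v), odd (g 1 v), odd (g 2 v), odd (g 3 v), odd (g 4 v), odd (w v)]"
  by (simp add: parity_row_def upt_rec numeral_eq_Suc)

lemma parity_row_nth: "i < 5 \<Longrightarrow> parity_row g w v ! i = odd (g i v)" "parity_row g w v ! 5 = odd (w v)"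
  unfolding parity_row_def by (subst nth_append; simp)+

lemma odd_many_odd: "odd_many (map odd xs) \<longleftrightarrow> odd (sum_list (xs :: int list))"
  by (induction xs) auto

lemma kills_parity_row: "list_all (\<lambda>i. i < 5) q \<Longrightarrow> kills (parity_row g w v) q \<longleftrightarrow> even (\<Sum>i\<leftarrow>q. g i v)"
proof -
  assume "list_all (\<lambda>i. i < 5) q"
  then have "map ((!) (parity_row g w v)) q = map odd (map (\<lambda>i. g i v) q)"
    by (auto simp: parity_row_nth list_all_iff)
  then show ?thesis by (simp only: kills_def odd_many_odd not_not)
qed

lemma index_sets_props:
  "list_all (\<lambda>q. length q = 2 \<and> distinct q \<and> list_all (\<lambda>i. i < 5) q) (index_sets 2)"
  "list_all (\<lambda>q. length q = 3 \<and> distinct q \<and> list_all (\<lambda>i. i < 5) q) (index_sets 3)"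
  "list_all (\<lambda>q. length q = 4 \<and> distinct q \<and> list_all (\<lambda>i. i < 5) q) (index_sets 4)"
  by code_simp+

lemma list_all_bool: "list_all P [False, True] \<longleftrightarrow> (\<forall>b. P b)"
  by (auto simp: all_bool_eq)

lemma if_True_else_False: "(if a then b else False) \<longleftrightarrow> a \<and> b" "(if a then True else b) \<longleftrightarrow> a \<or> b"
  by auto

lemma sum_distinct_5:
  fixes f :: "nat \<Rightarrow> int"
  assumes "distinct q" "set q \<subseteq> {..<5}" "length q = 5"
  shows "(\<Sum>i<5. f i) = (\<Sum>i\<leftarrow>q. f i)"
proof -
  have "set q = {..<5}"
    using assms by (intro card_subset_eq) (auto simp: distinct_card)
  then show ?thesis using sum.distinct_set_conv_list[OF assms(1), of f] by simp
qed

lemma distinct_extend: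
  assumes "distinct q" "list_all (\<lambda>i. i < 5) q" "length q < 5"
  obtains t :: nat where "t < 5" "t \<notin> set q"
proof -
  have "card (set q) < card {..<5::nat}" using assms by (simp add: distinct_card)
  then have "\<not> {..<5} \<subseteq> set q" using card_mono[of "set q" "{..<5::nat}"] by auto
  then show ?thesis using that by auto
qed

lemma even_rep_of_triple:
  assumes r: "square_rep M g w" and q: "distinct [i, j, k]" "i < 5" "j < 5" "k < 5"
    and ev: "\<And>x. x \<in> M \<Longrightarrow> even (g i x + g j x + g k x)"
  shows "even_rep M"
proof -
  obtain s where s: "s < 5" "s \<notin> set [i, j, k]" using distinct_extend[of "[i, j, k]"] q by auto
  obtain t where t: "t < 5" "t \<notin> set [i, j, k, s]" using distinct_extend[of "[i, j, k, s]"] q s by auto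
  define g' where "g' r = g ([i, j, k, s, t] ! r)" for r
  have l: "g' 0 = g i" "g' 1 = g j" "g' 2 = g k" "g' 3 = g s" "g' 4 = g t"
    by (simp_all add: g'_def eval_nat_numeral)
  have "additive_on M (g' r)" if "r < 5" for r
  proof -
    have "r = 0 \<or> r = 1 \<or> r = 2 \<or> r = 3 \<or> r = 4" using that by linarith
    then show ?thesis using l r q s t by (auto simp: square_rep_def)
  qed
  moreover have "(\<Sum>r<5. (g' r x)\<^sup>2) = (\<Sum>r<5. (g r x)\<^sup>2)" for x
  proof -
    have d: "distinct [i, j, k, s, t]" "set [i, j, k, s, t] \<subseteq> {..<5}" using q s t by auto
    show ?thesis
      unfolding sum_distinct_5[OF d, of "\<lambda>r. (g r x)\<^sup>2", simplified] sum_lessThan_5 l by simp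
  qed
  ultimately have "square_rep M g' w" using r by (simp add: square_rep_def)
  then show ?thesis unfolding even_rep_def using ev l by metis
qed

text \<open>The assumption \<open>even_gen\<close> stands for odd index of the span of the
  \<open>m k\<close> in \<open>M\<close>: an additive function is even on \<open>M\<close> as soon
  as it is even at these three vectors. This reduces parity questions on \<open>M\<close> to three
  parity rows. In the application the \<open>m k\<close> are \<open>p\<close> times the unit
  vectors.\<close>

locale odd_index =
  fixes M :: "int vec set" and m :: "nat \<Rightarrow> int vec" and c :: int
  assumes M_carrier: "M \<subseteq> carrier_vec 3"
    and M_add: "x \<in> M \<Longrightarrow> y \<in> M \<Longrightarrow> x + y \<in> M"
    and m_in: "k < 3 \<Longrightarrow> m k \<in> M"
    and m_form: "j < 3 \<Longrightarrow> k < 3 \<Longrightarrow> m j \<bullet> m k = (if j = k then c else 0)"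
    and c_mod: "c mod 4 = 1"
    and even_gen: "additive_on M f \<Longrightarrow> (\<And>k. k < 3 \<Longrightarrow> even (f (m k))) \<Longrightarrow> x \<in> M \<Longrightarrow> even (f x)"
begin

abbreviation "on_rows Q g w \<equiv> Q (parity_row g w (m 0)) (parity_row g w (m 1)) (parity_row g w (m 2))"

lemma even_gen3:
  assumes "additive_on M f" "even (f (m 0))" "even (f (m 1))" "even (f (m 2))" "x \<in> M"
  shows "even (f x)"
proof (rule even_gen[OF assms(1) _ assms(5)])
  fix k :: nat assume "k < 3"
  then have "k = 0 \<or> k = 1 \<or> k = 2" by linarith
  then show "even (f (m k))" using assms by auto
qed

lemma polar:
  assumes r: "square_rep M g w" and x: "x \<in> M" "y \<in> M"
  shows "(\<Sum>i<5. g i x * g i y) + 3 * (w x * w y) = x \<bullet> y"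
proof -
  have a: "g i (x + y) = g i x + g i y" if "i < 5" for i using r x that by (auto simp: square_rep_def additive_on_def)
  have w: "w (x + y) = w x + w y" using r x by (auto simp: square_rep_def additive_on_def)
  have n: "(\<Sum>i<5. (g i z)\<^sup>2) + 3 * (w z)\<^sup>2 = z \<bullet> z" if "z \<in> M" for z using r that by (auto simp: square_rep_def)
  have c: "x \<in> carrier_vec 3" "y \<in> carrier_vec 3" using x M_carrier by auto
  have "(x + y) \<bullet> (x + y) = x \<bullet> x + 2 * (x \<bullet> y) + y \<bullet> y"
    using c by (simp add: scalar_prod_add_distrib[of _ 3] add_scalar_prod_distrib[of _ 3] comm_scalar_prod[of y 3 x])
  moreover have "(\<Sum>i<5. (g i (x + y))\<^sup>2) + 3 * (w (x + y))\<^sup>2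
     = ((\<Sum>i<5. (g i x)\<^sup>2) + 3 * (w x)\<^sup>2) + 2 * ((\<Sum>i<5. g i x * g i y) + 3 * (w x * w y)) + ((\<Sum>i<5. (g i y)\<^sup>2) + 3 * (w y)\<^sup>2)"
    by (simp add: a w sum_lessThan_5 power2_eq_square algebra_simps)
  ultimately show ?thesis using n[OF x(1)] n[OF x(2)] n[OF M_add[OF x]] by simp
qed

lemma parity_row_in:
  assumes r: "square_rep M g w" and k: "k < 3"
  shows "parity_row g w (m k) \<in> set parity_rows"
proof -
  let ?b = "\<lambda>a. of_bool (odd (a::int)) :: int"
  obtain q where q: "\<And>a. a\<^sup>2 = 4 * q a + ?b a" using square_mod_4 by metis
  let ?l = "\<lambda>i. g i (m k)"
  have "(\<Sum>i<5. (?l i)\<^sup>2) + 3 * (w (m k))\<^sup>2 = c"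
    using r m_in[OF k] m_form[OF k k] by (simp add: square_rep_def)
  then have "c = 4 * (q (?l 0) + q (?l 1) + q (?l 2) + q (?l 3) + q (?l 4) + 3 * q (w (m k)))
    + (?b (?l 0) + ?b (?l 1) + ?b (?l 2) + ?b (?l 3) + ?b (?l 4) + 3 * ?b (w (m k)))"
    unfolding sum_lessThan_5 q by (simp add: algebra_simps)
  moreover have "(4 * A + B) mod 4 = B mod 4" for A B :: int by simp
  ultimately have *: "(?b (?l 0) + ?b (?l 1) + ?b (?l 2) + ?b (?l 3) + ?b (?l 4) + 3 * ?b (w (m k))) mod 4 = 1"
    using c_mod by metis
  have "[b0, b1, b2, b3, b4, b5] \<in> set parity_rows"
    if "(of_bool b0 + of_bool b1 + of_bool b2 + of_bool b3 + of_bool b4 + 3 * of_bool b5) mod 4 = (1::int)" for b0 b1 b2 b3 b4 b5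
    using that by (cases b0; cases b1; cases b2; cases b3; cases b4; cases b5; simp add: parity_rows_def)
  from this[OF *] show ?thesis unfolding parity_row_eq .
qed

lemma parity_orth_rows:
  assumes r: "square_rep M g w" and k: "j < 3" "k < 3" "j \<noteq> k"
  shows "parity_orth (parity_row g w (m j)) (parity_row g w (m k))"
proof -
  let ?p = "\<lambda>i. g i (m j) * g i (m k)"
  have "(\<Sum>i<5. ?p i) + 3 * (w (m j) * w (m k)) = 0"
    using polar[OF r m_in m_in] m_form k by simp
  then have "even (?p 0 + ?p 1 + ?p 2 + ?p 3 + ?p 4 + 3 * (w (m j) * w (m k)))"
    unfolding sum_lessThan_5 by (simp only: even_zero)
  then have "even (sum_list [?p 0, ?p 1, ?p 2, ?p 3, ?p 4, w (m j) * w (m k)])"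
    by (simp only: sum_list.Cons sum_list.Nil even_add even_mult_iff) auto
  moreover have "map2 (\<and>) (parity_row g w (m j)) (parity_row g w (m k)) = map odd [?p 0, ?p 1, ?p 2, ?p 3, ?p 4, w (m j) * w (m k)]"
    unfolding parity_row_eq by simp
  ultimately show ?thesis unfolding parity_orth_def by (simp only: odd_many_odd not_not)
qed

lemma even_rep_of_kills_three:
  assumes r: "square_rep M g w" and t: "on_rows kills_three g w"
  shows "even_rep M"
proof -
  obtain q where q: "q \<in> set (index_sets 3)" "kills (parity_row g w (m 0)) q" "kills (parity_row g w (m 1)) q" "kills (parity_row g w (m 2)) q"
    using t by (auto simp: kills_three_def list_ex_iff split: if_splits)
  then have p: "length q = 3" "distinct q" "list_all (\<lambda>i. i < 5) q"
    using index_sets_props(2) by (auto simp: list_all_iff)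
  then obtain i j k where ijk: "q = [i, j, k]" by (auto simp: length_Suc_conv eval_nat_numeral)
  have a: "additive_on M (\<lambda>x. g i x + g j x + g k x)"
    using r p unfolding ijk by (auto simp: square_rep_def intro!: additive_on_intros)
  have "even (g i x + g j x + g k x)" if "x \<in> M" for x
    using q(2-4)[unfolded kills_parity_row[OF p(3)]] unfolding ijk by (intro even_gen3[OF a _ _ _ that]) (simp_all add: add.assoc)
  then show ?thesis using even_rep_of_triple[OF r] p unfolding ijk by simp
qed

text \<open>On the four coordinates the map l |-> s - l is minus the reflection in (1, 1, 1, 1). It
  preserves the sum of squares, since 4 s^2 - 2 s (2 s) = 0, and it is integral here because the sum
  of the four is 2 s.\<close>

lemma hadamard_square_rep:
  assumes r: "square_rep M g w" and q: "q = [i, j, k, l]" "distinct q" "list_all (\<lambda>i. i < 5) q"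
    and s: "additive_on M s" "\<And>x. x \<in> M \<Longrightarrow> 2 * s x = g i x + g j x + g k x + g l x"
  obtains g' where "square_rep M g' w" "\<And>v. parity_row g' w v = hadamard_row q (odd (s v)) (parity_row g w v)"
proof -
  define g' where "g' = (\<lambda>r x. if r \<in> set q then s x - g r x else g r x)"
  obtain t where t: "t < 5" "t \<notin> set q" using distinct_extend[of q] q by auto
  have "additive_on M (g' r)" if "r < 5" for r
    using r s that by (cases "r \<in> set q") (auto simp: square_rep_def g'_def intro!: additive_on_intros)
  moreover have "(\<Sum>r<5. (g' r x)\<^sup>2) = (\<Sum>r<5. (g r x)\<^sup>2)" if "x \<in> M" for x
  proof -
    have d: "distinct [i, j, k, l, t]" "set [i, j, k, l, t] \<subseteq> {..<5}" using q t by auto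
    have e: "(\<Sum>r<5. f r) = f i + f j + f k + f l + f t" for f :: "nat \<Rightarrow> int"
      unfolding sum_distinct_5[OF d, of f, simplified] by simp
    have m: "i \<in> set q" "j \<in> set q" "k \<in> set q" "l \<in> set q" using q by auto
    have l: "g l x = 2 * s x - g i x - g j x - g k x" using s(2)[OF that] by simp
    show ?thesis unfolding e g'_def using m t(2) by (simp only: if_True if_False l) (simp add: power2_eq_square algebra_simps)
  qed
  ultimately have r': "square_rep M g' w" using r by (simp add: square_rep_def)
  have "5 \<notin> set q" using q(3) by (auto simp: list_all_iff)
  then have "parity_row g' w v = hadamard_row q (odd (s v)) (parity_row g w v)" for v
    unfolding hadamard_row_def parity_row_eq by (auto simp: g'_def)
  with r' that show ?thesis by blast
qed

lemma even_rep_of_hadamard: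
  assumes r: "square_rep M g w" and t: "on_rows hadamard_kills g w"
  shows "even_rep M"
proof -
  let ?u = "\<lambda>k. parity_row g w (m k)"
  obtain q where q: "q \<in> set (index_sets 4)" "kills (?u 0) q" "kills (?u 1) q" "kills (?u 2) q"
    and h: "\<And>a b d. kills_three (hadamard_row q a (?u 0)) (hadamard_row q b (?u 1)) (hadamard_row q d (?u 2)) \<or>
      kills_three (hadamard_row q (a \<noteq> ?u 0 ! last q) (?u 0)) (hadamard_row q (b \<noteq> ?u 1 ! last q) (?u 1)) (hadamard_row q (d \<noteq> ?u 2 ! last q) (?u 2))"
    using t unfolding hadamard_kills_def list_ex_iff list_all_bool if_True_else_False by (elim bexE conjE) (rule that, assumption+, blast)
  then have p: "length q = 4" "distinct q" "list_all (\<lambda>i. i < 5) q"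
    using index_sets_props(3) by (auto simp: list_all_iff)
  then obtain i j k l where ijk: "q = [i, j, k, l]" by (auto simp: length_Suc_conv eval_nat_numeral)
  have l5: "i < 5" "j < 5" "k < 5" "l < 5" using p unfolding ijk by auto
  have a: "additive_on M (\<lambda>x. g i x + g j x + g k x + g l x)"
    using r l5 by (auto simp: square_rep_def intro!: additive_on_intros)
  have ev: "even (g i x + g j x + g k x + g l x)" if "x \<in> M" for x
    using q(2-4)[unfolded kills_parity_row[OF p(3)]] unfolding ijk by (intro even_gen3[OF a _ _ _ that]) (simp_all add: add.assoc)
  define s where "s x = (g i x + g j x + g k x + g l x) div 2" for x
  have s: "additive_on M s" "\<And>x. x \<in> M \<Longrightarrow> 2 * s x = g i x + g j x + g k x + g l x"
    using a ev unfolding s_def by (auto intro!: additive_on_div)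
  define g2 where "g2 = (\<lambda>r x. if r = l then - g l x else g r x)"
  have r2: "square_rep M g2 w"
  proof -
    have "additive_on M (g2 r)" if "r < 5" for r
      using r l5 that by (cases "r = l") (auto simp: square_rep_def g2_def intro!: additive_on_intros)
    moreover have "(g2 r x)\<^sup>2 = (g r x)\<^sup>2" for r x by (simp add: g2_def)
    ultimately show ?thesis using r by (simp add: square_rep_def)
  qed
  have row2: "parity_row g2 w v = parity_row g w v" for v unfolding parity_row_eq by (simp add: g2_def)
  define s2 where "s2 x = s x - g l x" for x
  have s2: "additive_on M s2" "\<And>x. x \<in> M \<Longrightarrow> 2 * s2 x = g2 i x + g2 j x + g2 k x + g2 l x"
    using s r l5 p(2) unfolding s2_def ijk by (auto simp: g2_def square_rep_def intro!: additive_on_intros)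
  have "odd (s2 v) = (odd (s v) \<noteq> parity_row g w v ! last q)" for v
    using l5 parity_row_nth(1)[of l] by (simp add: s2_def ijk)
  note o = this
  obtain g' where g': "square_rep M g' w" "\<And>v. parity_row g' w v = hadamard_row q (odd (s v)) (parity_row g w v)"
    using hadamard_square_rep[OF r ijk p(2,3) s] by blast
  obtain g'' where g'': "square_rep M g'' w" "\<And>v. parity_row g'' w v = hadamard_row q (odd (s2 v)) (parity_row g2 w v)"
    using hadamard_square_rep[OF r2 ijk p(2,3) s2] by blast
  show ?thesis
    using h[of "odd (s (m 0))" "odd (s (m 1))" "odd (s (m 2))"]
      even_rep_of_kills_three[OF g'(1)] even_rep_of_kills_three[OF g''(1)]
    unfolding g'(2) g''(2) row2 o by blast
qed

lemma parity_check_holds: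
  assumes r: "square_rep M g w"
  shows "on_rows parity_check g w"
proof -
  have "parity_row g w (m 0) \<in> set parity_rows" "parity_row g w (m 1) \<in> set parity_rows" "parity_row g w (m 2) \<in> set parity_rows"
    using parity_row_in[OF r] by auto
  moreover have "parity_orth (parity_row g w (m 0)) (parity_row g w (m 1))" "parity_orth (parity_row g w (m 0)) (parity_row g w (m 2))" "parity_orth (parity_row g w (m 1)) (parity_row g w (m 2))"
    using parity_orth_rows[OF r] by auto
  ultimately show ?thesis using parity_check_rows unfolding list_all_iff by metis
qed

lemma even_rep_of_odd:
  assumes r: "square_rep M g w" and x: "x \<in> M" "odd (w x)"
  shows "even_rep M"
proof -
  have "\<not> (even (w (m 0)) \<and> even (w (m 1)) \<and> even (w (m 2)))"
    using even_gen3[of w x] r x by (auto simp: square_rep_def)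
  then have "on_rows kills_three g w \<or> on_rows hadamard_kills g w"
    using parity_check_holds[OF r] unfolding parity_check_def parity_row_nth(2) by (auto split: if_splits)
  then show ?thesis using even_rep_of_kills_three[OF r] even_rep_of_hadamard[OF r] by blast
qed

text \<open>If \<open>w\<close> is even on all of \<open>M\<close>, two of the coordinates are even
  on all of \<open>M\<close> as well. These two and \<open>w\<close> enter the descent while the
  other three squares stay as they are, and \<open>nondeg\<close> provides the nonzero value that
  the descent needs. Afterwards \<open>w\<close> is odd somewhere.\<close>

lemma even_rep_of_square_rep:
  assumes r: "square_rep M g w"
    and nondeg: "\<And>i j. i < 5 \<Longrightarrow> j < 5 \<Longrightarrow> i \<noteq> j \<Longrightarrow> \<exists>x\<in>M. g i x \<noteq> 0 \<or> g j x \<noteq> 0 \<or> w x \<noteq> 0"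
  shows "even_rep M"
proof (cases "\<exists>x\<in>M. odd (w x)")
  case True
  then show ?thesis using even_rep_of_odd[OF r] by blast
next
  case False
  then have "on_rows two_zeros g w"
    using parity_check_holds[OF r] m_in unfolding parity_check_def parity_row_nth(2) by auto
  then obtain q where q: "q \<in> set (index_sets 2)"
      "list_all (\<lambda>i. \<not> parity_row g w (m 0) ! i \<and> \<not> parity_row g w (m 1) ! i \<and> \<not> parity_row g w (m 2) ! i) q"
    by (auto simp: two_zeros_def list_ex_iff)
  then have p: "length q = 2" "distinct q" "list_all (\<lambda>i. i < 5) q"
    using index_sets_props(1) by (auto simp: list_all_iff)
  then obtain i j where ij: "q = [i, j]" by (auto simp: length_Suc_conv eval_nat_numeral)
  have lt: "i < 5" "j < 5" "i \<noteq> j" using p unfolding ij by auto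
  have ad: "additive_on M (g i)" "additive_on M (g j)" "additive_on M w" using r lt by (auto simp: square_rep_def)
  have ev: "even (g i x) \<and> even (g j x) \<and> even (w x)" if "x \<in> M" for x
    using q(2) False that lt even_gen3[OF ad(1) _ _ _ that] even_gen3[OF ad(2) _ _ _ that]
    unfolding ij by (auto simp: parity_row_nth)
  obtain x0 where x0: "x0 \<in> M" "g i x0 \<noteq> 0 \<or> g j x0 \<noteq> 0 \<or> w x0 \<noteq> 0" using nondeg[OF lt] by blast
  obtain X Y W where XYW: "additive_on M X" "additive_on M Y" "additive_on M W"
      "\<And>x. x \<in> M \<Longrightarrow> (X x)\<^sup>2 + (Y x)\<^sup>2 + 3 * (W x)\<^sup>2 = (g i x)\<^sup>2 + (g j x)\<^sup>2 + 3 * (w x)\<^sup>2" "\<exists>x\<in>M. odd (W x)"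
    using descent[OF ad ev x0] unfolding odd_rep_def by blast
  define g' where "g' r = (if r = i then X else if r = j then Y else g r)" for r
  have "square_rep M g' W"
    unfolding square_rep_def
  proof (intro conjI allI impI ballI)
    fix r' :: nat assume "r' < 5" then show "additive_on M (g' r')" using r XYW by (auto simp: g'_def square_rep_def)
  next
    fix x assume x: "x \<in> M"
    have s: "(\<Sum>r<5. f r) = f i + f j + (\<Sum>r\<in>{..<5} - {i, j}. f r)" for f :: "nat \<Rightarrow> int"
      using lt sum.subset_diff[of "{i, j}" "{..<5}" f] by simp
    have "(\<Sum>r\<in>{..<5} - {i, j}. (g' r x)\<^sup>2) = (\<Sum>r\<in>{..<5} - {i, j}. (g r x)\<^sup>2)"
      by (rule sum.cong) (auto simp: g'_def)
    then have "(\<Sum>r<5. (g' r x)\<^sup>2) = (X x)\<^sup>2 + (Y x)\<^sup>2 + (\<Sum>r\<in>{..<5} - {i, j}. (g r x)\<^sup>2)"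
      unfolding s[of "\<lambda>r. (g' r x)\<^sup>2"] using lt by (simp add: g'_def)
    moreover have "(\<Sum>r<5. (g r x)\<^sup>2) + 3 * (w x)\<^sup>2 = x \<bullet> x" using r x by (simp add: square_rep_def)
    ultimately show "(\<Sum>r<5. (g' r x)\<^sup>2) + 3 * (W x)\<^sup>2 = x \<bullet> x"
      using XYW(4)[OF x] unfolding s[of "\<lambda>r. (g r x)\<^sup>2"] by linarith
  qed (rule XYW(3))
  then show ?thesis using even_rep_of_odd XYW(5) by blast
qed

end

subsection \<open>The neighbour lattice for primes at least 5\<close>

lemma sum_6: "(\<Sum>s=0..<6. f s) = f 0 + f 1 + f 2 + f 3 + f 4 + (f 5 :: int)" for f :: "nat \<Rightarrow> int"
  by (simp add: eval_nat_numeral)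

lemma less_6_cases: "r < 6 \<Longrightarrow> r = 0 \<or> r = 1 \<or> r = 2 \<or> r = 3 \<or> r = 4 \<or> r = (5::nat)"
  by linarith

lemma eq_vec_6:
  assumes "x \<in> carrier_vec 6" "y \<in> carrier_vec 6" "x $ 0 = y $ 0" "x $ 1 = y $ 1" "x $ 2 = y $ 2"
    "x $ 3 = y $ 3" "x $ 4 = y $ 4" "x $ 5 = y $ 5"
  shows "x = y"
  using assms less_6_cases by (intro eq_vecI) force+

lemma std_gram_6_mult:
  assumes "x \<in> carrier_vec 6"
  shows "std_gram 6 *\<^sub>v x = vec 6 (\<lambda>i. (if i = 5 then 3 else 1) * x $ i)" (is "_ = ?R")
proof (rule eq_vecI)
  fix i assume "i < dim_vec ?R"
  then have i: "i < 6" by simp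
  then show "(std_gram 6 *\<^sub>v x) $ i = ?R $ i"
    using assms less_6_cases[OF i] by (auto simp: std_gram_def scalar_prod_def sum_6)
qed (simp add: std_gram_def)

lemma std_gram_6_form:
  assumes "x \<in> carrier_vec 6" "y \<in> carrier_vec 6"
  shows "x \<bullet> (std_gram 6 *\<^sub>v y) = (\<Sum>i<5. x $ i * y $ i) + 3 * (x $ 5 * y $ 5)"
  unfolding std_gram_6_mult[OF assms(2)]
  by (simp add: scalar_prod_def sum_6 sum_lessThan_5[of "\<lambda>i. x $ i * y $ i"])

lemma std_gram_carrier [simp]: "std_gram n \<in> carrier_mat n n"
  by (simp add: std_gram_def)

lemma det_std_gram_6: "det (std_gram 6) = 3"
proof -
  have "det (std_gram (Suc n)) = 3" for n
  proof (induction n)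
    case 0 then show ?case by (subst det_single) (auto simp: std_gram_def)
  next
    case (Suc n) then show ?case by (simp add: std_gram_Suc[of "Suc n"] det_dsum[OF std_gram_carrier])
  qed
  from this[of 5] show ?thesis by simp
qed

lemma posdef_std_gram_6: "posdef 6 (std_gram 6)"
  unfolding posdef_def
proof (intro conjI ballI impI)
  fix x :: "int vec" assume x: "x \<in> carrier_vec 6" "x \<noteq> 0\<^sub>v 6"
  obtain i where i: "i < 6" "x $ i \<noteq> 0" using nonzero_vec_index[OF x] .
  have s: "0 \<le> x $ i * x $ i" for i by simp
  have "0 < x $ i * x $ i" using i(2) by (auto simp: zero_less_mult_iff neq_iff)
  then show "0 < x \<bullet> (std_gram 6 *\<^sub>v x)"
    unfolding std_gram_6_form[OF x(1,1)] sum_lessThan_5[of "\<lambda>i. x $ i * x $ i"]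
    using less_6_cases[OF i(1)] s[of 0] s[of 1] s[of 2] s[of 3] s[of 4] s[of 5] by (elim disjE; simp only:; linarith)
qed (auto simp: std_gram_def intro!: eq_matI)

lemma posdef_scaled_congr:
  fixes D G P :: "int mat"
  assumes D: "posdef n D" and P: "P \<in> carrier_mat n n" "det P \<noteq> 0" and G: "G \<in> carrier_mat n n"
    and e: "congr P D = q \<cdot>\<^sub>m G" and q: "0 < q"
  shows "posdef n G"
proof -
  have Dc: "D \<in> carrier_mat n n" "D\<^sup>T = D" using D by (auto simp: posdef_def)
  have form: "q * (x \<bullet> (G *\<^sub>v x)) = (P *\<^sub>v x) \<bullet> (D *\<^sub>v (P *\<^sub>v x))" if "x \<in> carrier_vec n" for x
    using congr_form[OF P(1) Dc(1) that that] that G unfolding e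
    by (simp add: scalar_prod_def sum_distrib_left mult_ac)
  have "(q \<cdot>\<^sub>m G)\<^sup>T = q \<cdot>\<^sub>m G" using congr_symmetric[OF P(1) Dc] e by simp
  then have t: "(q \<cdot>\<^sub>m G)\<^sup>T $$ (i, j) = (q \<cdot>\<^sub>m G) $$ (i, j)" for i j by (rule arg_cong)
  have "q * G $$ (j, i) = q * G $$ (i, j)" if "i < n" "j < n" for i j
    using t[of i j] that G by simp
  then have "G\<^sup>T = G" using q G by (intro eq_matI) auto
  moreover have "0 < x \<bullet> (G *\<^sub>v x)" if x: "x \<in> carrier_vec n" "x \<noteq> 0\<^sub>v n" for x
  proof -
    have "P *\<^sub>v x \<noteq> 0\<^sub>v n" using det_0_iff_vec_prod_zero[OF P(1)] P(2) x by blast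
    then have "0 < q * (x \<bullet> (G *\<^sub>v x))" using D P(1) x unfolding form[OF x(1)] posdef_def by simp
    then show ?thesis using q by (simp add: zero_less_mult_iff)
  qed
  ultimately show ?thesis using G by (simp add: posdef_def)
qed

text \<open>The assumption \<open>rho\<close> says that (1, b, c, k1, k2, 1) is isotropic modulo
  \<open>p\<close> in I_5 + <3>. Here \<open>b\<close> and \<open>c\<close> come from the congruence
  that defines the sublattice, while \<open>k1\<close> and \<open>k2\<close> are free to be
  chosen.\<close>

locale p_lattice =
  fixes p b c k1 k2 \<rho> y :: int
  assumes p: "prime p" "5 \<le> p"
    and rho: "1 + b\<^sup>2 + c\<^sup>2 + k1\<^sup>2 + k2\<^sup>2 + 3 = p * \<rho>"
    and y: "2 * y = \<rho> * (p - 1)"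
begin

text \<open>Write h for the vector \<open>hs\<close>. Since \<open>c6\<close> is 3 modulo
  \<open>p\<close>, the vectors e_s - c_s e_0 with s = 1, ..., 5 have product divisible by
  \<open>p\<close> with h. The value of \<open>t6\<close> is fixed by 1 + p y + b^2 + c^2 + k1^2 +
  k2^2 + c6 = p: then h minus the sum of the h_s (e_s - c_s e_0) is exactly p e_0, so h/p and these
  five vectors generate the whole neighbour.\<close>

definition "t6 = 1 - \<rho> - y"
definition "c6 = 3 + p * t6"
definition "hs r = [1 + p * y, b, c, k1, k2, 1] ! r"
definition "cs r = [0, b, c, k1, k2, c6] ! r"
text \<open>For positive \<open>r\<close> this is the inner product of h/p with e_r - c_r
  e_0.\<close>

definition "us r = - y * cs r - (if r = 5 then t6 else 0)"

text \<open>The choice of \<open>y\<close> makes the norm of the vector \<open>hs\<close> divisible by \<open>p\<^sup>2\<close>. The columns of \<open>P / p\<close> are a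
  basis of the resulting \<open>p\<close>-neighbour of the lattice with Gram matrix \<^term>\<open>std_gram 6\<close>.\<close>

definition "P = mat 6 6 (\<lambda>(r, s). if s = 0 then hs r else if r = 0 then - p * cs s else if r = s then p else 0)"
definition "N = mat 6 6 (\<lambda>(r, s). if r = 0 \<and> s = 0 then \<rho> + y\<^sup>2 else if r = 0 then us s else if s = 0 then us r
    else cs r * cs s + (if r = s then if r = 5 then 3 else 1 else 0))"

lemma P_carrier: "P \<in> carrier_mat 6 6" and N_carrier: "N \<in> carrier_mat 6 6"
  by (simp_all add: P_def N_def)

lemma rho': "b * b + c * c + k1 * k1 + k2 * k2 = p * \<rho> - 4"
  using rho by (simp add: power2_eq_square)

lemma norm_h: "(1 + p * y) * (1 + p * y) + b * b + c * c + k1 * k1 + k2 * k2 + 3 = p * p * (\<rho> + y\<^sup>2)"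
proof -
  have "(1 + p * y) * (1 + p * y) = 1 + p * (2 * y) + p * p * y\<^sup>2" by (simp add: power2_eq_square algebra_simps)
  also have "\<dots> = 1 + p * (\<rho> * (p - 1)) + p * p * y\<^sup>2" unfolding y ..
  finally show ?thesis using rho' by (simp add: algebra_simps)
qed

lemma P_congr: "congr P (std_gram 6) = (p * p) \<cdot>\<^sub>m N"
proof (rule eq_matI)
  fix r s assume "r < dim_row ((p * p) \<cdot>\<^sub>m N)" "s < dim_col ((p * p) \<cdot>\<^sub>m N)"
  then have r: "r < 6" and s: "s < 6" using N_carrier by auto
  have "congr P (std_gram 6) $$ (r, s) = col P r \<bullet> (std_gram 6 *\<^sub>v col P s)"
    using r s P_carrier by (intro congr_index[of _ 6]) auto
  also have "\<dots> = (\<Sum>i<5. P $$ (i, r) * P $$ (i, s)) + 3 * (P $$ (5, r) * P $$ (5, s))"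
    using r s P_carrier by (subst std_gram_6_form) auto
  also have "\<dots> = p * p * N $$ (r, s)"
    unfolding sum_lessThan_5[of "\<lambda>i. P $$ (i, r) * P $$ (i, s)"]
    using less_6_cases[OF r] less_6_cases[OF s] norm_h
    by (elim disjE; simp add: P_def N_def hs_def cs_def us_def; simp add: c6_def algebra_simps)
  finally show "congr P (std_gram 6) $$ (r, s) = ((p * p) \<cdot>\<^sub>m N) $$ (r, s)" using r s N_carrier by simp
qed (use P_carrier N_carrier in \<open>auto simp: congr_def\<close>)

lemma det_P: "det P = p ^ 6"
proof -
  define q where "q = mat 1 5 (\<lambda>(_, s). - cs (Suc s))"
  define h where "h = mat 5 1 (\<lambda>(r, _). hs (Suc r))"
  let ?L = "four_block_mat (mat 1 1 (\<lambda>_. p)) (0\<^sub>m 1 5) h (p \<cdot>\<^sub>m 1\<^sub>m 5)"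
  have c: "q \<in> carrier_mat 1 5" "h \<in> carrier_mat 5 1" by (simp_all add: q_def h_def)
  have L: "?L \<in> carrier_mat 6 6" using four_block_carrier_mat[of "mat 1 1 (\<lambda>_. p)" 1 1 "p \<cdot>\<^sub>m 1\<^sub>m 5" 5 5] by simp
  have "P = unip 5 q * ?L"
  proof -
    have "unip 5 q * ?L = four_block_mat (mat 1 1 (\<lambda>_. p) + q * h) (p \<cdot>\<^sub>m q) h (p \<cdot>\<^sub>m 1\<^sub>m 5)"
      unfolding unip_def using c
      by (subst mult_four_block_mat[of _ 1 1 _ 5 _ 5 _ _ 1 _ 5]) (auto simp: mult_smult_distrib[of _ 1 5 _ 5])
    \<comment> \<open>The choice of \<open>t6\<close> enters here: added to \<open>p\<close>, this
      gives the corner 1 + p y of \<open>P\<close>.\<close>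
    moreover have "(q * h) $$ (0, 0) = 1 + p * y - p"
      using rho' by (simp add: q_def h_def scalar_prod_def eval_nat_numeral)
        (simp add: hs_def cs_def c6_def t6_def algebra_simps)
    ultimately show ?thesis
      using c P_carrier by (intro eq_matI) (auto simp: P_def q_def h_def hs_def)
  qed
  then have "det P = det (unip 5 q) * det ?L" using L c unip_carrier[OF c(1)] by (simp add: det_mult[of _ 6])
  also have "det ?L = p * det (p \<cdot>\<^sub>m 1\<^sub>m 5)"
    using c by (subst det_four_block_mat_upper_right_zero[of _ 1 _ 5]) (auto simp: det_single)
  also have "det (p \<cdot>\<^sub>m 1\<^sub>m 5) = p ^ 5" by (simp add: det_smult)
  finally show ?thesis using c by (simp add: det_unip power_Suc[symmetric] del: power_Suc)
qed

lemma p0: "0 < p" using p by simp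

lemma posdef_N: "posdef 6 N"
  using posdef_scaled_congr[OF posdef_std_gram_6 P_carrier _ N_carrier P_congr] det_P p0 by simp

lemma det_N: "det N = 3"
proof -
  have "det (congr P (std_gram 6)) = p ^ 6 * p ^ 6 * 3"
    using P_carrier by (subst det_congr[of _ 6]) (auto simp: std_gram_def det_P det_std_gram_6[unfolded std_gram_def])
  moreover have "det ((p * p) \<cdot>\<^sub>m N) = (p * p) ^ 6 * det N" using N_carrier by (simp add: det_smult)
  ultimately have "(p * p) ^ 6 * det N = (p * p) ^ 6 * 3" unfolding P_congr by (simp add: power_mult_distrib)
  then show ?thesis using p0 by simp
qed

lemma N_form:
  assumes "u \<in> carrier_vec 6" "v \<in> carrier_vec 6"
  shows "(p * p) * (u \<bullet> (N *\<^sub>v v)) = (P *\<^sub>v u) \<bullet> (std_gram 6 *\<^sub>v (P *\<^sub>v v))"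
proof -
  have "u \<bullet> (((p * p) \<cdot>\<^sub>m N) *\<^sub>v v) = (P *\<^sub>v u) \<bullet> (std_gram 6 *\<^sub>v (P *\<^sub>v v))"
    unfolding P_congr[symmetric] using assms P_carrier by (intro congr_form[of _ 6]) (auto simp: std_gram_def)
  moreover have "u \<bullet> (((p * p) \<cdot>\<^sub>m N) *\<^sub>v v) = (p * p) * (u \<bullet> (N *\<^sub>v v))"
    using assms N_carrier by (simp add: scalar_prod_def sum_distrib_left mult_ac)
  ultimately show ?thesis by simp
qed

lemma P_mult:
  assumes "v \<in> carrier_vec 6"
  shows "(P *\<^sub>v v) $ 0 = (1 + p * y) * v $ 0 - p * (b * v $ 1 + c * v $ 2 + k1 * v $ 3 + k2 * v $ 4 + c6 * v $ 5)"
    "(P *\<^sub>v v) $ 1 = b * v $ 0 + p * v $ 1" "(P *\<^sub>v v) $ 2 = c * v $ 0 + p * v $ 2"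
    "(P *\<^sub>v v) $ 3 = k1 * v $ 0 + p * v $ 3" "(P *\<^sub>v v) $ 4 = k2 * v $ 0 + p * v $ 4"
    "(P *\<^sub>v v) $ 5 = v $ 0 + p * v $ 5"
  using assms by (simp_all add: P_def scalar_prod_def sum_6 hs_def cs_def algebra_simps)

text \<open>The vector \<open>x\<close> holds the coordinates of p e_5, where e_5 is the basis
  vector of norm 3. Its product with a vector \<open>P u / p\<close> of the neighbour is three times
  the integer (P u)_5, and its norm 3 p^2 is 3 modulo 9 because 3 does not divide
  \<open>p\<close>.\<close>

lemma glue_N: "glue 6 N"
proof -
  define x where "x = vec_of_list [p * c6, - c6 * b, - c6 * c, - c6 * k1, - c6 * k2, p - c6]"
  have x: "x \<in> carrier_vec 6" by (simp add: x_def carrier_vecI)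
  have xi: "x $ 0 = p * c6" "x $ 1 = - c6 * b" "x $ 2 = - c6 * c" "x $ 3 = - c6 * k1" "x $ 4 = - c6 * k2" "x $ 5 = p - c6"
    by (simp_all add: x_def eval_nat_numeral)
  have z: "(1 + p * y) * c6 + (b * b + c * c + k1 * k1 + k2 * k2) * c6 - c6 * (p - c6) = 0"
    unfolding rho' by (simp add: c6_def t6_def algebra_simps)
  have Px: "P *\<^sub>v x = vec 6 (\<lambda>r. if r = 5 then p * p else 0)"
  proof (rule eq_vec_6; (unfold P_mult[OF x] xi)?)
    have "(1 + p * y) * (p * c6) - p * (b * (- c6 * b) + c * (- c6 * c) + k1 * (- c6 * k1) + k2 * (- c6 * k2) + c6 * (p - c6))
      = p * ((1 + p * y) * c6 + (b * b + c * c + k1 * k1 + k2 * k2) * c6 - c6 * (p - c6))"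
      by (simp add: algebra_simps)
    then show "(1 + p * y) * (p * c6) - p * (b * (- c6 * b) + c * (- c6 * c) + k1 * (- c6 * k1) + k2 * (- c6 * k2) + c6 * (p - c6))
      = vec 6 (\<lambda>r. if r = 5 then p * p else 0) $ 0"
      unfolding z by simp
  qed (use P_carrier x in \<open>simp_all add: algebra_simps\<close>)
  have dual: "(p * p) * (u \<bullet> (N *\<^sub>v x)) = (p * p) * (3 * (P *\<^sub>v u) $ 5)" if u: "u \<in> carrier_vec 6" for u
    unfolding N_form[OF u x] Px using u P_carrier
    by (subst std_gram_6_form) (auto simp: sum_lessThan_5)
  have "3 dvd (N *\<^sub>v x) $ r" if r: "r < 6" for r
  proof -
    have "unit_vec 6 r \<bullet> (N *\<^sub>v x) = (N *\<^sub>v x) $ r" using r N_carrier x by (simp add: scalar_prod_left_unit)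
    then show ?thesis using dual[of "unit_vec 6 r"] p0 by simp
  qed
  moreover have "x \<bullet> (N *\<^sub>v x) = 3 * (p * p)" using dual[OF x] p0 unfolding Px by simp
  moreover have "(3 * (p * p)) mod 9 = 3"
  proof -
    have "\<not> 3 dvd p" using p unfolding prime_int_iff by (auto dest!: spec[of _ 3])
    then have "p mod 3 = 1 \<or> p mod 3 = 2" by presburger
    moreover have "p = 3 * (p div 3) + p mod 3" by simp
    ultimately obtain q where "p = 3 * q + 1 \<or> p = 3 * q + 2" by metis
    then have "3 * (p * p) = 9 * (3 * q * q + 2 * q) + 3 \<or> 3 * (p * p) = 9 * (3 * q * q + 4 * q + 1) + 3"
      by (elim disjE) (simp_all add: algebra_simps)
    then show ?thesis by (elim disjE) (simp_all only: mod_mult_self4 mod_mult_self3, simp_all)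
  qed
  ultimately show ?thesis unfolding glue_def using x by (intro bexI[of _ x] conjI allI impI) simp_all
qed

end

section \<open>Sublattices of the cubic lattice given by one congruence\<close>

lemma vCons_numeral [simp]: "vCons a v $ numeral l = v $ pred_numeral l"
  by (simp add: numeral_eq_Suc)

lemma additive_on_smult:
  assumes f: "additive_on M f" and M: "\<And>x y. x \<in> M \<Longrightarrow> y \<in> M \<Longrightarrow> x + y \<in> M" "\<And>k x. x \<in> M \<Longrightarrow> k \<cdot>\<^sub>v x \<in> M" and x: "x \<in> M"
  shows "f (k \<cdot>\<^sub>v x) = k * f x"
proof -
  have add: "f ((a + b) \<cdot>\<^sub>v x) = f (a \<cdot>\<^sub>v x) + f (b \<cdot>\<^sub>v x)" for a b
    using f M(2)[OF x] unfolding additive_on_def by (metis add_smult_distrib_vec)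
  have z: "f (0 \<cdot>\<^sub>v x) = 0" using add[of 0 0] by simp
  have one: "f (1 \<cdot>\<^sub>v x) = f x" by (rule arg_cong[where f = f]) (rule eq_vecI; simp)
  show ?thesis
  proof (induction k rule: int_induct[where k = 0])
    case (step1 l) then show ?case using add[of l 1] one by (simp add: algebra_simps)
  next
    case (step2 l) then show ?case using add[of "l - 1" 1] one by (simp add: algebra_simps)
  qed (simp add: z)
qed

text \<open>The order of the indices is a parameter because a nonzero linear form modulo a prime can
  be scaled to have coefficient 1 at some coordinate, but not at a prescribed one.\<close>

definition cong_sublattice :: "int \<Rightarrow> int \<Rightarrow> int \<Rightarrow> nat \<Rightarrow> nat \<Rightarrow> nat \<Rightarrow> int vec set" where
  "cong_sublattice p b c i j k = {x \<in> carrier_vec 3. p dvd x $ i + b * x $ j + c * x $ k}"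

lemma perm_3_cases:
  fixes i j k :: nat
  assumes "{i, j, k} = {0, 1, 2}"
  shows "(i, j, k) \<in> {(0, 1, 2), (0, 2, 1), (1, 0, 2), (1, 2, 0), (2, 0, 1), (2, 1, 0)}"
proof -
  have c: "card {i, j, k} = 3" unfolding assms by simp
  have "i \<in> {0, 1, 2}" "j \<in> {0, 1, 2}" "k \<in> {0, 1, 2}" using assms by blast+
  moreover have "i \<noteq> j" "i \<noteq> k" "j \<noteq> k" using c by (auto simp: card_insert_if split: if_splits)
  ultimately show ?thesis by auto
qed

lemma cong_sublattice_closed:
  assumes "{i, j, k} = {0, 1, 2}"
  shows "x \<in> cong_sublattice p b c i j k \<Longrightarrow> y \<in> cong_sublattice p b c i j k \<Longrightarrow> x + y \<in> cong_sublattice p b c i j k"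
    "x \<in> cong_sublattice p b c i j k \<Longrightarrow> a \<cdot>\<^sub>v x \<in> cong_sublattice p b c i j k"
proof -
  have lt: "i < 3" "j < 3" "k < 3" using perm_3_cases[OF assms] by auto
  { assume "x \<in> cong_sublattice p b c i j k" "y \<in> cong_sublattice p b c i j k"
    then have x: "x \<in> carrier_vec 3" "y \<in> carrier_vec 3" "p dvd (x $ i + b * x $ j + c * x $ k) + (y $ i + b * y $ j + c * y $ k)"
      by (auto simp: cong_sublattice_def)
    have "(x + y) $ i + b * (x + y) $ j + c * (x + y) $ k = (x $ i + b * x $ j + c * x $ k) + (y $ i + b * y $ j + c * y $ k)"
      using x lt by (simp add: algebra_simps)
    then show "x + y \<in> cong_sublattice p b c i j k" using x by (simp add: cong_sublattice_def) }
  { assume "x \<in> cong_sublattice p b c i j k"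
    then have x: "x \<in> carrier_vec 3" "p dvd a * (x $ i + b * x $ j + c * x $ k)"
      by (auto simp: cong_sublattice_def)
    have "(a \<cdot>\<^sub>v x) $ i + b * (a \<cdot>\<^sub>v x) $ j + c * (a \<cdot>\<^sub>v x) $ k = a * (x $ i + b * x $ j + c * x $ k)"
      using x lt by (simp add: algebra_simps)
    then show "a \<cdot>\<^sub>v x \<in> cong_sublattice p b c i j k" using x by (simp add: cong_sublattice_def) }
qed

lemma scalar_prod_3:
  assumes "{i, j, k} = {0, 1, 2 :: nat}" "x \<in> carrier_vec 3" "y \<in> carrier_vec 3"
  shows "x \<bullet> y = x $ i * y $ i + x $ j * y $ j + x $ k * (y $ k :: int)"
proof -
  have "x \<bullet> y = x $ 0 * y $ 0 + x $ 1 * y $ 1 + x $ 2 * y $ 2"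
    using assms(2,3) by (simp add: scalar_prod_def eval_nat_numeral)
  then show ?thesis using perm_3_cases[OF assms(1)] by auto
qed

lemma eq_vec_3:
  assumes "{i, j, k} = {0, 1, 2 :: nat}" "x \<in> carrier_vec 3" "y \<in> carrier_vec 3"
    "x $ i = y $ i" "x $ j = y $ j" "x $ k = (y $ k :: int)"
  shows "x = y"
proof (rule eq_vecI)
  fix l assume "l < dim_vec y"
  then have "l \<in> {0, 1, 2}" using assms(3) by auto
  then have "l \<in> {i, j, k}" unfolding assms(1) .
  then show "x $ l = y $ l" using assms(4-6) by auto
qed (use assms(2,3) in auto)

text \<open>The inverse of \<open>V\<close> need not be integral. The adjugate takes its place, and
  the nonzero determinant is cancelled at the end.\<close>

lemma orthogonal_transpose:
  fixes V :: "'a :: idom mat"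
  assumes V: "V \<in> carrier_mat n n" "V\<^sup>T * V = q \<cdot>\<^sub>m 1\<^sub>m n" "q \<noteq> 0"
  shows "V * V\<^sup>T = q \<cdot>\<^sub>m 1\<^sub>m n"
proof -
  have t: "V\<^sup>T \<in> carrier_mat n n" using V(1) by simp
  have "det V * det V = q ^ n"
    using arg_cong[OF V(2), of det] by (simp add: det_mult[OF t V(1)] det_transpose[OF V(1)] det_smult)
  then have d: "det V \<noteq> 0" using V(3) by auto
  note adj = adj_mat[OF V(1)]
  have "V * V\<^sup>T * (V * adj_mat V) = V * (V\<^sup>T * V) * adj_mat V"
    using V(1) t adj(1) by (simp add: assoc_mult_mat[of _ n n _ n _ n])
  then have e: "det V \<cdot>\<^sub>m (V * V\<^sup>T) = q \<cdot>\<^sub>m (det V \<cdot>\<^sub>m 1\<^sub>m n)"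
    using V(1) t adj by (simp add: V(2) mult_smult_distrib[of _ n n _ n] mult_smult_assoc_mat[of _ n n _ n])
  show ?thesis
  proof (rule eq_matI)
    fix r s assume "r < dim_row (q \<cdot>\<^sub>m 1\<^sub>m n)" "s < dim_col (q \<cdot>\<^sub>m 1\<^sub>m n)"
    then show "(V * V\<^sup>T) $$ (r, s) = (q \<cdot>\<^sub>m 1\<^sub>m n) $$ (r, s)"
      using arg_cong[OF e, of "\<lambda>A. A $$ (r, s)"] V(1) d by (auto split: if_splits)
  qed (use V(1) in auto)
qed

locale p_sublattice = p_lattice +
  fixes i j k :: nat
  assumes ijk: "{i, j, k} = {0, 1, 2}"
begin

definition "M = cong_sublattice p b c i j k"
definition "al x = (x $ i + b * x $ j + c * x $ k) div p"
text \<open>These are the coordinates of (x_i, x_j, x_k, 0, 0, 0) in the neighbour: p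
  \<open>al x\<close> times h/p, and then the multiples of e_s - c_s e_0 that correct the entries 1
  to 5. By the choice of \<open>t6\<close> entry 0 comes out right as well.\<close>

definition "nv x = vec_of_list [p * al x, x $ j - al x * b, x $ k - al x * c, - al x * k1, - al x * k2, - al x]"

lemma lt3: "i < 3" "j < 3" "k < 3" using perm_3_cases[OF ijk] by auto

lemma distinct_ijk: "i \<noteq> j" "i \<noteq> k" "j \<noteq> k" using perm_3_cases[OF ijk] by auto

lemma M_vec: "x \<in> M \<Longrightarrow> x \<in> carrier_vec 3" by (simp add: M_def cong_sublattice_def)

lemma al: "x \<in> M \<Longrightarrow> p * al x = x $ i + b * x $ j + c * x $ k"
  by (simp add: M_def cong_sublattice_def al_def)

lemma al_add: assumes "x \<in> M" "z \<in> M" shows "al (x + z) = al x + al z"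
proof -
  have "p * al (x + z) = p * (al x + al z)"
    using al[OF assms(1)] al[OF assms(2)] al[of "x + z"] cong_sublattice_closed(1)[OF ijk] assms M_vec[OF assms(1)] M_vec[OF assms(2)] lt3
    by (simp add: M_def algebra_simps)
  then show ?thesis using p0 by simp
qed

lemma nv_carrier: "nv x \<in> carrier_vec 6" by (simp add: nv_def carrier_vecI)

lemma nv_index: "nv x $ 0 = p * al x" "nv x $ 1 = x $ j - al x * b" "nv x $ 2 = x $ k - al x * c"
  "nv x $ 3 = - al x * k1" "nv x $ 4 = - al x * k2" "nv x $ 5 = - al x"
  by (simp_all add: nv_def eval_nat_numeral)

lemma nv_add: assumes "x \<in> M" "z \<in> M" shows "nv (x + z) = nv x + nv z"
proof (rule eq_vecI)
  fix r assume "r < dim_vec (nv x + nv z)"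
  then have r: "r < 6" using nv_carrier[of z] by simp
  show "nv (x + z) $ r = (nv x + nv z) $ r"
    using less_6_cases[OF r] nv_carrier[of x] nv_carrier[of z] assms M_vec[OF assms(1)] M_vec[OF assms(2)] lt3
    by (elim disjE) (simp_all add: nv_index[unfolded One_nat_def] al_add algebra_simps)
qed (use nv_carrier[of x] nv_carrier[of z] nv_carrier[of "x + z"] in auto)

lemma P_nv: assumes x: "x \<in> M"
  shows "P *\<^sub>v nv x = vec_of_list [p * x $ i, p * x $ j, p * x $ k, 0, 0, 0]" (is "_ = ?R")
proof (rule eq_vec_6; (unfold P_mult[OF nv_carrier] nv_index)?)
  have "(1 + p * y) * (p * al x) - p * (b * (x $ j - al x * b) + c * (x $ k - al x * c) + k1 * (- al x * k1) + k2 * (- al x * k2) + c6 * - al x)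
    = p * ((1 + p * y + (b * b + c * c + k1 * k1 + k2 * k2) + c6) * al x - b * x $ j - c * x $ k)"
    by (simp add: algebra_simps)
  also have "1 + p * y + (b * b + c * c + k1 * k1 + k2 * k2) + c6 = p"
    unfolding rho' by (simp add: c6_def t6_def algebra_simps)
  also have "p * (p * al x - b * x $ j - c * x $ k) = ?R $ 0" unfolding al[OF x] by simp
  finally show "(1 + p * y) * (p * al x) - p * (b * (x $ j - al x * b) + c * (x $ k - al x * c) + k1 * (- al x * k1) + k2 * (- al x * k2) + c6 * - al x)
    = ?R $ 0" .
next
  show "?R \<in> carrier_vec 6" by (simp add: carrier_vecI)
  show "P *\<^sub>v nv x \<in> carrier_vec 6" using P_carrier nv_carrier by simp
qed (simp_all only: vec_of_list_index nth_Cons_numeral One_nat_def, simp_all add: eval_nat_numeral algebra_simps)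

lemma nv_form: assumes x: "x \<in> M" shows "nv x \<bullet> (N *\<^sub>v nv x) = x \<bullet> x"
proof -
  let ?v = "vec_of_list [p * x $ i, p * x $ j, p * x $ k, 0, 0, 0]"
  have v: "?v \<in> carrier_vec 6" by (simp add: carrier_vecI)
  have "(p * p) * (nv x \<bullet> (N *\<^sub>v nv x)) = (p * p) * (x \<bullet> x)"
    unfolding N_form[OF nv_carrier nv_carrier] P_nv[OF x] std_gram_6_form[OF v v]
      scalar_prod_3[OF ijk M_vec[OF x] M_vec[OF x]]
    by (simp add: sum_lessThan_5[of "\<lambda>i. ?v $ i * ?v $ i"] eval_nat_numeral algebra_simps)
  then show ?thesis using p0 by simp
qed

definition "ord r = [i, j, k] ! r"
definition "mv r = p \<cdot>\<^sub>v unit_vec 3 (ord r)"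

lemma ord: "ord 0 = i" "ord 1 = j" "ord 2 = k" "r < 3 \<Longrightarrow> ord r < 3"
    "r < 3 \<Longrightarrow> s < 3 \<Longrightarrow> ord r = ord s \<longleftrightarrow> r = s"
proof -
  show o: "ord 0 = i" "ord 1 = j" "ord 2 = k" by (simp_all add: ord_def)
  have c: "r = 0 \<or> r = 1 \<or> r = 2" if "r < 3" for r :: nat using that by linarith
  show "ord r < 3" if "r < 3" using c[OF that] o lt3 by auto
  show "ord r = ord s \<longleftrightarrow> r = s" if "r < 3" "s < 3" using c[OF that(1)] c[OF that(2)] o distinct_ijk by auto
qed

lemma mv_in: "r < 3 \<Longrightarrow> mv r \<in> M"
  using ord(4) lt3 by (auto simp: M_def cong_sublattice_def mv_def unit_vec_def)

lemma odd_p: "odd p" using p prime_odd_int[of p] by simp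

sublocale odd_index M mv "p * p"
proof
  show "M \<subseteq> carrier_vec 3" using M_vec by blast
  show "x + z \<in> M" if "x \<in> M" "z \<in> M" for x z using cong_sublattice_closed(1)[OF ijk] that by (simp add: M_def)
  show "mv r \<in> M" if "r < 3" for r using mv_in that .
  show "mv r \<bullet> mv s = (if r = s then p * p else 0)" if "r < 3" "s < 3" for r s
    using ord(4)[OF that(1)] ord(4)[OF that(2)] ord(5)[OF that] by (cases "r = s") (simp_all add: mv_def scalar_prod_left_unit)
  show "p * p mod 4 = 1" using square_mod_4[of p] odd_p by (auto simp: power2_eq_square)
  show "even (f x)" if f: "additive_on M f" "\<And>r. r < 3 \<Longrightarrow> even (f (mv r))" and x: "x \<in> M" for f x
  proof -
    note cl = cong_sublattice_closed[OF ijk, of _ p b c, folded M_def]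
    have sm: "f (a \<cdot>\<^sub>v z) = a * f z" if "z \<in> M" for a z using additive_on_smult[OF f(1) cl that] by blast
    have z: "(x $ i) \<cdot>\<^sub>v mv 0 \<in> M" "(x $ j) \<cdot>\<^sub>v mv 1 \<in> M" "(x $ k) \<cdot>\<^sub>v mv 2 \<in> M" using cl(2) mv_in by auto
    \<comment> \<open>Here p x is a combination of the \<open>mv r\<close>, and it has the same
      parity under \<open>f\<close> as x because \<open>p\<close> is odd.\<close>
    have "p \<cdot>\<^sub>v x = (x $ i) \<cdot>\<^sub>v mv 0 + ((x $ j) \<cdot>\<^sub>v mv 1 + (x $ k) \<cdot>\<^sub>v mv 2)"
      by (rule eq_vec_3[OF ijk]) (use M_vec[OF x] lt3 distinct_ijk ord in \<open>auto simp: mv_def\<close>)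
    then have "p * f x = f ((x $ i) \<cdot>\<^sub>v mv 0) + (f ((x $ j) \<cdot>\<^sub>v mv 1) + f ((x $ k) \<cdot>\<^sub>v mv 2))"
      using sm[OF x, of p] f(1) z cl(1) unfolding additive_on_def by metis
    also have "even \<dots>" using sm mv_in f(2) by simp
    finally show ?thesis using odd_p by simp
  qed
qed

lemma odd_form: "\<exists>x\<in>carrier_vec 6. odd (x \<bullet> (N *\<^sub>v x))"
proof -
  have "nv (mv 0) \<bullet> (N *\<^sub>v nv (mv 0)) = p * p"
    using nv_form[OF mv_in[of 0]] m_form[of 0 0] by simp
  moreover have "odd (p * p)" using odd_p by simp
  ultimately show ?thesis using nv_carrier by metis
qed

text \<open>In the coordinates of Z^3 this would fail: p^2 e_i lies in \<open>M\<close>, but e_i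
  does not. In the neighbour \<open>al z\<close> is a coordinate too, and its divisibility is what
  puts the quotient into \<open>M\<close>.\<close>

lemma primitive:
  assumes z: "z \<in> M" and d: "\<And>r. r < 6 \<Longrightarrow> p * p dvd nv z $ r"
  obtains x where "x \<in> M" "z = (p * p) \<cdot>\<^sub>v x"
proof -
  have a: "p * p dvd al z" using d[of 5] by (simp add: nv_index)
  have j: "p * p dvd z $ j" using dvd_add[OF d[of 1] dvd_mult2[OF a, of b]] by (simp add: nv_index[unfolded One_nat_def])
  have k: "p * p dvd z $ k" using dvd_add[OF d[of 2] dvd_mult2[OF a, of c]] by (simp add: nv_index)
  have zi: "z $ i = p * al z - b * z $ j - c * z $ k" using al[OF z] by simp
  have i: "p * p dvd z $ i" unfolding zi by (intro dvd_diff dvd_mult a j k)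
  obtain A X Y Z where e: "al z = p * p * A" "z $ i = p * p * X" "z $ j = p * p * Y" "z $ k = p * p * Z"
    using a i j k by (auto elim!: dvdE)
  define x where "x = vec 3 (\<lambda>r. if r = i then X else if r = j then Y else Z)"
  have xi: "x $ i = X" "x $ j = Y" "x $ k = Z" "x \<in> carrier_vec 3" using lt3 distinct_ijk by (auto simp: x_def)
  have "(p * p) * (X + b * Y + c * Z) = (p * p) * (p * A)" using al[OF z] unfolding e by (simp add: algebra_simps)
  then have "X + b * Y + c * Z = p * A" using p0 by simp
  then have "x \<in> M" using xi by (simp add: M_def cong_sublattice_def)
  moreover have "z = (p * p) \<cdot>\<^sub>v x"
    by (rule eq_vec_3[OF ijk]) (use M_vec[OF z] xi e lt3 in auto)
  ultimately show ?thesis using that by blast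
qed

theorem even_rep_M: "even_rep M"
proof -
  obtain T where T: "unimodular 6 T" "congr T N = std_gram 6"
    using classification[OF posdef_N det_N glue_N] odd_form by auto
  then obtain T' where T': "T \<in> carrier_mat 6 6" "T' \<in> carrier_mat 6 6" "T * T' = 1\<^sub>m 6" "T' * T = 1\<^sub>m 6"
    by (auto simp: unimodular_def)
  define yv where "yv x = T' *\<^sub>v nv x" for x
  have yc: "yv x \<in> carrier_vec 6" for x unfolding yv_def using T' nv_carrier by simp
  have Ty: "T *\<^sub>v yv x = nv x" for x unfolding yv_def using T' nv_carrier by (metis assoc_mult_mat_vec one_mult_mat_vec)
  have yadd: "yv (x + z) = yv x + yv z" if "x \<in> M" "z \<in> M" for x z
    unfolding yv_def nv_add[OF that] using T' nv_carrier by (simp add: mult_add_distrib_mat_vec[of _ 6 6])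
  have yform: "yv x \<bullet> (std_gram 6 *\<^sub>v yv x) = x \<bullet> x" if "x \<in> M" for x
    unfolding T(2)[symmetric] congr_form[OF T'(1) N_carrier yc yc] Ty by (rule nv_form[OF that])
  define g where "g r x = yv x $ r" for r x
  define w where "w x = yv x $ 5" for x
  have ad: "additive_on M (g r)" if "r < 6" for r
    unfolding additive_on_def g_def using yadd that by (simp add: carrier_vecD[OF yc])
  have r5: "square_rep M g w"
    unfolding square_rep_def
  proof (intro conjI allI impI ballI)
    show "additive_on M w" using ad[of 5] by (simp add: additive_on_def g_def w_def)
    show "(\<Sum>r<5. (g r x)\<^sup>2) + 3 * (w x)\<^sup>2 = x \<bullet> x" if "x \<in> M" for x
      using yform[OF that] unfolding std_gram_6_form[OF yc yc] by (simp add: g_def w_def power2_eq_square)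
  qed (use ad in auto)
  show ?thesis
  proof (rule even_rep_of_square_rep[OF r5], rule ccontr)
    fix r4 r5 :: nat assume r45: "r4 < 5" "r5 < 5" "r4 \<noteq> r5" and "\<not> (\<exists>x\<in>M. g r4 x \<noteq> 0 \<or> g r5 x \<noteq> 0 \<or> w x \<noteq> 0)"
    then have z: "g r4 x = 0" "g r5 x = 0" "w x = 0" if "x \<in> M" for x using that by auto
    obtain r1 where r1: "r1 < 5" "r1 \<notin> set [r4, r5]" using distinct_extend[of "[r4, r5]"] r45 by auto
    obtain r2 where r2: "r2 < 5" "r2 \<notin> set [r4, r5, r1]" using distinct_extend[of "[r4, r5, r1]"] r45 r1 by auto
    obtain r3 where r3: "r3 < 5" "r3 \<notin> set [r4, r5, r1, r2]" using distinct_extend[of "[r4, r5, r1, r2]"] r45 r1 r2 by auto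
    define rs where "rs s = [r1, r2, r3] ! s" for s
    have rs: "rs 0 = r1" "rs 1 = r2" "rs 2 = r3" by (simp_all add: rs_def)
    have d: "distinct [r1, r2, r3, r4, r5]" "set [r1, r2, r3, r4, r5] \<subseteq> {..<5}" using r45 r1 r2 r3 by auto
    have sum5: "(\<Sum>r<5. f r) = f r1 + f r2 + f r3 + f r4 + f r5" for f :: "nat \<Rightarrow> int"
      unfolding sum_distinct_5[OF d, of f, simplified] by simp
    have c3: "s = 0 \<or> s = 1 \<or> s = 2" if "s < 3" for s :: nat using that by linarith
    \<comment> \<open>Only the coordinates r1, r2, r3 are left, so the columns of \<open>V\<close>
      are the images of the three vectors p e_t. They are orthogonal of norm p^2, and hence so are
      the rows.\<close>
    define V where "V = mat 3 3 (\<lambda>(s, t). g (rs s) (mv t))"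
    have V: "V \<in> carrier_mat 3 3" by (simp add: V_def)
    have sum3: "(\<Sum>s=0..<3. f s) = f 0 + f 1 + f (2::nat)" for f :: "nat \<Rightarrow> int" by (simp add: eval_nat_numeral)
    have gram: "(\<Sum>s=0..<3. V $$ (s, t) * V $$ (s, u)) = (if t = u then p * p else 0)" if tu: "t < 3" "u < 3" for t u
    proof -
      have "(\<Sum>s=0..<3. V $$ (s, t) * V $$ (s, u)) = (\<Sum>r<5. g r (mv t) * g r (mv u)) + 3 * (w (mv t) * w (mv u))"
        unfolding sum3 sum5 using tu z[OF mv_in[OF tu(1)]] by (simp add: V_def rs[unfolded One_nat_def])
      then show ?thesis using polar[OF r5 mv_in mv_in] m_form tu by simp
    qed
    have "V\<^sup>T * V = (p * p) \<cdot>\<^sub>m 1\<^sub>m 3"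
      using V gram by (intro eq_matI) (auto simp: scalar_prod_def)
    from orthogonal_transpose[OF V this] have VV: "V * V\<^sup>T = (p * p) \<cdot>\<^sub>m 1\<^sub>m 3" using p0 by simp
    have gram': "(\<Sum>t=0..<3. V $$ (s, t) * V $$ (u, t)) = (if s = u then p * p else 0)" if su: "s < 3" "u < 3" for s u
    proof -
      have "(V * V\<^sup>T) $$ (s, u) = ((p * p) \<cdot>\<^sub>m 1\<^sub>m 3) $$ (s, u)" unfolding VV ..
      then show ?thesis using su V by (simp add: scalar_prod_def)
    qed
    note cl = cong_sublattice_closed[OF ijk, of _ p b c, folded M_def]
    have "\<exists>x\<in>M. \<forall>t<3. V $$ (s, t) = p * x $ ord t" if s: "s < 3" for s
    proof -
      \<comment> \<open>By orthogonality of the rows the image of this vector is p^2 times the unit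
        vector at coordinate \<open>rs s\<close>. Primitivity then yields a vector of
        \<open>M\<close> itself that is mapped to the unit vector.\<close>
      define zz where "zz = V $$ (s, 0) \<cdot>\<^sub>v mv 0 + (V $$ (s, 1) \<cdot>\<^sub>v mv 1 + V $$ (s, 2) \<cdot>\<^sub>v mv 2)"
      have t: "V $$ (s, t) \<cdot>\<^sub>v mv t \<in> M" if "t < 3" for t using cl(2) mv_in that by auto
      have zM: "zz \<in> M" unfolding zz_def using cl(1) t by auto
      have gz: "g r zz = V $$ (s, 0) * g r (mv 0) + V $$ (s, 1) * g r (mv 1) + V $$ (s, 2) * g r (mv 2)" if r: "r < 6" for r
      proof -
        have sm: "g r (a \<cdot>\<^sub>v v) = a * g r v" if "v \<in> M" for a v using additive_on_smult[OF ad[OF r] cl that] by blast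
        have ag: "g r (u + v) = g r u + g r v" if "u \<in> M" "v \<in> M" for u v using ad[OF r] that by (auto simp: additive_on_def)
        show ?thesis unfolding zz_def
          using ag[OF t[of 0] cl(1)[OF t[of 1] t[of 2]]] ag[OF t[of 1] t[of 2]] sm[OF mv_in[of 0]] sm[OF mv_in[of 1]] sm[OF mv_in[of 2]] by simp
      qed
      have div: "p * p dvd yv zz $ r" if r: "r < 6" for r
      proof -
        have "p * p dvd g r zz"
        proof (cases "\<exists>u<3. r = rs u")
          case True
          then obtain u where u: "u < 3" "r = rs u" by blast
          have "g r zz = (\<Sum>t=0..<3. V $$ (s, t) * V $$ (u, t))"
            unfolding gz[OF r] sum3 using u by (simp add: V_def)
          then show ?thesis using gram'[OF s u(1)] by simp
        next
          case False
          then have "r \<noteq> rs 0" "r \<noteq> rs 1" "r \<noteq> rs 2" by auto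
          then have ne: "r \<noteq> r1" "r \<noteq> r2" "r \<noteq> r3" unfolding rs .
          have "r = r4 \<or> r = r5 \<or> r = 5"
          proof (rule ccontr)
            assume *: "\<not> (r = r4 \<or> r = r5 \<or> r = 5)"
            then have "(\<Sum>q<5. if q = r then 1 else 0 :: int) = 1" using r by simp
            then show False unfolding sum5 using ne * by auto
          qed
          then have "g r zz = 0" using z[OF zM] by (auto simp: g_def w_def)
          then show ?thesis by simp
        qed
        then show ?thesis by (simp add: g_def)
      qed
      have "p * p dvd nv zz $ r" if r: "r < 6" for r
      proof -
        have "nv zz $ r = (\<Sum>u=0..<6. T $$ (r, u) * yv zz $ u)"
          using Ty[of zz] yc[of zz] T'(1) r by (metis (no_types, lifting) carrier_matD carrier_vecD index_mult_mat_vec index_row(1) scalar_prod_def sum.cong atLeastLessThan_iff)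
        then show ?thesis using div by (auto intro!: dvd_sum)
      qed
      from primitive[OF zM this] obtain x where x: "x \<in> M" "zz = (p * p) \<cdot>\<^sub>v x" by blast
      have "V $$ (s, t) = p * x $ ord t" if t: "t < 3" for t
      proof -
        have "zz $ ord t = p * V $$ (s, t)"
          unfolding zz_def using c3[OF t] ord lt3 distinct_ijk by (auto simp: mv_def)
        moreover have "zz $ ord t = p * p * x $ ord t" unfolding x(2) using M_vec[OF x(1)] ord(4)[OF t] by simp
        ultimately show ?thesis using p0 by simp
      qed
      then show ?thesis using x(1) by blast
    qed
    then obtain xs where xs: "\<And>s. s < 3 \<Longrightarrow> xs s \<in> M" "\<And>s t. s < 3 \<Longrightarrow> t < 3 \<Longrightarrow> V $$ (s, t) = p * xs s $ ord t" by metis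
    \<comment> \<open>The \<open>xs s\<close> are the rows of an orthogonal integral matrix, so its
      columns are orthonormal. Pairing column \<open>i\<close> with the congruence satisfied by
      every row gives 1 on one side and a multiple of \<open>p\<close> on the other.\<close>
    have orth: "(\<Sum>s=0..<3. xs s $ i * xs s $ ord t) = (if t = 0 then 1 else 0)" if t: "t < 3" for t
    proof -
      have "p * p * (\<Sum>s=0..<3. xs s $ i * xs s $ ord t) = (\<Sum>s=0..<3. V $$ (s, 0) * V $$ (s, t))"
        unfolding sum_distrib_left using t ord(1) by (intro sum.cong) (auto simp: xs(2))
      also have "\<dots> = p * p * (if t = 0 then 1 else 0)" using gram[of 0 t] t by auto
      finally show ?thesis using p0 by simp
    qed
    have "(\<Sum>s=0..<3. xs s $ i * (xs s $ i + b * xs s $ j + c * xs s $ k))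
      = (\<Sum>s=0..<3. xs s $ i * xs s $ ord 0) + b * (\<Sum>s=0..<3. xs s $ i * xs s $ ord 1) + c * (\<Sum>s=0..<3. xs s $ i * xs s $ ord 2)"
      unfolding ord by (simp add: sum_distrib_left sum.distrib algebra_simps)
    then have "(\<Sum>s=0..<3. xs s $ i * (xs s $ i + b * xs s $ j + c * xs s $ k)) = 1"
      using orth[of 0] orth[of 1] orth[of 2] by simp
    moreover have "p dvd (\<Sum>s=0..<3. xs s $ i * (xs s $ i + b * xs s $ j + c * xs s $ k))"
      using xs(1) by (intro dvd_sum) (auto simp: M_def cong_sublattice_def)
    ultimately have "p dvd 1" by simp
    then show False using p by simp
  qed
qed

end

subsection \<open>Proper sublattices of the cubic lattice\<close>

text \<open>By the pigeonhole principle: x^2 and -r - y^2 with x and y from 0 to (p - 1)/2 give p +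
  1 residues. Within each of the two families they are distinct, so some residue belongs to
  both.\<close>

lemma sum_two_squares_mod:
  fixes p r :: int
  assumes p: "prime p" "odd p"
  shows "\<exists>x y. p dvd x\<^sup>2 + y\<^sup>2 + r"
proof (rule ccontr)
  assume no: "\<not> (\<exists>x y. p dvd x\<^sup>2 + y\<^sup>2 + r)"
  have p0: "0 < p" using p(1) by (simp add: prime_gt_0_int)
  define h where "h = (p - 1) div 2"
  have ph: "p = 2 * h + 1" using p(2) unfolding h_def by (auto elim: oddE)
  have h0: "0 \<le> h" using p0 ph by linarith
  have key: "x = y" if "x \<in> {0..h}" "y \<in> {0..h}" "p dvd x\<^sup>2 - y\<^sup>2" for x y
  proof -
    have "x\<^sup>2 - y\<^sup>2 = (x - y) * (x + y)" by (simp add: power2_eq_square algebra_simps)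
    then have "p dvd x - y \<or> p dvd x + y" using that(3) p(1) by (simp add: prime_dvd_mult_iff)
    then show ?thesis
    proof
      assume d: "p dvd x - y"
      show ?thesis
      proof (rule ccontr)
        assume "x \<noteq> y"
        then have "p \<le> \<bar>x - y\<bar>" using d by (intro zdvd_imp_le) auto
        then show False using that(1,2) ph by auto
      qed
    next
      assume d: "p dvd x + y"
      have "x + y = 0"
      proof (rule ccontr)
        assume "x + y \<noteq> 0"
        then have "p \<le> x + y" using d that by (intro zdvd_imp_le) auto
        then show False using that ph by simp
      qed
      then show ?thesis using that by auto
    qed
  qed
  define F :: "int \<times> bool \<Rightarrow> int" where "F u = (if snd u then - r - (fst u)\<^sup>2 else (fst u)\<^sup>2) mod p" for u
  have "card (F ` ({0..h} \<times> UNIV)) \<le> card {0..<p}" using p0 by (intro card_mono) (auto simp: F_def)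
  moreover have "card ({0..h} \<times> (UNIV :: bool set)) = nat (p + 1)" using ph h0 by (simp add: card_cartesian_product)
  ultimately have "\<not> inj_on F ({0..h} \<times> UNIV)" using card_image[of F "{0..h} \<times> UNIV"] p0 by auto
  then obtain x s y t where xy: "x \<in> {0..h}" "y \<in> {0..h}" "F (x, s) = F (y, t)" "(x, s) \<noteq> (y, t)"
    unfolding inj_on_def by auto
  have d: "p dvd (if s then - r - x\<^sup>2 else x\<^sup>2) - (if t then - r - y\<^sup>2 else y\<^sup>2)"
    using xy(3) unfolding F_def fst_conv snd_conv mod_eq_dvd_iff .
  show False
  proof (cases "s = t")
    case True
    then have "p dvd x\<^sup>2 - y\<^sup>2" using d by (cases t) (auto simp: dvd_diff_commute)
    then show ?thesis using key xy True by blast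
  next
    case False
    have "- r - x\<^sup>2 - y\<^sup>2 = - (x\<^sup>2 + y\<^sup>2 + r)" "x\<^sup>2 - (- r - y\<^sup>2) = x\<^sup>2 + y\<^sup>2 + r" by simp_all
    then show ?thesis using d False no by (cases s) (simp_all only: simp_thms if_True if_False dvd_minus_iff, blast+)
  qed
qed

lemma even_rep_large_prime:
  assumes p: "prime p" "5 \<le> p" and ijk: "{i, j, k} = {0, 1, 2}"
  shows "even_rep (cong_sublattice p b c i j k)"
proof -
  have odd: "odd p" using p prime_odd_int[of p] by simp
  obtain k1 k2 where "p dvd k1\<^sup>2 + k2\<^sup>2 + (4 + b\<^sup>2 + c\<^sup>2)" using sum_two_squares_mod[OF p(1) odd] by blast
  then obtain \<rho> where r: "k1\<^sup>2 + k2\<^sup>2 + (4 + b\<^sup>2 + c\<^sup>2) = p * \<rho>" by blast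
  have "2 * (\<rho> * ((p - 1) div 2)) = \<rho> * (p - 1)" using odd by simp
  then interpret p_sublattice p b c k1 k2 \<rho> "\<rho> * ((p - 1) div 2)" i j k
    using p r ijk by unfold_locales auto
  show ?thesis using even_rep_M unfolding M_def .
qed

section \<open>Explicit representations for the primes 2 and 3\<close>

lemma even_repI:
  assumes "additive_on M f0" "additive_on M f1" "additive_on M f2" "additive_on M f3" "additive_on M f4" "additive_on M w"
    "\<And>x. x \<in> M \<Longrightarrow> (f0 x)\<^sup>2 + (f1 x)\<^sup>2 + (f2 x)\<^sup>2 + (f3 x)\<^sup>2 + (f4 x)\<^sup>2 + 3 * (w x)\<^sup>2 = x \<bullet> x"
    "\<And>x. x \<in> M \<Longrightarrow> even (f0 x + f1 x + f2 x)"
  shows "even_rep M"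
proof -
  define g where "g r = [f0, f1, f2, f3, f4] ! r" for r
  have g: "g 0 = f0" "g 1 = f1" "g 2 = f2" "g 3 = f3" "g 4 = f4" by (simp_all add: g_def)
  have "additive_on M (g r)" if "r < 5" for r
  proof -
    have "r = 0 \<or> r = 1 \<or> r = 2 \<or> r = 3 \<or> r = 4" using that by linarith
    then show ?thesis using assms g by auto
  qed
  moreover have "(\<Sum>r<5. (g r x)\<^sup>2) + 3 * (w x)\<^sup>2 = x \<bullet> x" if "x \<in> M" for x
    unfolding sum_lessThan_5[of "\<lambda>r. (g r x)\<^sup>2"] g using assms(7)[OF that] by simp
  ultimately have "square_rep M g w" using assms by (simp add: square_rep_def)
  then show ?thesis unfolding even_rep_def using assms(8) g by metis
qed

lemma additive_on_if: "additive_on M f \<Longrightarrow> additive_on M (\<lambda>x. if P then f x else 0)"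
  by (cases P) (simp_all add: additive_on_zero)

lemma additive_on_coords:
  assumes "{i, j, k} = {0, 1, 2}" "M \<subseteq> carrier_vec 3"
  shows "additive_on M (\<lambda>x. x $ i)" "additive_on M (\<lambda>x. x $ j)" "additive_on M (\<lambda>x. x $ k)"
  using perm_3_cases[OF assms(1)] assms(2) unfolding additive_on_def by auto

lemma even_rep_mod_2:
  assumes ijk: "{i, j, k} = {0, 1, 2}"
  shows "even_rep (cong_sublattice 2 b c i j k)"
proof -
  let ?M = "cong_sublattice 2 b c i j k"
  have c: "?M \<subseteq> carrier_vec 3" by (auto simp: cong_sublattice_def)
  note ad = additive_on_coords[OF ijk c]
  let ?if = "\<lambda>P l (x :: int vec). if P then x $ l else 0"
  \<comment> \<open>Coordinates with odd coefficient go to the first three places, where the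
    congruence is the required even sum. Those with even coefficient go to the last two.\<close>
  show ?thesis
  proof (rule even_repI[of ?M "\<lambda>x. x $ i" "?if (odd b) j" "?if (odd c) k" "?if (even b) j" "?if (even c) k" "\<lambda>_. 0"])
    fix x assume "x \<in> ?M"
    then have x: "x \<in> carrier_vec 3" "even (x $ i + b * x $ j + c * x $ k)" by (auto simp: cong_sublattice_def)
    show "(x $ i)\<^sup>2 + (?if (odd b) j x)\<^sup>2 + (?if (odd c) k x)\<^sup>2 + (?if (even b) j x)\<^sup>2 + (?if (even c) k x)\<^sup>2 + 3 * 0\<^sup>2 = x \<bullet> x"
      unfolding scalar_prod_3[OF ijk x(1) x(1)] by (simp add: power2_eq_square)
    show "even (x $ i + ?if (odd b) j x + ?if (odd c) k x)" using x(2) by auto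
  qed (use ad in \<open>auto intro!: additive_on_intros intro: additive_on_if\<close>)
qed

lemma cong_sublattice_cong:
  assumes "p dvd b - b'" "p dvd c - c'"
  shows "cong_sublattice p b c i j k = cong_sublattice p b' c' i j k"
proof -
  have "p dvd x $ i + b * x $ j + c * x $ k \<longleftrightarrow> p dvd x $ i + b' * x $ j + c' * x $ k" for x
  proof -
    have "x $ i + b * x $ j + c * x $ k = (x $ i + b' * x $ j + c' * x $ k) + ((b - b') * x $ j + (c - c') * x $ k)"
      by (simp add: algebra_simps)
    moreover have "p dvd (b - b') * x $ j + (c - c') * x $ k" using assms by simp
    ultimately show ?thesis by (metis dvd_add_left_iff)
  qed
  then show ?thesis by (simp add: cong_sublattice_def)
qed

lemma even_rep_mod_3_mixed:
  assumes ijk: "{i, j, k} = {0, 1, 2}" and e: "e * e = 1"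
  shows "even_rep (cong_sublattice 3 e 0 i j k)" (is "even_rep ?M")
proof -
  have c: "?M \<subseteq> carrier_vec 3" by (auto simp: cong_sublattice_def)
  note ad = additive_on_coords[OF ijk c]
  define w where "w x = (x $ i + e * x $ j) div 3" for x
  have wa: "additive_on ?M w"
    unfolding w_def using ad by (intro additive_on_div additive_on_intros) (auto simp: cong_sublattice_def)
  \<comment> \<open>With e x_j = 3 w - x_i the two squares become 2 x_i^2 - 6 x_i w + 9 w^2, which
    equals (x_i - w)^2 + (x_i - 2 w)^2 + w^2 + 3 w^2. The first three bases add up to 2 (x_i -
    w).\<close>
  show ?thesis
  proof (rule even_repI[of ?M "\<lambda>x. x $ i - w x" "\<lambda>x. x $ i - 2 * w x" w "\<lambda>x. x $ k" "\<lambda>_. 0" w])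
    fix x assume x: "x \<in> ?M"
    then have "3 * w x = x $ i + e * x $ j" by (simp add: cong_sublattice_def w_def)
    moreover have "(x $ j)\<^sup>2 = (e * x $ j)\<^sup>2" using e by (simp add: power2_eq_square power_mult_distrib)
    ultimately have "(x $ j)\<^sup>2 = (3 * w x - x $ i)\<^sup>2" by simp
    then show "(x $ i - w x)\<^sup>2 + (x $ i - 2 * w x)\<^sup>2 + (w x)\<^sup>2 + (x $ k)\<^sup>2 + 0\<^sup>2 + 3 * (w x)\<^sup>2 = x \<bullet> x"
      using scalar_prod_3[OF ijk, of x x] c x by (auto simp: power2_eq_square algebra_simps)
  qed (use ad wa in \<open>auto intro!: additive_on_intros\<close>)
qed

lemma even_rep_mod_3:
  assumes ijk: "{i, j, k} = {0, 1, 2}"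
  shows "even_rep (cong_sublattice 3 b c i j k)"
proof -
  have "\<exists>e. (e = 0 \<or> e = 1 \<or> e = -1) \<and> 3 dvd b - e" for b :: int by presburger
  then obtain e f where e: "e = 0 \<or> e = 1 \<or> e = -1" "3 dvd b - e" and f: "f = 0 \<or> f = 1 \<or> f = -1" "3 dvd c - f" by metis
  let ?M = "cong_sublattice 3 e f i j k"
  have M: "cong_sublattice 3 b c i j k = ?M" by (rule cong_sublattice_cong[OF e(2) f(2)])
  have c: "?M \<subseteq> carrier_vec 3" by (auto simp: cong_sublattice_def)
  note ad = additive_on_coords[OF ijk c]
  define w where "w x = (x $ i + e * x $ j + f * x $ k) div 3" for x
  have w: "x $ i = 3 * w x - e * x $ j - f * x $ k" if "x \<in> ?M" for x
  proof -
    have "3 dvd x $ i + e * x $ j + f * x $ k" using that by (simp add: cong_sublattice_def)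
    then have "3 * w x = x $ i + e * x $ j + f * x $ k" unfolding w_def by simp
    then show ?thesis by simp
  qed
  have wa: "additive_on ?M w"
    unfolding w_def using ad by (intro additive_on_div additive_on_intros) (auto simp: cong_sublattice_def)
  have n: "x \<bullet> x = (x $ i)\<^sup>2 + (x $ j)\<^sup>2 + (x $ k)\<^sup>2" if "x \<in> ?M" for x
    using scalar_prod_3[OF ijk, of x x] c that by (auto simp: power2_eq_square)
  have ee: "e = 0 \<or> e * e = 1" and ff: "f = 0 \<or> f * f = 1" using e f by auto
  consider "e = 0" "f = 0" | "e \<noteq> 0" "f = 0" | "e = 0" "f \<noteq> 0" | "e \<noteq> 0" "f \<noteq> 0" by blast
  then have "even_rep ?M"
  proof cases
    case 1
    \<comment> \<open>Here x_i = 3 w, and 9 = 4 + 1 + 1 + 3.\<close>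
    show ?thesis
      by (rule even_repI[of ?M "\<lambda>x. 2 * w x" w w "\<lambda>x. x $ j" "\<lambda>x. x $ k" w])
        (use ad wa in \<open>auto intro!: additive_on_intros simp: n\<close>, simp add: w 1 power2_eq_square)
  next
    case 2
    then show ?thesis using even_rep_mod_3_mixed[OF ijk] ee by simp
  next
    case 3
    have "{i, k, j} = {0, 1, 2}" using ijk by (simp add: insert_commute)
    moreover have "?M = cong_sublattice 3 f e i k j" by (simp add: cong_sublattice_def add.commute add.left_commute)
    ultimately show ?thesis using even_rep_mod_3_mixed[of i k j f] 3 ff by simp
  next
    case 4
    then have e1: "e * e = 1" and f1: "f * f = 1" using ee ff by simp_all
    \<comment> \<open>The projection of x to the line of (1, e, f) is w (1, e, f), of norm 3 w^2.
      The orthogonal remainder has, up to the signs e and f, entries with sum 0.\<close>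
    show ?thesis
    proof (rule even_repI[of ?M "\<lambda>x. x $ i - w x" "\<lambda>x. e * x $ j - w x" "\<lambda>x. f * x $ k - w x" "\<lambda>_. 0" "\<lambda>_. 0" w])
      fix x assume x: "x \<in> ?M"
      have sq: "(e * x $ j)\<^sup>2 = (x $ j)\<^sup>2" "(f * x $ k)\<^sup>2 = (x $ k)\<^sup>2"
        using e1 f1 by (simp_all add: power2_eq_square power_mult_distrib)
      have "(x $ i - w x)\<^sup>2 + (e * x $ j - w x)\<^sup>2 + (f * x $ k - w x)\<^sup>2 + 0\<^sup>2 + 0\<^sup>2 + 3 * (w x)\<^sup>2
        = (x $ i)\<^sup>2 + (e * x $ j)\<^sup>2 + (f * x $ k)\<^sup>2 + 2 * w x * (3 * w x - (x $ i + e * x $ j + f * x $ k))"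
        by (simp add: power2_eq_square algebra_simps)
      then show "(x $ i - w x)\<^sup>2 + (e * x $ j - w x)\<^sup>2 + (f * x $ k - w x)\<^sup>2 + 0\<^sup>2 + 0\<^sup>2 + 3 * (w x)\<^sup>2 = x \<bullet> x"
        unfolding n[OF x] sq using w[OF x] by simp
      have "x $ i - w x + (e * x $ j - w x) + (f * x $ k - w x) = 0" using w[OF x] by simp
      then show "even (x $ i - w x + (e * x $ j - w x) + (f * x $ k - w x))" by simp
    qed (use ad wa in \<open>auto intro!: additive_on_intros\<close>)
  qed
  then show ?thesis unfolding M .
qed

theorem even_rep_cong_sublattice:
  assumes p: "prime p" and ijk: "{i, j, k} = {0, 1, 2}"
  shows "even_rep (cong_sublattice p b c i j k)"
proof -
  have "p \<noteq> 4"
  proof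
    assume "p = 4"
    then have "2 dvd p" by simp
    then show False using p \<open>p = 4\<close> unfolding prime_int_iff by (auto dest!: spec[of _ 2])
  qed
  then consider "p = 2" | "p = 3" | "5 \<le> p" using prime_ge_2_int[OF p] by linarith
  then show ?thesis
  proof cases
    case 1 show ?thesis unfolding 1 by (rule even_rep_mod_2[OF ijk])
  next
    case 2 show ?thesis unfolding 2 by (rule even_rep_mod_3[OF ijk])
  next
    case 3 show ?thesis by (rule even_rep_large_prime[OF p 3 ijk])
  qed
qed

lemma even_rep_subset: "even_rep M \<Longrightarrow> M' \<subseteq> M \<Longrightarrow> even_rep M'"
proof -
  assume "even_rep M" and s: "M' \<subseteq> M"
  then obtain g w where g: "square_rep M g w" "\<forall>x\<in>M. even (g 0 x + g 1 x + g 2 x)" unfolding even_rep_def by blast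
  have a: "additive_on M f \<Longrightarrow> additive_on M' f" for f using s unfolding additive_on_def by blast
  have "square_rep M' g w" using g(1) s a unfolding square_rep_def by blast
  then show "even_rep M'" unfolding even_rep_def using g(2) s by blast
qed

section \<open>Every proper subgroup satisfies a congruence modulo a prime\<close>

lemma prime_divides_proper_ideal:
  fixes I :: "int set"
  assumes add: "\<And>a b. a \<in> I \<Longrightarrow> b \<in> I \<Longrightarrow> a + b \<in> I" and mult: "\<And>a k. a \<in> I \<Longrightarrow> k * a \<in> I" and one: "1 \<notin> I"
  obtains p :: int where "prime p" "\<And>a. a \<in> I \<Longrightarrow> p dvd a"
proof (cases "I \<subseteq> {0}")
  case True
  have "\<exists>p::int. prime p" by (rule exI[of _ 2]) simp
  then obtain p :: int where "prime p" by blast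
  then show ?thesis using that True by auto
next
  case False
  then obtain a where a: "a \<in> I" "a \<noteq> 0" by blast
  define P where "P n \<longleftrightarrow> 0 < n \<and> int n \<in> I" for n
  have "P (nat \<bar>a\<bar>)" unfolding P_def using a mult[OF a(1), of "-1"] by (auto simp: abs_if)
  then have P: "P (LEAST n. P n)" "\<And>n. P n \<Longrightarrow> (LEAST n. P n) \<le> n" by (auto intro: LeastI Least_le)
  define d where "d = int (LEAST n. P n)"
  have d: "0 < d" "d \<in> I" using P(1) by (auto simp: P_def d_def)
  have dvd: "d dvd b" if "b \<in> I" for b
  proof -
    have "b mod d = b + (- (b div d)) * d" by (simp add: minus_div_mult_eq_mod[symmetric])
    then have m: "b mod d \<in> I" using add[OF that mult[OF d(2), of "- (b div d)"]] by simp
    have "b mod d = 0"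
    proof (rule ccontr)
      assume "b mod d \<noteq> 0"
      then have "0 < b mod d" using d(1) by (simp add: order_less_le)
      then have "P (nat (b mod d))" using m by (simp add: P_def)
      then have "(LEAST n. P n) \<le> nat (b mod d)" by (rule P(2))
      then have "d \<le> b mod d" using \<open>0 < b mod d\<close> by (simp add: d_def)
      then show False using pos_mod_bound[OF d(1), of b] by linarith
    qed
    then show ?thesis by (simp add: dvd_eq_mod_eq_0)
  qed
  have "\<not> is_unit d" using d one by auto
  then obtain p where "prime p" "p dvd d" using prime_divisor_exists[of d] d(1) by auto
  then show ?thesis using that dvd by (meson dvd_trans)
qed

text \<open>There is an index \<open>t\<close> such that \<open>M\<close> projects onto the
  coordinates after \<open>t\<close>, but not onto those from \<open>t\<close> on. The entries at
  \<open>t\<close> of members that vanish after \<open>t\<close> form a proper ideal, which lies in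
  some p Z. Any member of \<open>M\<close> can be cleared after \<open>t\<close> by members of
  \<open>M\<close>, and what this does to its entry at \<open>t\<close> is the congruence.\<close>

lemma proper_subgroup_in_cong_sublattice:
  assumes M: "M \<subseteq> carrier_vec 3" and add: "\<And>x y. x \<in> M \<Longrightarrow> y \<in> M \<Longrightarrow> x + y \<in> M"
    and smult: "\<And>k x. x \<in> M \<Longrightarrow> k \<cdot>\<^sub>v x \<in> M" and zero: "0\<^sub>v 3 \<in> M" and proper: "M \<noteq> carrier_vec 3"
  obtains p b c i j k where "prime p" "{i, j, k} = {0, 1, 2}" "M \<subseteq> cong_sublattice p b c i j k"
proof -
  define Q where "Q t \<longleftrightarrow> (\<forall>x \<in> carrier_vec 3. \<exists>m \<in> M. \<forall>s. t \<le> s \<longrightarrow> s < 3 \<longrightarrow> x $ s = m $ s)" for t :: nat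
  have "Q 3" using zero by (auto simp: Q_def)
  have "\<not> Q 0"
  proof
    assume q: "Q 0"
    have "carrier_vec 3 \<subseteq> M"
    proof
      fix x :: "int vec" assume x: "x \<in> carrier_vec 3"
      then obtain m where m: "m \<in> M" "\<And>s. s < 3 \<Longrightarrow> x $ s = m $ s" using q by (auto simp: Q_def)
      then have "x = m" using x M by (intro eq_vecI) auto
      then show "x \<in> M" using m by simp
    qed
    then show False using proper M by blast
  qed
  then have "\<exists>t<3. \<not> Q t \<and> Q (Suc t)" using \<open>Q 3\<close> by (auto simp: numeral_3_eq_3 less_Suc_eq)
  then obtain t where t: "t < 3" "\<not> Q t" "Q (Suc t)" by blast
  define I where "I = {m $ t | m. m \<in> M \<and> (\<forall>s. t < s \<longrightarrow> s < 3 \<longrightarrow> m $ s = 0)}"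
  have Iadd: "a + b \<in> I" if ab: "a \<in> I" "b \<in> I" for a b
  proof -
    obtain m where m: "a = m $ t" "m \<in> M" "\<forall>s. t < s \<longrightarrow> s < 3 \<longrightarrow> m $ s = 0"
      using ab(1) unfolding I_def by blast
    obtain n where n: "b = n $ t" "n \<in> M" "\<forall>s. t < s \<longrightarrow> s < 3 \<longrightarrow> n $ s = 0"
      using ab(2) unfolding I_def by blast
    have c: "m \<in> carrier_vec 3" "n \<in> carrier_vec 3" using M m n by auto
    then have "a + b = (m + n) $ t" "\<forall>s. t < s \<longrightarrow> s < 3 \<longrightarrow> (m + n) $ s = 0" using m n t by auto
    then show ?thesis unfolding I_def using add[OF m(2) n(2)] by blast
  qed
  have Imult: "k * a \<in> I" if ai: "a \<in> I" for a k
  proof -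
    obtain m where m: "a = m $ t" "m \<in> M" "\<forall>s. t < s \<longrightarrow> s < 3 \<longrightarrow> m $ s = 0" using ai unfolding I_def by blast
    have c: "m \<in> carrier_vec 3" using M m by auto
    then have "k * a = (k \<cdot>\<^sub>v m) $ t" "\<forall>s. t < s \<longrightarrow> s < 3 \<longrightarrow> (k \<cdot>\<^sub>v m) $ s = 0" using m t by auto
    then show ?thesis unfolding I_def using smult[OF m(2)] by blast
  qed
  have "1 \<notin> I"
  proof
    assume "1 \<in> I"
    then obtain e where e: "e \<in> M" "e $ t = 1" "\<And>s. t < s \<Longrightarrow> s < 3 \<Longrightarrow> e $ s = 0" by (auto simp: I_def)
    have ec: "e \<in> carrier_vec 3" using e M by auto
    have "Q t"
      unfolding Q_def
    proof
      fix x :: "int vec" assume x: "x \<in> carrier_vec 3"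
      then obtain m where m: "m \<in> M" "\<And>s. Suc t \<le> s \<Longrightarrow> s < 3 \<Longrightarrow> x $ s = m $ s" using t(3) by (auto simp: Q_def)
      have mc: "m \<in> carrier_vec 3" using m M by auto
      have "x $ s = (m + (x $ t - m $ t) \<cdot>\<^sub>v e) $ s" if "t \<le> s" "s < 3" for s
        using that m(2)[of s] e(2) e(3)[of s] ec mc by (cases "s = t") auto
      then show "\<exists>m\<in>M. \<forall>s\<ge>t. s < 3 \<longrightarrow> x $ s = m $ s" using add[OF m(1) smult[OF e(1)]] by blast
    qed
    then show False using t by simp
  qed
  then obtain p where p: "prime p" "\<And>a. a \<in> I \<Longrightarrow> p dvd a" using prime_divides_proper_ideal Iadd Imult by blast
  obtain j k where jk: "{t, j, k} = {0, 1, 2}"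
  proof -
    have "t = 0 \<or> t = 1 \<or> t = 2" using t by linarith
    then show ?thesis using that[of 1 2] that[of 0 2] that[of 0 1] by auto
  qed
  have lt: "j < 3" "k < 3" "t \<noteq> j" "t \<noteq> k" "j \<noteq> k" using perm_3_cases[OF jk] by auto
  obtain mj where mj: "mj \<in> M" "\<And>s. Suc t \<le> s \<Longrightarrow> s < 3 \<Longrightarrow> unit_vec 3 j $ s = mj $ s"
    using t(3) unfolding Q_def by (metis unit_vec_carrier)
  obtain mk where mk: "mk \<in> M" "\<And>s. Suc t \<le> s \<Longrightarrow> s < 3 \<Longrightarrow> unit_vec 3 k $ s = mk $ s"
    using t(3) unfolding Q_def by (metis unit_vec_carrier)
  have c: "mj \<in> carrier_vec 3" "mk \<in> carrier_vec 3" using mj mk M by auto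
  have "M \<subseteq> cong_sublattice p (- mj $ t) (- mk $ t) t j k"
  proof
    fix x assume x: "x \<in> M"
    have xc: "x \<in> carrier_vec 3" using x M by auto
    define y where "y = x + (- x $ j) \<cdot>\<^sub>v mj + (- x $ k) \<cdot>\<^sub>v mk"
    have y: "y \<in> M" unfolding y_def using add smult x mj(1) mk(1) by blast
    have "y $ s = 0" if s: "t < s" "s < 3" for s
    proof -
      have "s \<in> {t, j, k}" unfolding jk using s by auto
      then have "s = j \<or> s = k" using s by auto
      then show ?thesis using s mj(2)[of s] mk(2)[of s] xc c lt by (auto simp: y_def)
    qed
    then have "y $ t \<in> I" unfolding I_def using y by blast
    then have "p dvd y $ t" by (rule p(2))
    moreover have "y $ t = x $ t + (- mj $ t) * x $ j + (- mk $ t) * x $ k"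
      using xc c t by (simp add: y_def)
    ultimately show "x \<in> cong_sublattice p (- mj $ t) (- mk $ t) t j k" using xc by (simp add: cong_sublattice_def)
  qed
  with p(1) jk that show ?thesis by blast
qed

theorem even_rep_proper_subgroup:
  assumes "M \<subseteq> carrier_vec 3" "\<And>x y. x \<in> M \<Longrightarrow> y \<in> M \<Longrightarrow> x + y \<in> M"
    "\<And>k x. x \<in> M \<Longrightarrow> k \<cdot>\<^sub>v x \<in> M" "0\<^sub>v 3 \<in> M" "M \<noteq> carrier_vec 3"
  shows "even_rep M"
  using proper_subgroup_in_cong_sublattice[OF assms] even_rep_cong_sublattice even_rep_subset by metis

section \<open>The isolating lattice of rank 6\<close>

abbreviation "isolating_lat \<equiv> I_lat 2 \<bottom>\<^sub>L A3_lat \<bottom>\<^sub>L diag_lat [3]"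

lemma isolating_lat_explicit:
  "isolating_lat = mat_of_rows_list 6 [[1, 0, 0, 0, 0, 0], [0, 1, 0, 0, 0, 0],
    [0, 0, 2, -1, 0, 0], [0, 0, -1, 2, -1, 0], [0, 0, 0, -1, 2, 0], [0, 0, 0, 0, 0, 3]]" (is "_ = ?R")
proof (rule eq_matI)
  fix r s assume "r < dim_row ?R" "s < dim_col ?R"
  then have "r < 6" "s < 6" by (simp_all add: mat_of_rows_list_def)
  then have "r = 0 \<or> r = 1 \<or> r = 2 \<or> r = 3 \<or> r = 4 \<or> r = 5" "s = 0 \<or> s = 1 \<or> s = 2 \<or> s = 3 \<or> s = 4 \<or> s = 5" by linarith+
  then show "isolating_lat $$ (r, s) = ?R $$ (r, s)"
    by (elim disjE; simp add: orth_sum_def I_lat_def diag_lat_def A3_lat_def mat_of_rows_list_def mat_diag_def)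
qed (simp_all add: orth_sum_def I_lat_def diag_lat_def A3_lat_def mat_of_rows_list_def mat_diag_def)

lemma isolating_lat_rank: "lat_rank isolating_lat = 6"
  unfolding isolating_lat_explicit lat_rank_def by (simp add: mat_of_rows_list_def)

lemma isolating_lat_vecs: "lat_vecs isolating_lat = carrier_vec 6"
  unfolding lat_vecs_def isolating_lat_rank ..

lemma isolating_lat_qform:
  assumes "v \<in> carrier_vec 6"
  shows "lat_qform isolating_lat v = (v $ 0)\<^sup>2 + (v $ 1)\<^sup>2 + ((v $ 2)\<^sup>2 + (v $ 3 - v $ 2)\<^sup>2 + (v $ 4 - v $ 3)\<^sup>2 + (v $ 4)\<^sup>2) + 3 * (v $ 5)\<^sup>2"
  using assms unfolding lat_qform_def lat_bform_def isolating_lat_explicit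
  by (simp add: scalar_prod_def mat_of_rows_list_def sum_6) (simp add: numeral_eq_Suc power2_eq_square algebra_simps)

lemma I_lat_eq: "I_lat n = 1\<^sub>m n"
  by (rule eq_matI) (auto simp: I_lat_def diag_lat_def mat_diag_def)

lemma I_lat_3: "lat_rank (I_lat 3) = 3" "lat_vecs (I_lat 3) = carrier_vec 3"
  "x \<in> carrier_vec 3 \<Longrightarrow> lat_qform (I_lat 3) x = x \<bullet> x"
  unfolding I_lat_eq lat_vecs_def lat_rank_def lat_qform_def lat_bform_def by simp_all

lemma zlattice_I_lat_3: "zlattice (I_lat 3)"
  unfolding zlattice_def
proof (intro conjI ballI impI)
  fix x :: "int vec" assume "x \<in> lat_vecs (I_lat 3)" "x \<noteq> 0\<^sub>v (lat_rank (I_lat 3))"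
  then have x: "x \<in> carrier_vec 3" "x \<noteq> 0\<^sub>v 3" unfolding I_lat_3 by auto
  obtain l where "l < 3" "x $ l \<noteq> 0" using nonzero_vec_index[OF x] .
  then have "0 < x \<bullet> x"
    using x(1) unfolding scalar_prod_def by (intro sum_pos2[of _ l]) (auto simp: zero_less_mult_iff)
  then show "0 < lat_qform (I_lat 3) x" unfolding I_lat_3(3)[OF x(1)] .
qed (simp_all add: I_lat_eq transpose_one)

lemma zlattice_isolating_lat: "zlattice isolating_lat"
  unfolding zlattice_def
proof (intro conjI ballI impI)
  fix x :: "int vec" assume "x \<in> lat_vecs isolating_lat" "x \<noteq> 0\<^sub>v (lat_rank isolating_lat)"
  then have x: "x \<in> carrier_vec 6" "x \<noteq> 0\<^sub>v 6" unfolding isolating_lat_vecs isolating_lat_rank by auto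
  have "\<not> lat_qform isolating_lat x \<le> 0"
  proof
    assume "lat_qform isolating_lat x \<le> 0"
    moreover have "0 \<le> a\<^sup>2" for a :: int by simp
    ultimately have "(x $ 0)\<^sup>2 = 0" "(x $ 1)\<^sup>2 = 0" "(x $ 2)\<^sup>2 = 0" "(x $ 3 - x $ 2)\<^sup>2 = 0" "(x $ 4 - x $ 3)\<^sup>2 = 0" "(x $ 5)\<^sup>2 = 0"
      unfolding isolating_lat_qform[OF x(1)] by (smt (verit))+
    then have "x $ 0 = 0" "x $ 1 = 0" "x $ 2 = 0" "x $ 3 = 0" "x $ 4 = 0" "x $ 5 = 0" by simp_all
    then have "x = 0\<^sub>v 6" using x(1) less_6_cases by (intro eq_vecI) force+
    then show False using x(2) by simp
  qed
  then show "0 < lat_qform isolating_lat x" by simp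
next
  show "square_mat isolating_lat" unfolding isolating_lat_explicit by (simp add: mat_of_rows_list_def)
  show "isolating_lat\<^sup>T = isolating_lat"
    unfolding isolating_lat_explicit
  proof (rule eq_matI, goal_cases)
    case (1 r s)
    then have rs: "r < 6" "s < 6" by (simp_all add: mat_of_rows_list_def)
    show ?case using less_6_cases[OF rs(1)] less_6_cases[OF rs(2)]
      by (elim disjE; simp add: mat_of_rows_list_def)
  qed (simp_all add: mat_of_rows_list_def)
qed

lemma inv_monoid_vec:
  assumes "x \<in> carrier_vec n"
  shows "inv\<^bsub>monoid_vec TYPE(int) n\<^esub> x = (-1) \<cdot>\<^sub>v x"
proof -
  interpret comm_group "monoid_vec TYPE(int) n" by (rule comm_group_vec)
  show ?thesis using assms by (intro inv_equality) (auto simp: monoid_vec_def intro!: eq_vecI)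
qed

lemma sublatticeD:
  assumes "sublattice M (I_lat 3)"
  shows "M \<subseteq> carrier_vec 3" "x \<in> M \<Longrightarrow> y \<in> M \<Longrightarrow> x + y \<in> M" "0\<^sub>v 3 \<in> M" "x \<in> M \<Longrightarrow> k \<cdot>\<^sub>v x \<in> M"
proof -
  let ?G = "monoid_vec TYPE(int) 3"
  have s: "subgroup M ?G" using assms unfolding sublattice_def I_lat_3(1) .
  show c: "M \<subseteq> carrier_vec 3" using subgroup.subset[OF s] by (simp add: monoid_vec_def)
  show add: "x + y \<in> M" if "x \<in> M" "y \<in> M" for x y
    using subgroup.m_closed[OF s that] by (simp add: monoid_vec_def)
  show z: "0\<^sub>v 3 \<in> M" using subgroup.one_closed[OF s] by (simp add: monoid_vec_def)
  have neg: "(-1) \<cdot>\<^sub>v x \<in> M" if x: "x \<in> M" for x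
    using subgroup.m_inv_closed[OF s x] inv_monoid_vec[of x 3] c x by auto
  show "k \<cdot>\<^sub>v x \<in> M" if x: "x \<in> M" for x
  proof (induction k rule: int_induct[where k = 0])
    case base
    have "0 \<cdot>\<^sub>v x = 0\<^sub>v 3" using c x by (intro eq_vecI) auto
    then show ?case using z by simp
  next
    case (step1 l)
    have "(l + 1) \<cdot>\<^sub>v x = l \<cdot>\<^sub>v x + x" by (rule eq_vecI) (simp_all add: algebra_simps)
    then show ?case using add[OF step1(2) x] by simp
  next
    case (step2 l)
    have "(l - 1) \<cdot>\<^sub>v x = l \<cdot>\<^sub>v x + (-1) \<cdot>\<^sub>v x" by (rule eq_vecI) (simp_all add: algebra_simps)
    then show ?case using add[OF step2(2) neg[OF x]] by simp
  qed
qed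

lemma represents_of_even_rep:
  assumes M: "sublattice M (I_lat 3)" and g: "even_rep M"
  shows "represents isolating_lat M (I_lat 3)"
proof -
  note cl = sublatticeD[OF M]
  obtain g w where r: "square_rep M g w" and ev: "\<And>x. x \<in> M \<Longrightarrow> even (g 0 x + g 1 x + g 2 x)"
    using g unfolding even_rep_def by blast
  have ad: "additive_on M (g i)" if "i < 5" for i using r that by (simp add: square_rep_def)
  define a where "a x = (g 0 x + g 1 x + g 2 x) div 2" for x
  have a: "2 * a x = g 0 x + g 1 x + g 2 x" if "x \<in> M" for x using ev[OF that] by (simp add: a_def)
  have aa: "additive_on M a" unfolding a_def using ad ev by (intro additive_on_div additive_on_add) auto
  \<comment> \<open>\<open>a\<close>, \<open>g 0\<close>, \<open>a - g 2\<close> are the coordinates of \<open>(g 0, g 1, g 2)\<close> in \<open>D\<^sub>3\<close> for the simple roots of \<open>A\<^sub>3\<close>.\<close>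
  define fs where "fs = [g 3, g 4, a, g 0, \<lambda>x. a x - g 2 x, w]"
  have fsa: "additive_on M (fs ! l)" if "l < 6" for l
  proof -
    have "additive_on M (\<lambda>x. a x - g 2 x)" using aa ad by (intro additive_on_diff) auto
    moreover have "additive_on M w" using r by (simp add: square_rep_def)
    ultimately show ?thesis using less_6_cases[OF that] aa ad by (auto simp: fs_def)
  qed
  define \<sigma> where "\<sigma> x = vec 6 (\<lambda>l. (fs ! l) x)" for x
  have sc: "\<sigma> x \<in> carrier_vec 6" for x by (simp add: \<sigma>_def)
  show ?thesis
    unfolding represents_def
  proof (intro exI[of _ \<sigma>] conjI ballI allI)
    show "\<sigma> \<in> M \<rightarrow> lat_vecs isolating_lat" unfolding isolating_lat_vecs using sc by auto
    show "\<sigma> (x + y) = \<sigma> x + \<sigma> y" if "x \<in> M" "y \<in> M" for x y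
      using fsa that by (intro eq_vecI) (auto simp: \<sigma>_def additive_on_def)
    show "\<sigma> (k \<cdot>\<^sub>v x) = k \<cdot>\<^sub>v \<sigma> x" if "x \<in> M" for k x
      using additive_on_smult[OF fsa cl(2,4) that] by (intro eq_vecI) (auto simp: \<sigma>_def)
    show "lat_qform isolating_lat (\<sigma> x) = lat_qform (I_lat 3) x" if x: "x \<in> M" for x
    proof -
      have xc: "x \<in> carrier_vec 3" using cl(1) x by auto
      have e: "g 1 x = 2 * a x - g 0 x - g 2 x" using a[OF x] by simp
      have n: "(g 0 x)\<^sup>2 + (g 1 x)\<^sup>2 + (g 2 x)\<^sup>2 + (g 3 x)\<^sup>2 + (g 4 x)\<^sup>2 + 3 * (w x)\<^sup>2 = x \<bullet> x"
      proof -
        have "(\<Sum>i<5. (g i x)\<^sup>2) + 3 * (w x)\<^sup>2 = x \<bullet> x" using r x unfolding square_rep_def by blast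
        then show ?thesis unfolding sum_lessThan_5[of "\<lambda>i. (g i x)\<^sup>2"] .
      qed
      show ?thesis
        unfolding isolating_lat_qform[OF sc] I_lat_3(3)[OF xc] n[symmetric] e
        by (simp add: \<sigma>_def fs_def power2_eq_square algebra_simps)
    qed
  qed
qed

text \<open>The part of the norm from A_3 is even, so vectors of norm 1 lie in I_2. The image of e_0
  + e_1 + e_2 would then be a vector of I_2 of norm 3, but 3 is not a sum of two squares.\<close>

lemma not_represents_I_lat_3: "\<not> represents isolating_lat (lat_vecs (I_lat 3)) (I_lat 3)"
proof
  assume "represents isolating_lat (lat_vecs (I_lat 3)) (I_lat 3)"
  then obtain \<sigma> where s: "\<sigma> \<in> carrier_vec 3 \<rightarrow> carrier_vec 6"
    "\<And>x y. x \<in> carrier_vec 3 \<Longrightarrow> y \<in> carrier_vec 3 \<Longrightarrow> \<sigma> (x + y) = \<sigma> x + \<sigma> y"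
    "\<And>x. x \<in> carrier_vec 3 \<Longrightarrow> lat_qform isolating_lat (\<sigma> x) = x \<bullet> x"
    unfolding represents_def I_lat_3(2) isolating_lat_vecs using I_lat_3(3) by auto
  let ?e = "\<lambda>i. unit_vec 3 i :: int vec"
  have ec: "?e i \<in> carrier_vec 3" for i by simp
  have sc: "\<sigma> x \<in> carrier_vec 6" if "x \<in> carrier_vec 3" for x using s(1) that by auto
  have unit: "\<sigma> (?e i) $ l = 0" if i: "i < 3" and l: "l = 2 \<or> l = 3 \<or> l = 4 \<or> l = 5" for i l
  proof -
    define v where "v = \<sigma> (?e i)"
    define b c where "b = v $ 3 - v $ 2" and "c = v $ 4 - v $ 3"
    have "lat_qform isolating_lat v = 1" using s(3)[OF ec] i by (simp add: v_def)
    then have q: "(v $ 0)\<^sup>2 + (v $ 1)\<^sup>2 + ((v $ 2)\<^sup>2 + b\<^sup>2 + c\<^sup>2 + (v $ 4)\<^sup>2) + 3 * (v $ 5)\<^sup>2 = 1"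
      using isolating_lat_qform[OF sc[OF ec]] by (simp add: v_def b_def c_def)
    have nn: "0 \<le> a\<^sup>2" for a :: int by simp
    have "(v $ 2)\<^sup>2 + b\<^sup>2 + c\<^sup>2 + (v $ 4)\<^sup>2 = 2 * ((v $ 2)\<^sup>2 + (v $ 3)\<^sup>2 + (v $ 4)\<^sup>2 - v $ 2 * v $ 3 - v $ 3 * v $ 4)"
      by (simp add: b_def c_def power2_eq_square algebra_simps)
    moreover have "0 \<le> (v $ 2)\<^sup>2 + b\<^sup>2 + c\<^sup>2 + (v $ 4)\<^sup>2" "(v $ 2)\<^sup>2 + b\<^sup>2 + c\<^sup>2 + (v $ 4)\<^sup>2 \<le> 1"
      using q nn[of "v $ 0"] nn[of "v $ 1"] nn[of "v $ 2"] nn[of b] nn[of c] nn[of "v $ 4"] nn[of "v $ 5"] by linarith+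
    ultimately have z: "(v $ 2)\<^sup>2 + b\<^sup>2 + c\<^sup>2 + (v $ 4)\<^sup>2 = 0" by presburger
    then have "(v $ 2)\<^sup>2 = 0" "b\<^sup>2 = 0" "(v $ 4)\<^sup>2 = 0"
      using nn[of "v $ 2"] nn[of b] nn[of c] nn[of "v $ 4"] by linarith+
    moreover have "(v $ 5)\<^sup>2 = 0" using q z nn[of "v $ 0"] nn[of "v $ 1"] nn[of "v $ 5"] by linarith
    ultimately have "v $ 2 = 0" "v $ 3 = 0" "v $ 4 = 0" "v $ 5 = 0" by (simp_all add: b_def)
    then show ?thesis using l unfolding v_def by auto
  qed
  let ?u = "?e 0 + (?e 1 + ?e 2)"
  have u: "?u \<in> carrier_vec 3" by simp
  have su: "\<sigma> ?u = \<sigma> (?e 0) + (\<sigma> (?e 1) + \<sigma> (?e 2))" using s(2) ec by simp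
  have "(\<sigma> ?u $ 0)\<^sup>2 + (\<sigma> ?u $ 1)\<^sup>2 = lat_qform isolating_lat (\<sigma> ?u)"
  proof -
    have z: "\<sigma> ?u $ l = 0" if l: "l = 2 \<or> l = 3 \<or> l = 4 \<or> l = 5" for l
      unfolding su using unit[of 0, OF _ l] unit[of 1, OF _ l] unit[of 2, OF _ l] l by (auto simp: carrier_vecD[OF sc[OF ec]])
    show ?thesis unfolding isolating_lat_qform[OF sc[OF u]] using z[of 2] z[of 3] z[of 4] z[of 5] by simp
  qed
  also have "\<dots> = 3" unfolding s(3)[OF u] using scalar_prod_3[of 0 1 2 ?u ?u] u by simp
  finally have e: "(\<sigma> ?u $ 0)\<^sup>2 + (\<sigma> ?u $ 1)\<^sup>2 = 3" .
  have sq: "a\<^sup>2 mod 4 = 0 \<or> a\<^sup>2 mod 4 = 1" for a :: int using square_mod_4[of a] by auto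
  show False using e sq[of "\<sigma> ?u $ 0"] sq[of "\<sigma> ?u $ 1"] by presburger
qed

theorem isolation_isolating_lat: "isolation isolating_lat (I_lat 3)"
  unfolding isolation_def
proof (intro conjI allI impI)
  fix M assume M: "sublattice M (I_lat 3) \<and> M \<noteq> lat_vecs (I_lat 3)"
  note cl = sublatticeD[OF conjunct1[OF M]]
  have "M \<noteq> carrier_vec 3" using M I_lat_3(2) by simp
  then have "even_rep M" using even_rep_proper_subgroup[OF cl(1,2,4,3)] by blast
  then show "represents isolating_lat M (I_lat 3)" using represents_of_even_rep M by blast
qed (rule zlattice_isolating_lat zlattice_I_lat_3 not_represents_I_lat_3)+

subsection \<open>The lower bound\<close>

lemma represents_bform:
  assumes \<sigma>: "\<And>x y. x \<in> M \<Longrightarrow> y \<in> M \<Longrightarrow> \<sigma> (x + y) = \<sigma> x + \<sigma> y" "\<And>x. x \<in> M \<Longrightarrow> lat_qform L (\<sigma> x) = x \<bullet> x"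
    "\<And>x. x \<in> M \<Longrightarrow> \<sigma> x \<in> carrier_vec n"
    and M: "M \<subseteq> carrier_vec 3" "\<And>x y. x \<in> M \<Longrightarrow> y \<in> M \<Longrightarrow> x + y \<in> M"
    and L: "L \<in> carrier_mat n n" "L\<^sup>T = L" and xy: "x \<in> M" "y \<in> M"
  shows "lat_bform L (\<sigma> x) (\<sigma> y) = x \<bullet> y"
proof -
  have add: "u \<bullet> (L *\<^sub>v v) = v \<bullet> (L *\<^sub>v u)" if "u \<in> carrier_vec n" "v \<in> carrier_vec n" for u v
    by (metis L comm_scalar_prod mult_mat_vec_carrier that transpose_vec_mult_scalar)
  have c: "\<sigma> x \<in> carrier_vec n" "\<sigma> y \<in> carrier_vec n" using \<sigma>(3) xy by auto
  have c3: "x \<in> carrier_vec 3" "y \<in> carrier_vec 3" using M xy by auto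
  have "(x + y) \<bullet> (x + y) = x \<bullet> x + 2 * (x \<bullet> y) + y \<bullet> y"
    using c3 by (simp add: scalar_prod_add_distrib[of _ 3] add_scalar_prod_distrib[of _ 3] comm_scalar_prod[of y 3 x])
  moreover have "lat_qform L (\<sigma> (x + y)) = lat_qform L (\<sigma> x) + 2 * lat_bform L (\<sigma> x) (\<sigma> y) + lat_qform L (\<sigma> y)"
    unfolding \<sigma>(1)[OF xy] lat_qform_def lat_bform_def using c L add[OF c]
    by (simp add: mult_add_distrib_mat_vec[of _ n n] scalar_prod_add_distrib[of _ n] add_scalar_prod_distrib[of _ n])
  ultimately show ?thesis using \<sigma>(2) M(2) xy by simp
qed

text \<open>The first \<open>n\<close> entries of the vectors, padded with zero rows to a square
  matrix of size \<open>m\<close>, give a singular matrix, and an integral kernel vector supplies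
  the coefficients.\<close>

lemma dependent_vectors:
  fixes v :: "nat \<Rightarrow> int vec"
  assumes "n < m"
  obtains c :: "nat \<Rightarrow> int" where "\<exists>i<m. c i \<noteq> 0" "\<And>r. r < n \<Longrightarrow> (\<Sum>i=0..<m. c i * v i $ r) = 0"
proof -
  define V where "V = mat m m (\<lambda>(r, s). if r < n then v s $ r else 0)"
  have V: "V \<in> carrier_mat m m" by (simp add: V_def)
  have "V\<^sup>T *\<^sub>v unit_vec m n = 0\<^sub>v m"
    using assms by (intro eq_vecI) (auto simp: V_def scalar_prod_def sum.delta intro!: sum.neutral)
  moreover have "unit_vec m n \<noteq> (0\<^sub>v m :: int vec)" using assms by (metis index_unit_vec(1) index_zero_vec(1) zero_neq_one)
  ultimately have "det (V\<^sup>T) = 0"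
    using det_0_iff_vec_prod_zero[of "V\<^sup>T" m] V by (metis transpose_carrier_mat unit_vec_carrier)
  then have "det V = 0" using det_transpose[OF V] by simp
  then obtain w where w: "w \<in> carrier_vec m" "w \<noteq> 0\<^sub>v m" "V *\<^sub>v w = 0\<^sub>v m" using det_0_iff_vec_prod_zero[OF V] by blast
  have "\<exists>i<m. w $ i \<noteq> 0" using nonzero_vec_index[OF w(1,2)] by blast
  moreover have "(\<Sum>i=0..<m. w $ i * v i $ r) = 0" if "r < n" for r
  proof -
    have "(V *\<^sub>v w) $ r = 0" using w(3) that assms by simp
    then show ?thesis using that assms w(1) by (simp add: V_def scalar_prod_def mult.commute)
  qed
  ultimately show ?thesis using that[of "\<lambda>i. w $ i"] by blast
qed

lemma cong_sublattice_sublattice: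
  assumes ijk: "{i, j, k} = {0, 1, 2}" and p: "\<not> p dvd 1"
  shows "sublattice (cong_sublattice p b c i j k) (I_lat 3)" "cong_sublattice p b c i j k \<noteq> lat_vecs (I_lat 3)"
proof -
  let ?M = "cong_sublattice p b c i j k" and ?G = "monoid_vec TYPE(int) 3"
  have lt: "i < 3" "j < 3" "k < 3" "i \<noteq> j" "i \<noteq> k" using perm_3_cases[OF ijk] by auto
  interpret comm_group ?G by (rule comm_group_vec)
  have sub: "?M \<subseteq> carrier_vec 3" by (auto simp: cong_sublattice_def)
  have z: "0\<^sub>v 3 \<in> ?M" using lt by (simp add: cong_sublattice_def)
  have "subgroup ?M ?G"
  proof (rule subgroupI)
    show "?M \<subseteq> carrier ?G" using sub by (simp add: monoid_vec_def)
    show "?M \<noteq> {}" using z by blast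
    show "inv\<^bsub>?G\<^esub> x \<in> ?M" if x: "x \<in> ?M" for x
      using cong_sublattice_closed(2)[OF ijk x] inv_monoid_vec[of x 3] sub x by auto
    show "x \<otimes>\<^bsub>?G\<^esub> y \<in> ?M" if "x \<in> ?M" "y \<in> ?M" for x y
      using cong_sublattice_closed(1)[OF ijk that] by (simp add: monoid_vec_def)
  qed
  then show "sublattice ?M (I_lat 3)" unfolding sublattice_def I_lat_3(1) .
  have "unit_vec 3 i \<notin> ?M" using p lt by (simp add: cong_sublattice_def unit_vec_def)
  then show "?M \<noteq> lat_vecs (I_lat 3)" unfolding I_lat_3(2) by (metis unit_vec_carrier)
qed

text \<open>Here \<open>d\<^sub>i\<close> is the inner product of \<open>g\<close> with the \<open>i\<close>th simple root \<open>r\<^sub>i\<close>, the hypothesis says that \<open>g\<close>,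
  of norm \<open>9\<close>, lies in the rational span of the roots, and the conclusion is that
  \<open>g - k r\<^sub>1 - m r\<^sub>2 - l r\<^sub>3\<close> has norm \<open>1\<close>.\<close>

lemma gram_arith:
  fixes d1 d2 d3 s :: int
  assumes "36 = 3 * d1 * d1 + 4 * d2 * d2 + 3 * d3 * d3 + 4 * d1 * d2 + 2 * d1 * d3 + 4 * d2 * d3"
  obtains k m l where "9 - 2 * (k * d1 + m * d2 + l * d3) + 2 * (k * k + m * m + l * l - k * m - m * l) = 1"
proof -
  \<comment> \<open>The dual of A_3 has four classes modulo A_3, of norms 0, 3/4, 1, 3/4 modulo 2.
    As \<open>g\<close> has norm 9, only the class of norm 1 is possible. This claim excludes the
    classes of norm 3/4, and the oddness of d1 + d2 + s below excludes A_3 itself.\<close>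
  have "even (d1 + d3)"
  proof (rule ccontr)
    assume "odd (d1 + d3)"
    then obtain e where e: "d1 + d3 = 2 * e + 1" by (rule oddE)
    have "36 = 3 * (d1 + d3) * (d1 + d3) - 4 * d1 * d3 + 4 * d2 * d2 + 4 * d1 * d2 + 4 * d2 * d3"
      using assms by (simp add: algebra_simps)
    then have "36 = 4 * (3 * (e * e + e) - d1 * d3 + d2 * d2 + d1 * d2 + d2 * d3) + 3"
      unfolding e by (simp add: algebra_simps)
    then show False by presburger
  qed
  then obtain s where "d1 + d3 = 2 * s" by (rule evenE)
  then have d3: "d3 = 2 * s - d1" by simp
  have nine: "9 = 3 * s * s - d1 * (2 * s - d1) + d2 * d2 + 2 * d2 * s"
    using assms unfolding d3 by (simp add: algebra_simps)
  have "odd (d1 + d2 + s)"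
  proof
    assume "even (d1 + d2 + s)"
    then obtain a where "d1 + d2 + s = 2 * a" by (rule evenE)
    then have d1: "d1 = 2 * a - d2 - s" by simp
    have "9 = 2 * (2 * a * a + 3 * s * s + d2 * d2 + 3 * d2 * s - 2 * a * d2 - 4 * a * s)"
      using nine unfolding d1 by (simp add: algebra_simps)
    then show False by presburger
  qed
  then obtain k where "d1 + d2 + s = 2 * k + 1" by (rule oddE)
  then have d1: "d1 = 2 * k + 1 - d2 - s" by simp
  \<comment> \<open>The coefficients of \<open>g\<close> in the simple roots are k + 1/2, s + d2 and
    k + s - d1 + 1/2. Dropping the halves leaves half the sum of the first and third root, two
    orthogonal vectors of norm 2, and this has norm 1.\<close>
  show ?thesis
  proof (rule that[of k "s + d2" "k + s - d1"])
    show "9 - 2 * (k * d1 + (s + d2) * d2 + (k + s - d1) * d3)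
      + 2 * (k * k + (s + d2) * (s + d2) + (k + s - d1) * (k + s - d1) - k * (s + d2) - (s + d2) * (k + s - d1)) = 1"
      unfolding nine d3 d1 by (simp add: algebra_simps)
  qed
qed

text \<open>An opaque name, so that the simplifier leaves the index \<open>1\<close> as it is.\<close>

definition ubasis :: "nat \<Rightarrow> int vec" where "ubasis i = unit_vec 3 i"

theorem isolation_rank_ge_6:
  assumes L: "zlattice L" and rank: "lat_rank L < 6" and iso: "isolation L (I_lat 3)"
  shows False
proof -
  define n where "n = lat_rank L"
  have n6: "n < 6" using rank by (simp add: n_def)
  have Lc: "L \<in> carrier_mat n n" "L\<^sup>T = L"
    using L by (auto simp: zlattice_def n_def lat_rank_def intro: carrier_matI)
  have Lv: "lat_vecs L = carrier_vec n" by (simp add: lat_vecs_def n_def)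
  define B where "B u v = lat_bform L u v" for u v
  have Bsym: "B u v = B v u" if "u \<in> carrier_vec n" "v \<in> carrier_vec n" for u v
    unfolding B_def lat_bform_def by (metis Lc comm_scalar_prod mult_mat_vec_carrier that transpose_vec_mult_scalar)
  have Badd: "B (u + v) x = B u x + B v x" if "u \<in> carrier_vec n" "v \<in> carrier_vec n" "x \<in> carrier_vec n" for u v x
    unfolding B_def lat_bform_def using that Lc by (simp add: add_scalar_prod_distrib[of _ n])
  have Bsm: "B (k \<cdot>\<^sub>v u) x = k * B u x" if "u \<in> carrier_vec n" "x \<in> carrier_vec n" for u x k
    unfolding B_def lat_bform_def using that Lc by simp
  have Badd': "B x (u + v) = B x u + B x v" if "u \<in> carrier_vec n" "v \<in> carrier_vec n" "x \<in> carrier_vec n" for u v x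
    using Badd[OF that] Bsym[of x] that by simp
  have Bsm': "B x (k \<cdot>\<^sub>v u) = k * B x u" if "u \<in> carrier_vec n" "x \<in> carrier_vec n" for u x k
    using Bsm[OF that] Bsym[of x] that by simp
  note Bs = Badd Bsm Badd' Bsm'
  have pos: "u = 0\<^sub>v n \<or> 0 < B u u" if "u \<in> carrier_vec n" for u
    using L that unfolding zlattice_def Lv B_def lat_qform_def n_def[symmetric] by auto
  have nonneg: "0 \<le> B u u" if "u \<in> carrier_vec n" for u
  proof -
    have "B (0\<^sub>v n) (0\<^sub>v n) = 0" using Lc by (simp add: B_def lat_bform_def mult_mat_zero_vec[OF Lc(1)])
    then show ?thesis using pos[OF that] by auto
  qed
  have rep: "\<exists>\<sigma>. (\<forall>x\<in>M. \<sigma> x \<in> carrier_vec n) \<and> (\<forall>x\<in>M. \<forall>y\<in>M. B (\<sigma> x) (\<sigma> y) = x \<bullet> y)"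
    if M: "M = cong_sublattice p b c i j k" "{i, j, k} = {0, 1, 2}" "\<not> p dvd 1" for M p b c i j k
  proof -
    note s = cong_sublattice_sublattice[OF M(2,3), of b c, folded M(1)]
    then have "represents L M (I_lat 3)" using iso unfolding isolation_def by blast
    then obtain \<sigma> where \<sigma>: "\<sigma> \<in> M \<rightarrow> carrier_vec n" "\<And>x y. x \<in> M \<Longrightarrow> y \<in> M \<Longrightarrow> \<sigma> (x + y) = \<sigma> x + \<sigma> y"
      "\<And>x. x \<in> M \<Longrightarrow> lat_qform L (\<sigma> x) = lat_qform (I_lat 3) x"
      unfolding represents_def Lv by blast
    note cl = sublatticeD[OF s(1)]
    have q: "lat_qform L (\<sigma> x) = x \<bullet> x" if "x \<in> M" for x using \<sigma>(3)[OF that] I_lat_3(3) cl(1) that by auto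
    have c: "\<sigma> x \<in> carrier_vec n" if "x \<in> M" for x using \<sigma>(1) that by auto
    have "B (\<sigma> x) (\<sigma> y) = x \<bullet> y" if "x \<in> M" "y \<in> M" for x y
      unfolding B_def using represents_bform[OF \<sigma>(2) q c cl(1,2) Lc that] by blast
    then show ?thesis using c by blast
  qed
  have perms: "{2, 0, 1} = {0, 1, 2 :: nat}" "{0, 1, 2} = {0, 1, 2 :: nat}" by auto
  let ?e = ubasis
  \<comment> \<open>These are <1, 1, 9> and D_3.\<close>
  let ?M1 = "cong_sublattice 3 0 0 2 0 1" and ?M2 = "cong_sublattice 2 1 1 0 1 2"
  obtain \<sigma> where \<sigma>: "\<And>x. x \<in> ?M1 \<Longrightarrow> \<sigma> x \<in> carrier_vec n" "\<And>x y. x \<in> ?M1 \<Longrightarrow> y \<in> ?M1 \<Longrightarrow> B (\<sigma> x) (\<sigma> y) = x \<bullet> y"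
    using rep[OF refl perms(1), of 3 0 0] by auto
  obtain \<tau> where \<tau>: "\<And>x. x \<in> ?M2 \<Longrightarrow> \<tau> x \<in> carrier_vec n" "\<And>x y. x \<in> ?M2 \<Longrightarrow> y \<in> ?M2 \<Longrightarrow> B (\<tau> x) (\<tau> y) = x \<bullet> y"
    using rep[OF refl perms(2), of 2 1 1] by auto
  have m1: "?e 0 \<in> ?M1" "?e 1 \<in> ?M1" "3 \<cdot>\<^sub>v ?e 2 \<in> ?M1"
    by (auto simp: cong_sublattice_def ubasis_def)
  have m2: "?e 1 - ?e 2 \<in> ?M2" "?e 0 - ?e 1 \<in> ?M2" "?e 1 + ?e 2 \<in> ?M2"
    by (auto simp: cong_sublattice_def ubasis_def)
  define f1 f2 g where "f1 = \<sigma> (?e 0)" and "f2 = \<sigma> (?e 1)" and "g = \<sigma> (3 \<cdot>\<^sub>v ?e 2)"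
  \<comment> \<open>Simple roots of D_3, numbered along the diagram of A_3 with e_0 - e_1 in the
    middle.\<close>
  define r1 r2 r3 where "r1 = \<tau> (?e 1 - ?e 2)" and "r2 = \<tau> (?e 0 - ?e 1)" and "r3 = \<tau> (?e 1 + ?e 2)"
  have c: "f1 \<in> carrier_vec n" "f2 \<in> carrier_vec n" "g \<in> carrier_vec n" "r1 \<in> carrier_vec n" "r2 \<in> carrier_vec n" "r3 \<in> carrier_vec n"
    using \<sigma>(1) \<tau>(1) m1 m2 by (simp_all add: f1_def f2_def g_def r1_def r2_def r3_def)
  note sp = scalar_prod_3[OF perms(2)]
  have Bf: "B f1 f1 = 1" "B f2 f2 = 1" "B g g = 9" "B f1 f2 = 0" "B f1 g = 0" "B f2 g = 0"
    unfolding f1_def f2_def g_def using \<sigma>(2) m1 by (simp_all add: sp ubasis_def)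
  have Br: "B r1 r1 = 2" "B r2 r2 = 2" "B r3 r3 = 2" "B r1 r2 = -1" "B r2 r3 = -1" "B r1 r3 = 0"
    unfolding r1_def r2_def r3_def using \<tau>(2) m2 by (simp_all add: sp ubasis_def)
  \<comment> \<open>Together with \<open>f1\<close> and \<open>f2\<close> such a vector would span a
    copy of I_3.\<close>
  have no_third: False if u: "u \<in> carrier_vec n" "B u u = 1" "B u f1 = 0" "B u f2 = 0" for u
  proof -
    define \<rho> where "\<rho> x = x $ 0 \<cdot>\<^sub>v f1 + (x $ 1 \<cdot>\<^sub>v f2 + x $ 2 \<cdot>\<^sub>v u)" for x :: "int vec"
    have "represents L (lat_vecs (I_lat 3)) (I_lat 3)"
      unfolding represents_def I_lat_3(2) Lv
    proof (intro exI[of _ \<rho>] conjI ballI allI)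
      show "\<rho> \<in> carrier_vec 3 \<rightarrow> carrier_vec n" using c u by (auto simp: \<rho>_def)
      show "\<rho> (x + y) = \<rho> x + \<rho> y" if "x \<in> carrier_vec 3" "y \<in> carrier_vec 3" for x y
        using c u that by (intro eq_vecI) (auto simp: \<rho>_def algebra_simps)
      show "\<rho> (k \<cdot>\<^sub>v x) = k \<cdot>\<^sub>v \<rho> x" if "x \<in> carrier_vec 3" for k x
        using c u that by (intro eq_vecI) (auto simp: \<rho>_def algebra_simps)
      show "lat_qform L (\<rho> x) = lat_qform (I_lat 3) x" if x: "x \<in> carrier_vec 3" for x
      proof -
        have "B (\<rho> x) (\<rho> x) = x $ 0 * x $ 0 + x $ 1 * x $ 1 + x $ 2 * x $ 2"
          unfolding \<rho>_def using c u Bf Bsym[of f2 f1] Bsym[of f1 u] Bsym[of f2 u]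
          by (simp add: Bs)
        then show ?thesis unfolding I_lat_3(3)[OF x] sp[OF x x] by (simp add: lat_qform_def B_def)
      qed
    qed
    then show False using iso unfolding isolation_def by blast
  qed
  have cs: "B (u + (- B u f) \<cdot>\<^sub>v f) (u + (- B u f) \<cdot>\<^sub>v f) = B u u - B u f * B u f"
    if "u \<in> carrier_vec n" "f \<in> carrier_vec n" "B f f = 1" for u f
    using that Bsym[of f u] by (simp add: Bs algebra_simps)
  have sq: "a = 0 \<or> a = 1 \<or> a = -1" if "a * a \<le> 2" for a :: int
  proof (rule ccontr)
    assume "\<not> (a = 0 \<or> a = 1 \<or> a = -1)"
    then have "2 \<le> \<bar>a\<bar>" by linarith
    then have "2 * 2 \<le> \<bar>a\<bar> * \<bar>a\<bar>" by (intro mult_mono) auto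
    then show False using that by simp
  qed
  have move: "u = k \<cdot>\<^sub>v f + w" if "u + (- k) \<cdot>\<^sub>v f = w" "u \<in> carrier_vec n" "f \<in> carrier_vec n" for u f w and k :: int
    unfolding that(1)[symmetric] using that(2,3) by (intro eq_vecI) (auto simp: algebra_simps)
  have unit_eq: "u = B u f \<cdot>\<^sub>v f" if u: "u \<in> carrier_vec n" "f \<in> carrier_vec n" "B f f = 1" "B u u = B u f * B u f" for u f
  proof -
    have "B (u + (- B u f) \<cdot>\<^sub>v f) (u + (- B u f) \<cdot>\<^sub>v f) = 0" using cs[OF u(1-3)] u(4) by simp
    then have z: "u + (- B u f) \<cdot>\<^sub>v f = 0\<^sub>v n" using pos[of "u + (- B u f) \<cdot>\<^sub>v f"] u by auto
    show ?thesis using move[OF z u(1,2)] u by simp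
  qed
  \<comment> \<open>By Cauchy-Schwarz a vector of norm 2 has product 0, 1 or -1 with a unit vector.
    If the product with \<open>f1\<close> or \<open>f2\<close> is not 0, removing that component
    leaves a unit vector orthogonal to it. By \<open>no_third\<close> this is not orthogonal to the
    other one, so it equals the other one up to sign.\<close>
  have root: "B r f1 = 0 \<and> B r f2 = 0 \<or> r = B r f1 \<cdot>\<^sub>v f1 + B r f2 \<cdot>\<^sub>v f2 \<and> B r f1 * B r f1 = 1 \<and> B r f2 * B r f2 = 1"
    if r: "r \<in> carrier_vec n" "B r r = 2" for r
  proof -
    have one: "B r h = 0 \<or> B r h * B r h = 1" if h: "h \<in> carrier_vec n" "B h h = 1" for h
    proof -
      have "0 \<le> 2 - B r h * B r h" using cs[OF r(1) h] nonneg[of "r + (- B r h) \<cdot>\<^sub>v h"] r h by simp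
      then show ?thesis using sq[of "B r h"] by auto
    qed
    have aux: "B r f' * B r f' = 1 \<and> r = B r f \<cdot>\<^sub>v f + B r f' \<cdot>\<^sub>v f'"
      if f: "f \<in> carrier_vec n" "B f f = 1" "f' \<in> carrier_vec n" "B f' f' = 1" "B f f' = 0"
        and nz: "B r f * B r f = 1" and third: "\<And>u. u \<in> carrier_vec n \<Longrightarrow> B u u = 1 \<Longrightarrow> B u f = 0 \<Longrightarrow> B u f' = 0 \<Longrightarrow> False" for f f'
    proof -
      define u where "u = r + (- B r f) \<cdot>\<^sub>v f"
      have uc: "u \<in> carrier_vec n" using r f by (simp add: u_def)
      have uu: "B u u = 1" unfolding u_def using cs[OF r(1) f(1,2)] nz r by simp
      have uf: "B u f = 0" "B u f' = B r f'" unfolding u_def using r f by (simp_all add: Bs)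
      have "B r f' \<noteq> 0" using third[OF uc uu uf(1)] uf(2) by auto
      then have n1: "B r f' * B r f' = 1" using one[OF f(3,4)] by blast
      have "u = B u f' \<cdot>\<^sub>v f'" by (rule unit_eq[OF uc f(3,4)]) (simp add: uu uf n1)
      then have "u = B r f' \<cdot>\<^sub>v f'" unfolding uf(2) .
      then have "r + (- B r f) \<cdot>\<^sub>v f = B r f' \<cdot>\<^sub>v f'" unfolding u_def .
      then have "r = B r f \<cdot>\<^sub>v f + B r f' \<cdot>\<^sub>v f'" using move r f by blast
      then show ?thesis using n1 by blast
    qed
    have "B r f1 = 0 \<and> B r f2 = 0 \<or> B r f1 * B r f1 = 1 \<or> B r f2 * B r f2 = 1" using one[OF c(1) Bf(1)] one[OF c(2) Bf(2)] by blast
    moreover have ?thesis if "B r f1 * B r f1 = 1"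
      using aux[OF c(1) Bf(1) c(2) Bf(2,4) that] no_third that by blast
    moreover have ?thesis if h: "B r f2 * B r f2 = 1"
    proof -
      have "B f2 f1 = 0" using Bsym[of f2 f1] Bf c by simp
      then have "B r f1 * B r f1 = 1" using aux[OF c(2) Bf(2) c(1) Bf(1) _ h] no_third by blast
      then show ?thesis using aux[OF c(1) Bf(1) c(2) Bf(2,4)] no_third h by blast
    qed
    ultimately show ?thesis by blast
  qed
  \<comment> \<open>If r is a signed sum of \<open>f1\<close> and \<open>f2\<close>, its product
    with another such sum is even, and with a root orthogonal to both it is 0. The odd product -1
    between neighbours in the diagram of A_3 is thus impossible.\<close>
  have conn: "B r f1 = 0 \<and> B r f2 = 0" if r: "r \<in> carrier_vec n" "B r r = 2" and r': "r' \<in> carrier_vec n" "B r' r' = 2" and "B r r' = -1" for r r'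
  proof (rule ccontr)
    assume "\<not> ?thesis"
    then have e: "r = B r f1 \<cdot>\<^sub>v f1 + B r f2 \<cdot>\<^sub>v f2" "B r f1 * B r f1 = 1" "B r f2 * B r f2 = 1" using root[OF r] by blast+
    define a b where "a = B r f1" and "b = B r f2"
    have "B r r' = a * B f1 r' + b * B f2 r'"
      using arg_cong[OF e(1), of "\<lambda>v. B v r'"] c r' by (simp add: Bs a_def b_def)
    then have s: "a * B r' f1 + b * B r' f2 = -1" using that(5) Bsym[of f1 r'] Bsym[of f2 r'] c r' by simp
    have "a * a = 1" "b * b = 1" using e by (simp_all add: a_def b_def)
    then have o: "odd a" "odd b" by (metis even_mult_iff odd_one)+
    from root[OF r'] show False
    proof
      assume "B r' f1 = 0 \<and> B r' f2 = 0" then show False using s by simp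
    next
      assume "r' = B r' f1 \<cdot>\<^sub>v f1 + B r' f2 \<cdot>\<^sub>v f2 \<and> B r' f1 * B r' f1 = 1 \<and> B r' f2 * B r' f2 = 1"
      then have "odd (B r' f1)" "odd (B r' f2)" by (metis even_mult_iff odd_one)+
      then have "even (a * B r' f1 + b * B r' f2)" using o by simp
      then show False unfolding s by simp
    qed
  qed
  have rf: "B r1 f1 = 0" "B r1 f2 = 0" "B r2 f1 = 0" "B r2 f2 = 0" "B r3 f1 = 0" "B r3 f2 = 0"
    using conn[OF c(4) Br(1) c(5) Br(2,4)] conn[OF c(5) Br(2) c(6) Br(3,5)]
      conn[OF c(6) Br(3) c(5) Br(2)] Br(5) Bsym[OF c(6,5)] by simp_all
  define d1 d2 d3 where "d1 = B r1 g" and "d2 = B r2 g" and "d3 = B r3 g"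
  have sym: "B f2 f1 = 0" "B g f1 = 0" "B g f2 = 0" "B r2 r1 = -1" "B r3 r2 = -1" "B r3 r1 = 0"
     "B f1 r1 = 0" "B f2 r1 = 0" "B f1 r2 = 0" "B f2 r2 = 0" "B f1 r3 = 0" "B f2 r3 = 0" "B g r1 = d1" "B g r2 = d2" "B g r3 = d3"
    using Bsym[OF c(2,1)] Bsym[OF c(3,1)] Bsym[OF c(3,2)] Bsym[OF c(5,4)] Bsym[OF c(6,5)] Bsym[OF c(6,4)]
      Bsym[OF c(1,4)] Bsym[OF c(2,4)] Bsym[OF c(1,5)] Bsym[OF c(2,5)] Bsym[OF c(1,6)] Bsym[OF c(2,6)]
      Bsym[OF c(3,4)] Bsym[OF c(3,5)] Bsym[OF c(3,6)] Bf Br rf by (simp_all add: d1_def d2_def d3_def)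
  obtain t where t: "\<exists>i<6. t i \<noteq> (0::int)" "\<And>r. r < n \<Longrightarrow> (\<Sum>i=0..<6. t i * ([f1, f2, r1, r2, r3, g] ! i) $ r) = 0"
    using dependent_vectors[OF n6, of "\<lambda>i. [f1, f2, r1, r2, r3, g] ! i"] by blast
  define w where "w = t 0 \<cdot>\<^sub>v f1 + (t 1 \<cdot>\<^sub>v f2 + (t 2 \<cdot>\<^sub>v r1 + (t 3 \<cdot>\<^sub>v r2 + (t 4 \<cdot>\<^sub>v r3 + t 5 \<cdot>\<^sub>v g))))"
  have w0: "w = 0\<^sub>v n"
  proof (rule eq_vecI)
    fix r assume "r < dim_vec (0\<^sub>v n :: int vec)"
    then have r: "r < n" by simp
    show "w $ r = 0\<^sub>v n $ r"
      using t(2)[OF r] r c unfolding sum_6[of "\<lambda>i. t i * ([f1, f2, r1, r2, r3, g] ! i) $ r"] w_def by (simp add: add.assoc)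
  qed (use c in \<open>simp add: w_def\<close>)
  have Bw: "t 0 * B f1 v + (t 1 * B f2 v + (t 2 * B r1 v + (t 3 * B r2 v + (t 4 * B r3 v + t 5 * B g v)))) = 0"
    if v: "v \<in> carrier_vec n" for v
  proof -
    have "B w v = 0" unfolding w0 using v Lc by (simp add: B_def lat_bform_def)
    then show ?thesis unfolding w_def using c v by (simp add: Bs)
  qed
  have t0: "t 0 = 0" using Bw[OF c(1)] by (simp add: Bf sym rf)
  have t1: "t 1 = 0" using Bw[OF c(2)] by (simp add: Bf sym rf)
  have e2: "2 * t 2 - t 3 + t 5 * d1 = 0" using Bw[OF c(4)] by (simp add: Br sym)
  have e3: "- t 2 + 2 * t 3 - t 4 + t 5 * d2 = 0" using Bw[OF c(5)] by (simp add: Br sym)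
  have e4: "- t 3 + 2 * t 4 + t 5 * d3 = 0" using Bw[OF c(6)] by (simp add: Br sym)
  have e5: "t 2 * d1 + t 3 * d2 + t 4 * d3 + 9 * t 5 = 0" using Bw[OF c(3)] by (simp add: Bf d1_def d2_def d3_def)
  \<comment> \<open>A relation without \<open>g\<close> would be trivial because the Cartan matrix
    of A_3 is nonsingular.\<close>
  have t5: "t 5 \<noteq> 0"
  proof
    assume z: "t 5 = 0"
    then have "t 2 = 0" "t 3 = 0" "t 4 = 0" using e2 e3 e4 by simp_all
    then show False using t(1) t0 t1 z less_6_cases by (metis)
  qed
  \<comment> \<open>Four times the inverse of the Cartan matrix of A_3 has the rows (3, 2, 1), (2,
    4, 2), (1, 2, 3).\<close>
  have f2': "4 * t 2 = - t 5 * (3 * d1 + 2 * d2 + d3)" "4 * t 3 = - t 5 * (2 * d1 + 4 * d2 + 2 * d3)" "4 * t 4 = - t 5 * (d1 + 2 * d2 + 3 * d3)"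
    using e2 e3 e4 by (simp_all add: algebra_simps)
  have "4 * t 2 * d1 + 4 * t 3 * d2 + 4 * t 4 * d3 + 36 * t 5 = 0" using e5 by simp
  then have "t 5 * 36 = t 5 * (3 * d1 * d1 + 4 * d2 * d2 + 3 * d3 * d3 + 4 * d1 * d2 + 2 * d1 * d3 + 4 * d2 * d3)"
    unfolding f2' by (simp add: algebra_simps)
  then have "36 = 3 * d1 * d1 + 4 * d2 * d2 + 3 * d3 * d3 + 4 * d1 * d2 + 2 * d1 * d3 + 4 * d2 * d3"
    using t5 by (simp only: mult_cancel_left simp_thms)
  then obtain k m l where klm: "9 - 2 * (k * d1 + m * d2 + l * d3) + 2 * (k * k + m * m + l * l - k * m - m * l) = 1"
    by (rule gram_arith)
  define u where "u = g + ((- k) \<cdot>\<^sub>v r1 + ((- m) \<cdot>\<^sub>v r2 + (- l) \<cdot>\<^sub>v r3))"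
  have uc: "u \<in> carrier_vec n" using c by (simp add: u_def)
  have "B u u = 9 - 2 * (k * d1 + m * d2 + l * d3) + 2 * (k * k + m * m + l * l - k * m - m * l)"
    unfolding u_def using c by (simp add: Bs Bf Br sym d1_def[symmetric] d2_def[symmetric] d3_def[symmetric]) (simp add: algebra_simps)
  then have "B u u = 1" unfolding klm .
  moreover have "B u f1 = 0" "B u f2 = 0" unfolding u_def using c by (simp_all add: Bs sym rf)
  ultimately show False using no_third[OF uc] by blast
qed

theorem theorem3p2:
  shows "isolation (I_lat 2 \<bottom>\<^sub>L A3_lat \<bottom>\<^sub>L diag_lat [3]) (I_lat 3)
    \<and> lat_rank (I_lat 2 \<bottom>\<^sub>L A3_lat \<bottom>\<^sub>L diag_lat [3]) = 6
    \<and> (\<forall>L. zlattice L \<and> lat_rank L < 6 \<longrightarrow> \<not> isolation L (I_lat 3))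
    \<and> Iso (I_lat 3) = 6"
proof -
  have low: "\<forall>L. zlattice L \<and> lat_rank L < 6 \<longrightarrow> \<not> isolation L (I_lat 3)"
    using isolation_rank_ge_6 by blast
  have "Iso (I_lat 3) = 6"
    unfolding Iso_def
  proof (rule Least_equality)
    show "\<exists>L. isolation L (I_lat 3) \<and> lat_rank L = 6"
      using isolation_isolating_lat isolating_lat_rank by blast
    show "6 \<le> r" if "\<exists>L. isolation L (I_lat 3) \<and> lat_rank L = r" for r
      using that low unfolding isolation_def by (metis not_le)
  qed
  then show ?thesis using low isolation_isolating_lat isolating_lat_rank by blast
qed

end
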